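(* Let $\mathcal C$ be a second-countable continuous field of Hilbert–Hadamard spaces. Let $\alpha_0$ and $\alpha_1$ be two isometric actions of a group $G$ on $\mathcal C$ such that $\underline{\alpha_0}=\underline{\alpha_1}$, i.e., they induce the same action on the base space $\underline{\mathcal C}$. Let $(\Omega,\mu)$ be a standard probability space, and consider the induced actions $\beta_0:=\alpha_0^{(\Omega,\mu)}$ and $\beta_1:=\alpha_1^{(\Omega,\mu)}$ of $G$ on the randomization $\mathcal C^{(\Omega,\mu)}$. Then there is a homotopy $(\beta_t)_{t\in[0,1]}$ of isometric actions by $G$ on $\mathcal C^{(\Omega,\mu)}$ (having the given $\beta_0$ and $\beta_1$ as its endpoints) such that $\underline{\beta_0}=\underline{\beta_t}$ for any $t\in[0,1]$.
   Context: **Hilbert–Hadamard spaces.** A Hilbert–Hadamard space (HHS) is a complete geodesic CAT(0) space all of whose tangent cones (Euclidean cones over the completed spaces of directions with the angle metric) embed isometrically in Hilbert spaces. **Continuous fields.** A continuous field $\mathcal C$ of HHSs consists of a locally compact paracompact Hausdorff base space $\underline{\mathcal C}$, HHSs $(\mathcal C_z)_{z\in\underline{\mathcal C}}$ (the fibers), and a set $\Gamma_{\rm cont}(\mathcal C)\subseteq\prod_z\mathcal C_z$ of continuous sections that is: (i) closed under pointwise midpoints of two sections; (ii) pointwise dense in each fiber; (iii) mutually co-continuous: $z\mapsto d_{\mathcal C_z}(s(z),s'(z))$ is continuous for any two members ("$s,s'$ are co-continuous"); (iv) closed in the sense that any $s\in\prod_z\mathcal C_z$ co-continuous with all members is a member.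 It is second-countable if $\underline{\mathcal C}$ and all fibers are second-countable. If $\Sigma\subseteq\prod_{z\in Z}X_z$ ($Z$ locally compact paracompact Hausdorff, $X_z$ HHSs) satisfies (i) and (iii), the field generated by $\Sigma$ has base $Z$, fibers $\overline{\{s(z):s\in\Sigma\}}$, and as continuous sections all sections co-continuous with every element of $\Sigma$. **Automorphisms and actions.** An isometric continuous isomorphism $\varphi$ of $\mathcal C$ to itself consists of a homeomorphism $\underline\varphi$ of $\underline{\mathcal C}$ and isometric bijections $\varphi_z\colon\mathcal C_{\underline\varphi(z)}\to\mathcal C_z$ such that $\varphi(s):=(\varphi_z(s(\underline\varphi(z))))_z\in\Gamma_{\rm cont}(\mathcal C)$ for each $s\in\Gamma_{\rm cont}(\mathcal C)$. These form a group $\operatorname{Isom}(\mathcal C)$ with $\underline{\psi\circ\varphi}=\underline\varphi\circ\underline\psi$ and $(\psi\circ\varphi)_z=\psi_z\circ\varphi_{\underline\psi(z)}$. It is topologized by taking, at each $\varphi$, the local subbase of sets $$\{\psi:\ \underline\psi(L)\subseteq V,\ d_{\mathcal C_z}(\psi(s)(z),\varphi(s)(z))<\varepsilon\ \ \forall z\in K\},$$ with $V\subseteq\underline{\mathcal C}$ open, $L\subseteq\underline\varphi^{-1}(V)$ compact, $s\in\Gamma_{\rm cont}(\mathcal C)$, $K\subseteq\underline{\mathcal C}$ compact, $\varepsilon>0$. An isometric action of a group $G$ on $\mathcal C$ is a homomorphism $\alpha\colon G\to\operatorname{Isom}(\mathcal C)$, $g\mapsto\alpha_g$; the induced (right) action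 $\underline\alpha$ on $\underline{\mathcal C}$ is $g\mapsto\underline{\alpha_g}$. A homotopy $(\beta_t)_{t\in[0,1]}$ of isometric actions by a topological group $G$ is a family of isometric actions such that $G\times[0,1]\to\operatorname{Isom}(\mathcal C)$, $(g,t)\mapsto\beta_{t,g}$, is continuous (a group given without a topology is regarded as discrete); it is then a homotopy between $\beta_0$ and $\beta_1$. **Randomization.** Here a standard probability space $(\Omega,\mu)$ is one isomorphic, as a measure space, to $[0,1]$ with Lebesgue measure; $\Omega$ is taken to be a compact Hausdorff space and $\mu$ a regular Borel probability measure on it. For an HHS $X$, $L^2(\Omega,\mu,X)$ is the HHS of $\mu$-a.e. classes of measurable $\xi\colon\Omega\to X$ with $\int_\Omega d(\xi(\omega),x_0)^2\,d\mu(\omega)<\infty$ (for some, equivalently any, $x_0\in X$), with metric $\left(\int_\Omega d(\xi,\eta)^2\,d\mu\right)^{1/2}$. Let $\mathcal C|_{\underline{\mathcal C}\times\Omega}$ be the continuous field over $\underline{\mathcal C}\times\Omega$ with fiber $\mathcal C_z$ at $(z,\omega)$, generated by the sections $(z,\omega)\mapsto s_0(z)$, $s_0\in\Gamma_{\rm cont}(\mathcal C)$. The randomization $\mathcal C^{(\Omega,\mu)}$ is the continuous field over $\underline{\mathcal C}$ with fibers $L^2(\Omega,\mu,\mathcal C_z)$ generated by the sections $z\mapsto(\omega\mapsto s(z,\omega))$, with $s$ ranging over $\Gamma_{\rm cont}(\mathcal C|_{\underline{\mathcal C}\times\Omega})$. For an isometric action $\alpha$ of $G$ on $\mathcal C$,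 the induced isometric action $\alpha^{(\Omega,\mu)}$ of $G$ on $\mathcal C^{(\Omega,\mu)}$ has $\underline{(\alpha^{(\Omega,\mu)})_g}=\underline{\alpha_g}$ and $\big((\alpha^{(\Omega,\mu)})_g\big)_z(\xi)=(\alpha_g)_z\circ\xi$ for $\xi\in L^2(\Omega,\mu,\mathcal C_{\underline{\alpha_g}(z)})$. *)

theory Defs
  imports "HOL-Probability.Probability" "HOL-Algebra.Group"
begin

section \<open>Metric quotients\<close>

text \<open>The metric induced on the classes of an equivalence relation \<open>r\<close> on \<open>S\<close> by a pseudometric \<open>d\<close>
  on \<open>S\<close> for which \<open>r\<close> relates exactly the points at distance \<open>0\<close>.  The value \<open>0\<close> off the carrier
  is needed because the axioms of \<open>Metric_space\<close> include nonnegativity and symmetry off the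
  carrier.\<close>

definition quotient_metric :: "'a set \<Rightarrow> 'a rel \<Rightarrow> ('a \<Rightarrow> 'a \<Rightarrow> real) \<Rightarrow> 'a set metric" where
  "quotient_metric S r d =
     metric (S // r, \<lambda>A B. if A \<in> S // r \<and> B \<in> S // r
                           then d (SOME a. a \<in> A) (SOME b. b \<in> B) else 0)"

definition zero_dist_rel :: "'a set \<Rightarrow> ('a \<Rightarrow> 'a \<Rightarrow> real) \<Rightarrow> 'a rel" where
  "zero_dist_rel S d = {(a, b). a \<in> S \<and> b \<in> S \<and> d a b = 0}"

lemma
  assumes equiv: "equiv S r"
    and d_nonneg: "\<And>a b. \<lbrakk>a \<in> S; b \<in> S\<rbrakk> \<Longrightarrow> 0 \<le> d a b"
    and d_sym: "\<And>a b. \<lbrakk>a \<in> S; b \<in> S\<rbrakk> \<Longrightarrow> d a b = d b a"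
    and d_triangle: "\<And>a b c. \<lbrakk>a \<in> S; b \<in> S; c \<in> S\<rbrakk> \<Longrightarrow> d a c \<le> d a b + d b c"
    and d_zero: "\<And>a b. \<lbrakk>a \<in> S; b \<in> S\<rbrakk> \<Longrightarrow> d a b = 0 \<longleftrightarrow> (a, b) \<in> r"
  shows mspace_quotient_metric: "mspace (quotient_metric S r d) = S // r"
    and mdist_quotient_metric:
      "\<And>a b. \<lbrakk>a \<in> S; b \<in> S\<rbrakk> \<Longrightarrow> mdist (quotient_metric S r d) (r `` {a}) (r `` {b}) = d a b"
proof -
  define e where "e = (\<lambda>A::'a set. SOME a. a \<in> A)"
  define D where "D = (\<lambda>A B. if A \<in> S // r \<and> B \<in> S // r then d (e A) (e B) else 0)"
  have e_in: "e A \<in> A" and e_S: "e A \<in> S" if A: "A \<in> S // r" for A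
  proof -
    have "A \<noteq> {}" "A \<subseteq> S"
      using in_quotient_imp_non_empty[OF equiv A] in_quotient_imp_subset[OF equiv A] by auto
    then show "e A \<in> A" "e A \<in> S"
      unfolding e_def using some_in_eq[of A] by auto
  qed
  have eq_iff: "A = B \<longleftrightarrow> (e A, e B) \<in> r" if "A \<in> S // r" "B \<in> S // r" for A B
    using quotient_eq_iff[OF equiv that e_in[OF that(1)] e_in[OF that(2)]] .
  interpret Metric_space "S // r" D
  proof
    show "0 \<le> D A B" for A B by (simp add: D_def d_nonneg e_S)
    show "D A B = D B A" for A B by (simp add: D_def d_sym e_S)
    show "D A B = 0 \<longleftrightarrow> A = B" if "A \<in> S // r" "B \<in> S // r" for A B
      using that eq_iff[OF that] d_zero[OF e_S e_S, OF that] by (simp add: D_def)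
    show "D A C \<le> D A B + D B C" if "A \<in> S // r" "B \<in> S // r" "C \<in> S // r" for A B C
      using that by (simp add: D_def d_triangle e_S)
  qed
  have q: "quotient_metric S r d = metric (S // r, D)"
    unfolding quotient_metric_def D_def e_def ..
  then show "mspace (quotient_metric S r d) = S // r"
    by simp
  fix a b assume a: "a \<in> S" and b: "b \<in> S"
  have qa: "r `` {a} \<in> S // r" and qb: "r `` {b} \<in> S // r"
    using a b by (auto intro: quotientI)
  define a' b' where "a' = e (r `` {a})" and "b' = e (r `` {b})"
  have S': "a' \<in> S" "b' \<in> S" and r: "(a, a') \<in> r" "(b, b') \<in> r"
    using e_S[OF qa] e_S[OF qb] e_in[OF qa] e_in[OF qb] by (auto simp: a'_def b'_def)
  have "d a a' = 0" "d b b' = 0"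
    using r d_zero[of a a'] d_zero[of b b'] a b S' by blast+
  then have "d a' b' = d a b"
    using d_triangle[of a a' b] d_triangle[of a' b' b] d_triangle[of a' a b'] d_triangle[of a b b']
      d_sym[of a a'] d_sym[of b b'] a b S' by linarith
  moreover have "mdist (quotient_metric S r d) = D"
    using q by simp
  ultimately show "mdist (quotient_metric S r d) (r `` {a}) (r `` {b}) = d a b"
    using qa qb by (simp add: D_def a'_def b'_def)
qed


section \<open>Hilbert--Hadamard spaces\<close>

text \<open>Geodesics are parametrized proportionally to arc length on \<open>[0, 1]\<close>.\<close>

definition geodesic :: "'a metric \<Rightarrow> (real \<Rightarrow> 'a) \<Rightarrow> 'a \<Rightarrow> 'a \<Rightarrow> bool" where
  "geodesic X \<gamma> x y \<longleftrightarrow>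
     \<gamma> \<in> {0..1} \<rightarrow> mspace X \<and> \<gamma> 0 = x \<and> \<gamma> 1 = y \<and>
     (\<forall>s\<in>{0..1}. \<forall>t\<in>{0..1}. mdist X (\<gamma> s) (\<gamma> t) = \<bar>s - t\<bar> * mdist X x y)"

definition geodesic_space :: "'a metric \<Rightarrow> bool" where
  "geodesic_space X \<longleftrightarrow> (\<forall>x\<in>mspace X. \<forall>y\<in>mspace X. \<exists>\<gamma>. geodesic X \<gamma> x y)"

text \<open>\<open>p'\<close>, \<open>q'\<close>, \<open>r'\<close> form a comparison triangle in the Euclidean plane.  Any two sides of a triangle
  share a vertex, so it suffices to compare points on the two sides issuing from \<open>p\<close>.\<close>

definition CAT0 :: "'a metric \<Rightarrow> bool" where
  "CAT0 X \<longleftrightarrow> geodesic_space X \<and>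
     (\<forall>p q r \<gamma> \<gamma>'. geodesic X \<gamma> p q \<and> geodesic X \<gamma>' p r \<longrightarrow>
       (\<forall>p' q' r' :: real^2.
          dist p' q' = mdist X p q \<and> dist p' r' = mdist X p r \<and> dist q' r' = mdist X q r \<longrightarrow>
          (\<forall>s\<in>{0..1}. \<forall>t\<in>{0..1}.
             mdist X (\<gamma> s) (\<gamma>' t) \<le> dist (p' + s *\<^sub>R (q' - p')) (p' + t *\<^sub>R (r' - p')))))"

definition comparison_angle :: "'a metric \<Rightarrow> 'a \<Rightarrow> 'a \<Rightarrow> 'a \<Rightarrow> real" where
  "comparison_angle X p x y =
     arccos (((mdist X p x)\<^sup>2 + (mdist X p y)\<^sup>2 - (mdist X x y)\<^sup>2) / (2 * mdist X p x * mdist X p y))"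

definition alexandrov_angle :: "'a metric \<Rightarrow> (real \<Rightarrow> 'a) \<Rightarrow> (real \<Rightarrow> 'a) \<Rightarrow> real" where
  "alexandrov_angle X \<gamma> \<gamma>' =
     real_of_ereal (Limsup (at_right 0 \<times>\<^sub>F at_right 0)
       (\<lambda>(s, t). ereal (comparison_angle X (\<gamma> 0) (\<gamma> s) (\<gamma>' t))))"

definition directions :: "'a metric \<Rightarrow> 'a \<Rightarrow> (real \<Rightarrow> 'a) set metric" where
  "directions X x =
     (let S = {\<gamma>. \<exists>y\<in>mspace X - {x}. geodesic X \<gamma> x y}
      in quotient_metric S (zero_dist_rel S (alexandrov_angle X)) (alexandrov_angle X))"

definition metric_completion :: "'a metric \<Rightarrow> (nat \<Rightarrow> 'a) set metric" where
  "metric_completion X =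
     (let S = {u. Metric_space.MCauchy (mspace X) (mdist X) u};
          d = (\<lambda>u v. lim (\<lambda>n. mdist X (u n) (v n)))
      in quotient_metric S (zero_dist_rel S d) d)"

definition euclidean_cone :: "'a metric \<Rightarrow> (real \<times> 'a) set metric" where
  "euclidean_cone Y =
     (let S = {0..} \<times> mspace Y;
          d = (\<lambda>(s, p) (t, q). sqrt (s\<^sup>2 + t\<^sup>2 - 2 * s * t * cos (min pi (mdist Y p q))))
      in quotient_metric S (zero_dist_rel S d) d)"

abbreviation tangent_cone :: "'a metric \<Rightarrow> 'a \<Rightarrow> (real \<times> (nat \<Rightarrow> (real \<Rightarrow> 'a) set) set) set metric" where
  "tangent_cone X x \<equiv> euclidean_cone (metric_completion (directions X x))"

text \<open>The Hilbert space into which the tangent cones embed is a type \<open>'h\<close>, passed as a parameter since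
  HOL has no existential quantifier over types.  Where this notion is an assumption, a free \<open>'h\<close>
  amounts to existential quantification in that assumption; a single \<open>'h\<close> can serve for a whole
  family of spaces, as Hilbert spaces embed isometrically into any Hilbert space of larger
  dimension.\<close>

definition embeds_in_Hilbert ::
    "'h::{real_inner, complete_space} itself \<Rightarrow> 'a metric \<Rightarrow> bool" where
  "embeds_in_Hilbert _ X \<longleftrightarrow>
     (\<exists>f :: 'a \<Rightarrow> 'h. \<forall>x\<in>mspace X. \<forall>y\<in>mspace X. dist (f x) (f y) = mdist X x y)"

definition Hilbert_Hadamard ::
    "'h::{real_inner, complete_space} itself \<Rightarrow> 'a metric \<Rightarrow> bool" where
  "Hilbert_Hadamard H X \<longleftrightarrow>
     mcomplete_of X \<and> CAT0 X \<and> (\<forall>x\<in>mspace X. embeds_in_Hilbert H (tangent_cone X x))"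


section \<open>Continuous fields\<close>

definition paracompact_space :: "'z topology \<Rightarrow> bool" where
  "paracompact_space Z \<longleftrightarrow>
     (\<forall>\<U>. (\<forall>U\<in>\<U>. openin Z U) \<and> \<Union>\<U> = topspace Z \<longrightarrow>
       (\<exists>\<V>. (\<forall>V\<in>\<V>. openin Z V \<and> (\<exists>U\<in>\<U>. V \<subseteq> U)) \<and> \<Union>\<V> = topspace Z \<and>
            locally_finite_in Z \<V>))"

text \<open>All fibers are metric spaces carried by subsets of one type, and sections are extensional
  functions on the base.\<close>

record ('z, 'a) metric_field =
  base :: "'z topology"
  fiber :: "'z \<Rightarrow> 'a metric"
  sections :: "('z \<Rightarrow> 'a) set"

definition all_sections :: "'z topology \<Rightarrow> ('z \<Rightarrow> 'a metric) \<Rightarrow> ('z \<Rightarrow> 'a) set" where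
  "all_sections Z X = (\<Pi>\<^sub>E z\<in>topspace Z. mspace (X z))"

definition cocontinuous ::
    "'z topology \<Rightarrow> ('z \<Rightarrow> 'a metric) \<Rightarrow> ('z \<Rightarrow> 'a) \<Rightarrow> ('z \<Rightarrow> 'a) \<Rightarrow> bool" where
  "cocontinuous Z X s s' \<longleftrightarrow>
     continuous_map Z euclideanreal (\<lambda>z. mdist (X z) (s z) (s' z))"

definition is_midpoint :: "'a metric \<Rightarrow> 'a \<Rightarrow> 'a \<Rightarrow> 'a \<Rightarrow> bool" where
  "is_midpoint X x y m \<longleftrightarrow>
     m \<in> mspace X \<and> mdist X x m = mdist X x y / 2 \<and> mdist X y m = mdist X x y / 2"

definition midpoint_closed ::
    "'z topology \<Rightarrow> ('z \<Rightarrow> 'a metric) \<Rightarrow> ('z \<Rightarrow> 'a) set \<Rightarrow> bool" where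
  "midpoint_closed Z X \<Sigma> \<longleftrightarrow>
     (\<forall>s\<in>\<Sigma>. \<forall>s'\<in>\<Sigma>. \<forall>m\<in>all_sections Z X.
        (\<forall>z\<in>topspace Z. is_midpoint (X z) (s z) (s' z) (m z)) \<longrightarrow> m \<in> \<Sigma>)"

definition continuous_field ::
    "'h::{real_inner, complete_space} itself \<Rightarrow> ('z, 'a) metric_field \<Rightarrow> bool" where
  "continuous_field H C \<longleftrightarrow>
     locally_compact_space (base C) \<and> paracompact_space (base C) \<and> Hausdorff_space (base C) \<and>
     (\<forall>z\<in>topspace (base C). Hilbert_Hadamard H (fiber C z)) \<and>
     sections C \<subseteq> all_sections (base C) (fiber C) \<and>
     midpoint_closed (base C) (fiber C) (sections C) \<and>
     (\<forall>z\<in>topspace (base C).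
        mtopology_of (fiber C z) closure_of {s z | s. s \<in> sections C} = mspace (fiber C z)) \<and>
     (\<forall>s\<in>sections C. \<forall>s'\<in>sections C. cocontinuous (base C) (fiber C) s s') \<and>
     (\<forall>s\<in>all_sections (base C) (fiber C).
        (\<forall>s'\<in>sections C. cocontinuous (base C) (fiber C) s s') \<longrightarrow> s \<in> sections C)"

definition second_countable_field :: "('z, 'a) metric_field \<Rightarrow> bool" where
  "second_countable_field C \<longleftrightarrow>
     second_countable (base C) \<and>
     (\<forall>z\<in>topspace (base C). second_countable (mtopology_of (fiber C z)))"

definition generated_field ::
    "'z topology \<Rightarrow> ('z \<Rightarrow> 'a metric) \<Rightarrow> ('z \<Rightarrow> 'a) set \<Rightarrow> ('z, 'a) metric_field" where
  "generated_field Z X \<Sigma> =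
     (let Y = (\<lambda>z. submetric (X z) (mtopology_of (X z) closure_of {s z | s. s \<in> \<Sigma>}))
      in \<lparr>base = Z, fiber = Y,
          sections = {s \<in> all_sections Z Y. \<forall>s'\<in>\<Sigma>. cocontinuous Z X s s'}\<rparr>)"


section \<open>Automorphisms and actions\<close>

text \<open>An automorphism \<open>\<phi>\<close> is the pair of its map \<open>base_map \<phi>\<close> on the base and the family of its
  (contravariant) fiber maps \<open>fiber_map \<phi> z\<close> from the fiber at \<open>base_map \<phi> z\<close> to the fiber at \<open>z\<close>.
  All functions are extensional, so that equality of automorphisms is equality in HOL.\<close>

type_synonym ('z, 'a) field_map = "('z \<Rightarrow> 'z) \<times> ('z \<Rightarrow> 'a \<Rightarrow> 'a)"

abbreviation base_map :: "('z, 'a) field_map \<Rightarrow> 'z \<Rightarrow> 'z" where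
  "base_map \<equiv> fst"

abbreviation fiber_map :: "('z, 'a) field_map \<Rightarrow> 'z \<Rightarrow> 'a \<Rightarrow> 'a" where
  "fiber_map \<equiv> snd"

definition apply_section ::
    "('z, 'a) metric_field \<Rightarrow> ('z, 'a) field_map \<Rightarrow> ('z \<Rightarrow> 'a) \<Rightarrow> 'z \<Rightarrow> 'a" where
  "apply_section C \<phi> s = (\<lambda>z\<in>topspace (base C). fiber_map \<phi> z (s (base_map \<phi> z)))"

definition Isom :: "('z, 'a) metric_field \<Rightarrow> ('z, 'a) field_map set" where
  "Isom C = {\<phi>.
     homeomorphic_map (base C) (base C) (base_map \<phi>) \<and>
     base_map \<phi> \<in> extensional (topspace (base C)) \<and>
     fiber_map \<phi> \<in> extensional (topspace (base C)) \<and>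
     (\<forall>z\<in>topspace (base C).
        let X = fiber C (base_map \<phi> z); Y = fiber C z in
        fiber_map \<phi> z \<in> extensional (mspace X) \<and>
        bij_betw (fiber_map \<phi> z) (mspace X) (mspace Y) \<and>
        (\<forall>x\<in>mspace X. \<forall>y\<in>mspace X.
           mdist Y (fiber_map \<phi> z x) (fiber_map \<phi> z y) = mdist X x y)) \<and>
     (\<forall>s\<in>sections C. apply_section C \<phi> s \<in> sections C)}"

definition compose_maps ::
    "('z, 'a) metric_field \<Rightarrow> ('z, 'a) field_map \<Rightarrow> ('z, 'a) field_map \<Rightarrow> ('z, 'a) field_map" where
  "compose_maps C \<psi> \<phi> =
     (\<lambda>z\<in>topspace (base C). base_map \<phi> (base_map \<psi> z),
      \<lambda>z\<in>topspace (base C).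
        \<lambda>x\<in>mspace (fiber C (base_map \<phi> (base_map \<psi> z))).
          fiber_map \<psi> z (fiber_map \<phi> (base_map \<psi> z) x))"

definition Isom_group :: "('z, 'a) metric_field \<Rightarrow> ('z, 'a) field_map monoid" where
  "Isom_group C =
     \<lparr>carrier = Isom C, monoid.mult = compose_maps C,
      one = (\<lambda>z\<in>topspace (base C). z, \<lambda>z\<in>topspace (base C). \<lambda>x\<in>mspace (fiber C z). x)\<rparr>"

definition Isom_subbase :: "('z, 'a) metric_field \<Rightarrow> ('z, 'a) field_map \<Rightarrow> ('z, 'a) field_map set set" where
  "Isom_subbase C \<phi> =
     {{\<psi> \<in> Isom C. base_map \<psi> ` L \<subseteq> V \<and>
         (\<forall>z\<in>K. mdist (fiber C z) (apply_section C \<psi> s z) (apply_section C \<phi> s z) < \<epsilon>)}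
      | L V K s \<epsilon>. openin (base C) V \<and> compactin (base C) L \<and> base_map \<phi> ` L \<subseteq> V \<and>
          s \<in> sections C \<and> compactin (base C) K \<and> (0::real) < \<epsilon>}"

definition Isom_topology :: "('z, 'a) metric_field \<Rightarrow> ('z, 'a) field_map topology" where
  "Isom_topology C =
     topology (\<lambda>U. U \<subseteq> Isom C \<and>
       (\<forall>\<phi>\<in>U. \<exists>\<F>. finite \<F> \<and> \<F> \<subseteq> Isom_subbase C \<phi> \<and> Isom C \<inter> \<Inter>\<F> \<subseteq> U))"

lemma openin_Isom_topology:
  "openin (Isom_topology C) U \<longleftrightarrow> U \<subseteq> Isom C \<and>
     (\<forall>\<phi>\<in>U. \<exists>\<F>. finite \<F> \<and> \<F> \<subseteq> Isom_subbase C \<phi> \<and> Isom C \<inter> \<Inter>\<F> \<subseteq> U)"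
proof -
  let ?P = "\<lambda>U. U \<subseteq> Isom C \<and>
     (\<forall>\<phi>\<in>U. \<exists>\<F>. finite \<F> \<and> \<F> \<subseteq> Isom_subbase C \<phi> \<and> Isom C \<inter> \<Inter>\<F> \<subseteq> U)"
  have "istopology ?P"
    unfolding istopology_def
  proof (intro conjI allI impI)
    fix S T assume S: "?P S" and T: "?P T"
    show "S \<inter> T \<subseteq> Isom C" using S by blast
    show "\<forall>\<phi>\<in>S \<inter> T. \<exists>\<F>. finite \<F> \<and> \<F> \<subseteq> Isom_subbase C \<phi> \<and> Isom C \<inter> \<Inter>\<F> \<subseteq> S \<inter> T"
    proof
      fix \<phi> assume "\<phi> \<in> S \<inter> T"
      then obtain \<F> \<G> where
        "finite \<F>" "\<F> \<subseteq> Isom_subbase C \<phi>" "Isom C \<inter> \<Inter>\<F> \<subseteq> S"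
        "finite \<G>" "\<G> \<subseteq> Isom_subbase C \<phi>" "Isom C \<inter> \<Inter>\<G> \<subseteq> T"
        using S T by (metis IntD1 IntD2)
      then show "\<exists>\<F>. finite \<F> \<and> \<F> \<subseteq> Isom_subbase C \<phi> \<and> Isom C \<inter> \<Inter>\<F> \<subseteq> S \<inter> T"
        by (intro exI[of _ "\<F> \<union> \<G>"]) auto
    qed
  next
    fix \<K> assume K: "\<forall>S\<in>\<K>. ?P S"
    show "\<Union>\<K> \<subseteq> Isom C" using K by blast
    show "\<forall>\<phi>\<in>\<Union>\<K>. \<exists>\<F>. finite \<F> \<and> \<F> \<subseteq> Isom_subbase C \<phi> \<and> Isom C \<inter> \<Inter>\<F> \<subseteq> \<Union>\<K>"
      using K by (meson UnionE Sup_upper order_trans)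
  qed
  then show ?thesis
    by (simp add: Isom_topology_def topology_inverse')
qed

definition isometric_action ::
    "('g, 'm) monoid_scheme \<Rightarrow> ('z, 'a) metric_field \<Rightarrow> ('g \<Rightarrow> ('z, 'a) field_map) \<Rightarrow> bool" where
  "isometric_action G C \<alpha> \<longleftrightarrow> \<alpha> \<in> hom G (Isom_group C)"

text \<open>\<open>T\<close> is the topology of the group \<open>G\<close>.\<close>

definition homotopy_of_actions ::
    "'g topology \<Rightarrow> ('g, 'm) monoid_scheme \<Rightarrow> ('z, 'a) metric_field \<Rightarrow>
     (real \<Rightarrow> 'g \<Rightarrow> ('z, 'a) field_map) \<Rightarrow> bool" where
  "homotopy_of_actions T G C \<beta> \<longleftrightarrow>
     (\<forall>t\<in>{0..1}. isometric_action G C (\<beta> t)) \<and>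
     continuous_map (prod_topology T (top_of_set {0..1})) (Isom_topology C) (\<lambda>(g, t). \<beta> t g)"


section \<open>Randomization\<close>

definition borel_of :: "'a topology \<Rightarrow> 'a measure" where
  "borel_of X = sigma (topspace X) {U. openin X U}"

definition regular_borel_probability :: "'w topology \<Rightarrow> 'w measure \<Rightarrow> bool" where
  "regular_borel_probability \<Omega> \<mu> \<longleftrightarrow>
     prob_space \<mu> \<and> space \<mu> = topspace \<Omega> \<and> sets \<mu> = sets (borel_of \<Omega>) \<and>
     (\<forall>A\<in>sets \<mu>. emeasure \<mu> A = (SUP K\<in>{K. compactin \<Omega> K \<and> K \<subseteq> A}. emeasure \<mu> K) \<and>
                 emeasure \<mu> A = (INF U\<in>{U. openin \<Omega> U \<and> A \<subseteq> U}. emeasure \<mu> U))"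

text \<open>Isomorphism of measure spaces is understood modulo null sets.\<close>

definition measure_isomorphic :: "'a measure \<Rightarrow> 'b measure \<Rightarrow> bool" where
  "measure_isomorphic M N \<longleftrightarrow>
     (\<exists>A\<in>null_sets M. \<exists>B\<in>null_sets N. \<exists>f g.
        (let M' = restrict_space M (space M - A); N' = restrict_space N (space N - B) in
         f \<in> measurable M' N' \<and> g \<in> measurable N' M' \<and>
         (\<forall>x\<in>space M'. g (f x) = x) \<and> (\<forall>y\<in>space N'. f (g y) = y) \<and>
         (\<forall>E\<in>sets N'. emeasure M' (f -` E \<inter> space M') = emeasure N' E)))"

text \<open>Lebesgue measure is complete whereas the Borel measure \<open>\<mu>\<close> need not be, hence the completion.\<close>

definition standard_probability_space :: "'w topology \<Rightarrow> 'w measure \<Rightarrow> bool" where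
  "standard_probability_space \<Omega> \<mu> \<longleftrightarrow>
     compact_space \<Omega> \<and> Hausdorff_space \<Omega> \<and> regular_borel_probability \<Omega> \<mu> \<and>
     measure_isomorphic (completion \<mu>) (lebesgue_on {0..1::real})"

definition L2_functions :: "'w measure \<Rightarrow> 'a metric \<Rightarrow> ('w \<Rightarrow> 'a) set" where
  "L2_functions \<mu> X =
     {\<xi> \<in> measurable \<mu> (borel_of (mtopology_of X)).
        \<exists>x0\<in>mspace X. integrable \<mu> (\<lambda>\<omega>. (mdist X (\<xi> \<omega>) x0)\<^sup>2)}"

definition L2_rel :: "'w measure \<Rightarrow> 'a metric \<Rightarrow> ('w \<Rightarrow> 'a) rel" where
  "L2_rel \<mu> X = {(\<xi>, \<eta>). \<xi> \<in> L2_functions \<mu> X \<and> \<eta> \<in> L2_functions \<mu> X \<and> (AE \<omega> in \<mu>. \<xi> \<omega> = \<eta> \<omega>)}"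

definition L2_class :: "'w measure \<Rightarrow> 'a metric \<Rightarrow> ('w \<Rightarrow> 'a) \<Rightarrow> ('w \<Rightarrow> 'a) set" where
  "L2_class \<mu> X \<xi> = L2_rel \<mu> X `` {\<xi>}"

definition L2_space :: "'w measure \<Rightarrow> 'a metric \<Rightarrow> ('w \<Rightarrow> 'a) set metric" where
  "L2_space \<mu> X =
     quotient_metric (L2_functions \<mu> X) (L2_rel \<mu> X)
       (\<lambda>\<xi> \<eta>. sqrt (\<integral>\<omega>. (mdist X (\<xi> \<omega>) (\<eta> \<omega>))\<^sup>2 \<partial>\<mu>))"

definition product_field :: "'w topology \<Rightarrow> ('z, 'a) metric_field \<Rightarrow> ('z \<times> 'w, 'a) metric_field" where
  "product_field \<Omega> C =
     generated_field (prod_topology (base C) \<Omega>) (\<lambda>(z, \<omega>). fiber C z)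
       {restrict (\<lambda>(z, \<omega>). s z) (topspace (prod_topology (base C) \<Omega>)) | s. s \<in> sections C}"

definition randomization ::
    "'w topology \<Rightarrow> 'w measure \<Rightarrow> ('z, 'a) metric_field \<Rightarrow> ('z, ('w \<Rightarrow> 'a) set) metric_field" where
  "randomization \<Omega> \<mu> C =
     generated_field (base C) (\<lambda>z. L2_space \<mu> (fiber C z))
       {\<lambda>z\<in>topspace (base C). L2_class \<mu> (fiber C z) (\<lambda>\<omega>. s (z, \<omega>))
        | s. s \<in> sections (product_field \<Omega> C)}"

definition randomized_map ::
    "'w topology \<Rightarrow> 'w measure \<Rightarrow> ('z, 'a) metric_field \<Rightarrow> ('z, 'a) field_map \<Rightarrow>
     ('z, ('w \<Rightarrow> 'a) set) field_map" where
  "randomized_map \<Omega> \<mu> C \<phi> =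
     (base_map \<phi>,
      \<lambda>z\<in>topspace (base C).
        \<lambda>c\<in>mspace (fiber (randomization \<Omega> \<mu> C) (base_map \<phi> z)).
          L2_class \<mu> (fiber C z) (fiber_map \<phi> z \<circ> (SOME \<xi>. \<xi> \<in> c)))"

definition randomized_action ::
    "'w topology \<Rightarrow> 'w measure \<Rightarrow> ('z, 'a) metric_field \<Rightarrow> ('g \<Rightarrow> ('z, 'a) field_map) \<Rightarrow>
     'g \<Rightarrow> ('z, ('w \<Rightarrow> 'a) set) field_map" where
  "randomized_action \<Omega> \<mu> C \<alpha> g = randomized_map \<Omega> \<mu> C (\<alpha> g)"

end

theory Submission
  imports Defs
begin

text \<open>
  Fix a family, increasing up to null sets, of measurable sets \<open>A t\<close> in \<open>\<Omega>\<close> with \<open>\<mu> (A t) = t\<close>, and let \<open>\<beta> t g\<close> act on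
  \<open>\<xi>\<close> in \<open>L\<^sup>2(\<Omega>, \<mu>, C\<^sub>z)\<close> by applying \<open>\<alpha>\<^sub>1 g\<close> to the values of \<open>\<xi>\<close> on \<open>A t\<close> and \<open>\<alpha>\<^sub>0 g\<close> to those off \<open>A t\<close>.
  This is an isometric action since both actions cover the same action on the base, and it is
  continuous in \<open>t\<close> because \<open>\<mu> (A s \<triangle> A t) = \<bar>s - t\<bar>\<close>.  The point is that \<open>\<beta> t g\<close> preserves continuous
  sections although it glues two continuous sections along a merely measurable set: up to a set
  of small measure \<open>A t\<close> is cut out by a continuous function \<open>f\<close> on \<open>\<Omega>\<close>, and moving along the geodesic
  from one section to the other by the ratio \<open>f \<omega>\<close> is continuous by the CAT(0) inequality.
\<close>

section \<open>Geodesics in CAT(0) spaces\<close>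

text \<open>Under \<open>\<beta> t g\<close> the class of a continuous product section in general
  stops being such a class, while the randomization is known only through these classes: its fibers
  are closures of their values, its sections are tested by co-continuity with them. So membership is
  always proved by approximation: whatever is locally uniformly close to sections co-continuous with
  \<open>\<sigma>\<close> is co-continuous with \<open>\<sigma>\<close>. To test the image of a
  section against a class, the class is carried back by the inverse map and approximated there.
  Hence automorphisms travel in pairs with their inverses, supplied by the action at the inverse
  group element. Second countable fibers make the distance of two measurable maps measurable.
  Compactness of \<open>\<Omega>\<close> bounds the distance of two continuous product sections by
  some \<open>M\<close> near each base point, so altering the gluing on a set of measure
  \<open>\<delta>\<close> costs at most \<open>M * sqrt \<delta>\<close> in L2. Midpoints are the
  only convexity among the axioms of a field; other ratios are reached through closedness.\<close>

lemma euclidean_comparison_triangle: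
  fixes a b c :: real
  assumes "0 \<le> a" "0 \<le> b" "0 \<le> c" "c \<le> a + b" "a \<le> b + c" "b \<le> a + c"
  obtains p q r :: "real^2" where "dist p q = a" "dist p r = b" "dist q r = c"
proof (cases "a = 0")
  case True
  then have "b = c" using assms by linarith
  then show ?thesis
    using True assms that[of 0 0 "b *\<^sub>R axis 1 1"] by (simp add: norm_axis_1)
next
  case False
  then have a: "0 < a" using assms by simp
  \<comment> \<open>The law of cosines: with \<open>p\<close> at the origin and \<open>q\<close> at
    \<open>(a, 0)\<close>, this is the first coordinate of \<open>r\<close>. The triangle
    inequalities amount to \<open>\<bar>x\<bar> \<le> b\<close>, which leaves room for a height
    \<open>y\<close>.\<close>
  define x where "x = (a\<^sup>2 + b\<^sup>2 - c\<^sup>2) / (2 * a)"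
  have ax: "2 * a * x = a\<^sup>2 + b\<^sup>2 - c\<^sup>2" using a by (simp add: x_def)
  have "c\<^sup>2 \<le> (a + b)\<^sup>2" using assms by (intro power_mono) auto
  then have "2 * a * (-b) \<le> 2 * a * x" unfolding ax by (simp add: power2_eq_square algebra_simps)
  then have 1: "- b \<le> x" using a mult_le_cancel_left_pos[of "2 * a" "- b" x] by simp
  have "\<bar>a - b\<bar>\<^sup>2 \<le> c\<^sup>2" using assms by (intro power_mono) auto
  then have "2 * a * x \<le> 2 * a * b" unfolding ax by (simp add: power2_eq_square algebra_simps)
  then have 2: "x \<le> b" using a by simp
  have "x\<^sup>2 \<le> b\<^sup>2" using 1 2 by (simp add: abs_le_square_iff[symmetric] abs_if)
  then obtain y where y: "y\<^sup>2 = b\<^sup>2 - x\<^sup>2" by (metis diff_ge_0_iff_ge real_sqrt_pow2)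
  define v :: "real \<Rightarrow> real \<Rightarrow> real^2" where "v = (\<lambda>u w. \<chi> i. if i = 1 then u else w)"
  have v: "dist (v u w) (v u' w') = sqrt ((u - u')\<^sup>2 + (w - w')\<^sup>2)" for u w u' w'
    by (simp add: v_def dist_vec_def L2_set_def UNIV_2 dist_real_def)
  have "(a - x)\<^sup>2 + y\<^sup>2 = c\<^sup>2" using y ax by (simp add: power2_eq_square algebra_simps)
  then show ?thesis
    using y assms by (intro that[of "v 0 0" "v a 0" "v x y"]) (simp_all add: v)
qed

text \<open>\<open>CAT0\<close> speaks of every comparison triangle, so one has to exist before it
  says anything. At equal ratios the comparison points are images of \<open>q'\<close> and
  \<open>r'\<close> under one homothety centred at the common vertex.\<close>

lemma mdist_geodesic_le:
  assumes X: "CAT0 X" and g: "geodesic X \<gamma> p q" and h: "geodesic X \<gamma>' p r" and t: "t \<in> {0..1}"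
  shows "mdist X (\<gamma> t) (\<gamma>' t) \<le> t * mdist X q r"
proof -
  have pqr: "p \<in> mspace X" "q \<in> mspace X" "r \<in> mspace X"
    using g h by (auto simp: geodesic_def Pi_iff)
  obtain p' q' r' :: "real^2" where
    *: "dist p' q' = mdist X p q" "dist p' r' = mdist X p r" "dist q' r' = mdist X q r"
  proof (rule euclidean_comparison_triangle)
    show "mdist X q r \<le> mdist X p q + mdist X p r" "mdist X p q \<le> mdist X p r + mdist X q r"
      "mdist X p r \<le> mdist X p q + mdist X q r"
      using mdist_triangle[of q X p r] mdist_triangle[of p X r q] mdist_triangle[of p X q r]
        pqr by (simp_all add: mdist_commute)
  qed auto
  have "mdist X (\<gamma> t) (\<gamma>' t) \<le> dist (p' + t *\<^sub>R (q' - p')) (p' + t *\<^sub>R (r' - p'))"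
    using X g h * t unfolding CAT0_def by blast
  also have "\<dots> = norm (t *\<^sub>R (q' - r'))"
    by (simp add: dist_norm algebra_simps)
  also have "\<dots> = t * mdist X q r"
    using t * by (simp add: dist_norm)
  finally show ?thesis .
qed

text \<open>Geodesics of a CAT(0) space are determined by their endpoints, so on the unit interval
  the choice is harmless; outside it the value is unspecified.\<close>

definition geodesic_point :: "'a metric \<Rightarrow> 'a \<Rightarrow> 'a \<Rightarrow> real \<Rightarrow> 'a" where
  "geodesic_point X x y = (SOME \<gamma>. geodesic X \<gamma> x y)"

lemma geodesic_geodesic_point:
  assumes "CAT0 X" "x \<in> mspace X" "y \<in> mspace X"
  shows "geodesic X (geodesic_point X x y) x y"
  unfolding geodesic_point_def
  using assms by (intro someI_ex[of "\<lambda>\<gamma>. geodesic X \<gamma> x y"]) (auto simp: CAT0_def geodesic_space_def)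

lemma geodesic_reverse:
  assumes g: "geodesic X \<gamma> x y"
  shows "geodesic X (\<lambda>t. \<gamma> (1 - t)) y x"
  unfolding geodesic_def
proof (intro conjI ballI)
  fix s t :: real assume st: "s \<in> {0..1}" "t \<in> {0..1}"
  then have "1 - s \<in> {0..1}" "1 - t \<in> {0..1}" by auto
  then have "mdist X (\<gamma> (1 - s)) (\<gamma> (1 - t)) = \<bar>(1 - s) - (1 - t)\<bar> * mdist X x y"
    using g unfolding geodesic_def by blast
  then show "mdist X (\<gamma> (1 - s)) (\<gamma> (1 - t)) = \<bar>s - t\<bar> * mdist X y x"
    by (simp add: mdist_commute abs_minus_commute)
qed (use g in \<open>auto simp: geodesic_def Pi_iff\<close>)

lemma geodesic_point_in: "\<lbrakk>CAT0 X; x \<in> mspace X; y \<in> mspace X; t \<in> {0..1}\<rbrakk> \<Longrightarrow> geodesic_point X x y t \<in> mspace X"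
  using geodesic_geodesic_point by (fastforce simp: geodesic_def)

lemma mdist_geodesic_point_same:
  "\<lbrakk>CAT0 X; x \<in> mspace X; y \<in> mspace X; s \<in> {0..1}; t \<in> {0..1}\<rbrakk>
    \<Longrightarrow> mdist X (geodesic_point X x y s) (geodesic_point X x y t) = \<bar>s - t\<bar> * mdist X x y"
  using geodesic_geodesic_point[of X x y] by (auto simp: geodesic_def)

text \<open>One endpoint is moved at a time: first \<open>q\<close> with \<open>p\<close> fixed,
  then \<open>p\<close> with \<open>q'\<close> fixed, the latter on reversed geodesics so that the
  fixed end is again the starting point. The factors \<open>t\<close> and \<open>1 - t\<close> are
  dropped to get a bound uniform in the ratio.\<close>

lemma mdist_geodesic_point_le:
  assumes X: "CAT0 X" and m: "p \<in> mspace X" "q \<in> mspace X" "p' \<in> mspace X" "q' \<in> mspace X"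
    and t: "t \<in> {0..1}"
  shows "mdist X (geodesic_point X p q t) (geodesic_point X p' q' t)
    \<le> mdist X p p' + mdist X q q'"
proof -
  note g = geodesic_geodesic_point[OF X]
  have t': "1 - t \<in> {0..1}" using t by auto
  have "mdist X (geodesic_point X p q t) (geodesic_point X p q' t) \<le> t * mdist X q q'"
    using mdist_geodesic_le[OF X g g t] m by blast
  also have "\<dots> \<le> mdist X q q'"
    using t by (simp add: mult_left_le_one_le)
  finally have 1: "mdist X (geodesic_point X p q t) (geodesic_point X p q' t) \<le> mdist X q q'" .
  have "mdist X (geodesic_point X p q' t) (geodesic_point X p' q' t) \<le> (1 - t) * mdist X p p'"
    using mdist_geodesic_le[OF X geodesic_reverse geodesic_reverse t', OF g g, of p q' p'] m by simp
  also have "\<dots> \<le> mdist X p p'"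
    using t by (simp add: mult_left_le_one_le)
  finally have 2: "mdist X (geodesic_point X p q' t) (geodesic_point X p' q' t) \<le> mdist X p p'" .
  show ?thesis
    using 1 2 mdist_triangle[of "geodesic_point X p q t" X "geodesic_point X p q' t" "geodesic_point X p' q' t"]
      geodesic_point_in[OF X] m t by fastforce
qed

section \<open>Co-continuity under local approximation\<close>

lemma continuous_map_euclideanreal_iff:
  "continuous_map Z euclideanreal f \<longleftrightarrow>
    (\<forall>z\<in>topspace Z. \<forall>\<epsilon>>0. \<exists>U. openin Z U \<and> z \<in> U \<and> (\<forall>y\<in>U. \<bar>f y - f z\<bar> < \<epsilon>))"
  using Met_TC.continuous_map_to_metric[of Z f]
  by (simp add: dist_real_def abs_minus_commute)

lemma cocontinuous_commute: "cocontinuous Z X s s' \<longleftrightarrow> cocontinuous Z X s' s"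
  by (simp add: cocontinuous_def mdist_commute)

text \<open>Distance to \<open>\<sigma> z\<close> is 1-Lipschitz, so local uniform limits of
  co-continuous sections are co-continuous. The approximant may depend on the point and on
  \<open>\<epsilon>\<close>, and its closeness to \<open>\<tau>\<close> matters only on the
  neighbourhood \<open>U\<close>.\<close>

lemma cocontinuous_approx:
  assumes \<sigma>: "\<And>z. z \<in> topspace Z \<Longrightarrow> \<sigma> z \<in> mspace (X z)"
    and \<tau>: "\<And>z. z \<in> topspace Z \<Longrightarrow> \<tau> z \<in> mspace (X z)"
    and approx: "\<And>z0 \<epsilon>. \<lbrakk>z0 \<in> topspace Z; 0 < \<epsilon>\<rbrakk> \<Longrightarrow>
      \<exists>\<tau>' U. openin Z U \<and> z0 \<in> U \<and> cocontinuous Z X \<sigma> \<tau>' \<and>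
        (\<forall>z\<in>U. \<tau>' z \<in> mspace (X z) \<and> mdist (X z) (\<tau> z) (\<tau>' z) < \<epsilon>)"
  shows "cocontinuous Z X \<sigma> \<tau>"
  unfolding cocontinuous_def continuous_map_euclideanreal_iff
proof (intro ballI allI impI)
  fix z0 and \<epsilon> :: real assume z0: "z0 \<in> topspace Z" and \<epsilon>: "0 < \<epsilon>"
  then obtain \<tau>' U where U: "openin Z U" "z0 \<in> U" and c: "cocontinuous Z X \<sigma> \<tau>'"
    and a: "\<And>z. z \<in> U \<Longrightarrow> \<tau>' z \<in> mspace (X z) \<and> mdist (X z) (\<tau> z) (\<tau>' z) < \<epsilon> / 3"
    using approx[of z0 "\<epsilon> / 3"] by auto
  obtain V where V: "openin Z V" "z0 \<in> V"
    and b: "\<And>z. z \<in> V \<Longrightarrow> \<bar>mdist (X z) (\<sigma> z) (\<tau>' z) - mdist (X z0) (\<sigma> z0) (\<tau>' z0)\<bar> < \<epsilon> / 3"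
    using c z0 \<epsilon> unfolding cocontinuous_def continuous_map_euclideanreal_iff
    by (metis divide_pos_pos zero_less_numeral)
  have near: "\<bar>mdist (X z) (\<sigma> z) (\<tau> z) - mdist (X z) (\<sigma> z) (\<tau>' z)\<bar> < \<epsilon> / 3" if "z \<in> U" for z
  proof -
    have "z \<in> topspace Z" using U(1) that openin_subset by blast
    then have "\<sigma> z \<in> mspace (X z)" "\<tau> z \<in> mspace (X z)" "\<tau>' z \<in> mspace (X z)"
      using \<sigma> \<tau> a that by auto
    then show ?thesis
      using mdist_triangle[of "\<sigma> z" "X z" "\<tau> z" "\<tau>' z"] mdist_triangle[of "\<sigma> z" "X z" "\<tau>' z" "\<tau> z"]
        a[OF that] mdist_commute[of "X z" "\<tau>' z" "\<tau> z"] by linarith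
  qed
  have "\<bar>mdist (X z) (\<sigma> z) (\<tau> z) - mdist (X z0) (\<sigma> z0) (\<tau> z0)\<bar> < \<epsilon>" if "z \<in> U \<inter> V" for z
    using b[OF IntD2[OF that]] near[OF IntD1[OF that]] near[OF U(2)] by linarith
  then show "\<exists>W. openin Z W \<and> z0 \<in> W \<and>
      (\<forall>z\<in>W. \<bar>mdist (X z) (\<sigma> z) (\<tau> z) - mdist (X z0) (\<sigma> z0) (\<tau> z0)\<bar> < \<epsilon>)"
    using U V by (intro exI[of _ "U \<inter> V"]) auto
qed

text \<open>A missing point would lie in a gap whose two ends belong to \<open>D\<close>; the
  midpoint of the ends belongs to \<open>D\<close> as well and falls inside the gap.\<close>

lemma closed_midpoint_convex_unit_interval:
  fixes D :: "real set"
  assumes D: "closed D" "D \<subseteq> {0..1}" "0 \<in> D" "1 \<in> D"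
    and mid: "\<And>s t. \<lbrakk>s \<in> D; t \<in> D\<rbrakk> \<Longrightarrow> (s + t) / 2 \<in> D"
  shows "D = {0..1}"
proof -
  have "t \<in> D" if t: "t \<in> {0..1}" for t
  proof (rule ccontr)
    assume "t \<notin> D"
    define a b where "a = Sup (D \<inter> {..t})" and "b = Inf (D \<inter> {t..})"
    have "a \<in> D \<inter> {..t}" unfolding a_def
      using D t by (intro closed_contains_Sup) auto
    moreover have "b \<in> D \<inter> {t..}" unfolding b_def
      using D t by (intro closed_contains_Inf) auto
    ultimately have ab: "a \<in> D" "b \<in> D" "a < t" "t < b"
      using \<open>t \<notin> D\<close> by (auto simp: less_le)
    have m: "(a + b) / 2 \<in> D" using mid ab by blast
    show False
    proof (cases "(a + b) / 2 \<le> t")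
      case True
      then have "(a + b) / 2 \<le> a"
        using m unfolding a_def by (intro cSup_upper) auto
      then show False using ab by simp
    next
      case False
      then have "b \<le> (a + b) / 2"
        using m unfolding b_def by (intro cInf_lower) auto
      then show False using ab by simp
    qed
  qed
  then show ?thesis using D by blast
qed

section \<open>Spaces of square integrable functions\<close>

text \<open>\<open>w\<close> carries no measurability assumption: only the dominating side has to be
  integrable, since the Bochner integral of a non-integrable function is 0. Products
  \<open>u x * v x\<close> are avoided by a weighted form of the inequality between squares.\<close>

lemma L2_minkowski:
  fixes u v w :: "'b \<Rightarrow> real"
  assumes u: "integrable M (\<lambda>x. (u x)\<^sup>2)" and v: "integrable M (\<lambda>x. (v x)\<^sup>2)"
    and le: "\<And>x. x \<in> space M \<Longrightarrow> 0 \<le> w x \<and> w x \<le> u x + v x"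
  shows "sqrt (\<integral>x. (w x)\<^sup>2 \<partial>M) \<le> sqrt (\<integral>x. (u x)\<^sup>2 \<partial>M) + sqrt (\<integral>x. (v x)\<^sup>2 \<partial>M)"
proof (rule field_le_epsilon)
  fix e :: real assume e: "0 < e"
  define I J where "I = (\<integral>x. (u x)\<^sup>2 \<partial>M)" and "J = (\<integral>x. (v x)\<^sup>2 \<partial>M)"
  have IJ: "0 \<le> I" "0 \<le> J" by (auto simp: I_def J_def)
  \<comment> \<open>The optimal weights are the two norms; the extra \<open>e / 2\<close> keeps them
    positive when a norm vanishes and is let go to 0 at the end.\<close>
  define a b where "a = sqrt I + e / 2" and "b = sqrt J + e / 2"
  have ab: "0 < a" "0 < b" using e IJ by (auto simp: a_def b_def intro: add_nonneg_pos)
  have Ia: "I \<le> a\<^sup>2" and Jb: "J \<le> b\<^sup>2"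
    using e IJ ab real_le_rsqrt sqrt_le_D[of I a] sqrt_le_D[of J b] by (auto simp: a_def b_def)
  have pt: "(w x)\<^sup>2 \<le> (a + b) / a * (u x)\<^sup>2 + (a + b) / b * (v x)\<^sup>2" if "x \<in> space M" for x
  proof -
    have "(w x)\<^sup>2 \<le> (u x + v x)\<^sup>2" using le[OF that] by (intro power_mono) auto
    \<comment> \<open>The added square is the defect of the arithmetic-geometric mean inequality for
      \<open>2 * u x * v x\<close>; its mixed term cancels that product.\<close>
    also have "\<dots> \<le> (u x + v x)\<^sup>2 + (b * u x - a * v x)\<^sup>2 / (a * b)" using ab by simp
    also have "\<dots> = (a + b) / a * (u x)\<^sup>2 + (a + b) / b * (v x)\<^sup>2"
      using ab by (simp add: field_simps power2_eq_square)
    finally show ?thesis .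
  qed
  have "(\<integral>x. (w x)\<^sup>2 \<partial>M) \<le> (\<integral>x. (a + b) / a * (u x)\<^sup>2 + (a + b) / b * (v x)\<^sup>2 \<partial>M)"
    using u v pt ab by (intro integral_mono') (auto intro: add_nonneg_nonneg)
  also have "\<dots> = (a + b) / a * I + (a + b) / b * J"
    using u v by (simp add: I_def J_def)
  also have "\<dots> \<le> (a + b) / a * a\<^sup>2 + (a + b) / b * b\<^sup>2"
    using ab Ia Jb by (intro add_mono mult_left_mono) auto
  also have "\<dots> = (a + b)\<^sup>2" using ab by (simp add: power2_eq_square field_simps)
  finally have "sqrt (\<integral>x. (w x)\<^sup>2 \<partial>M) \<le> sqrt ((a + b)\<^sup>2)" by (rule real_sqrt_le_mono)
  also have "\<dots> = sqrt I + sqrt J + e" using ab by (simp add: a_def b_def)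
  finally show "sqrt (\<integral>x. (w x)\<^sup>2 \<partial>M) \<le> sqrt (\<integral>x. (u x)\<^sup>2 \<partial>M) + sqrt (\<integral>x. (v x)\<^sup>2 \<partial>M) + e"
    by (simp add: I_def J_def)
qed

lemma space_borel_of [simp]: "space (borel_of X) = topspace X"
  by (simp add: borel_of_def space_measure_of_conv)

lemma sets_borel_of: "sets (borel_of X) = sigma_sets (topspace X) {U. openin X U}"
  unfolding borel_of_def by (rule sets_measure_of) (auto dest: openin_subset)

lemma openin_sets_borel_of: "openin X U \<Longrightarrow> U \<in> sets (borel_of X)"
  by (auto simp: sets_borel_of)

lemma measurable_borel_of_continuous_map:
  assumes "continuous_map X Y f"
  shows "f \<in> measurable (borel_of X) (borel_of Y)"
  unfolding borel_of_def[of Y]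
proof (rule measurable_measure_of)
  show "f \<in> space (borel_of X) \<rightarrow> topspace Y"
    using assms by (simp add: continuous_map_def Pi_iff)
  show "f -` U \<inter> space (borel_of X) \<in> sets (borel_of X)" if "U \<in> {U. openin Y U}" for U
  proof -
    have "f -` U \<inter> space (borel_of X) = {x \<in> topspace X. f x \<in> U}" by auto
    then show ?thesis
      using assms that by (auto simp: continuous_map_def intro!: openin_sets_borel_of)
  qed
qed (auto dest: openin_subset)

lemma sets_borel_of_euclidean: "sets (borel_of euclidean) = sets borel"
  by (simp add: sets_borel_of borel_def sets_measure_of_conv)

lemma borel_measurable_continuous_map:
  fixes f :: "'a \<Rightarrow> real"
  shows "continuous_map X euclideanreal f \<Longrightarrow> f \<in> borel_measurable (borel_of X)"
  using measurable_borel_of_continuous_map[of X euclideanreal f]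
    measurable_cong_sets[OF refl sets_borel_of_euclidean] by blast

lemma in_closure_of_mtopology_of:
  assumes "S \<subseteq> mspace X"
  shows "x \<in> mtopology_of X closure_of S \<longleftrightarrow> x \<in> mspace X \<and> (\<forall>\<epsilon>>0. \<exists>y\<in>S. mdist X x y < \<epsilon>)"
  using assms
  unfolding mtopology_of_def Metric_space.metric_closure_of[OF Metric_space_mspace_mdist]
    Metric_space.in_mball[OF Metric_space_mspace_mdist]
  by blast

text \<open>This is where second countability of the fibers enters. A countable dense set of centres
  \<open>p\<close> expresses the distance of two varying points through distances to fixed points,
  each of which is a continuous function of one variable point.\<close>

lemma borel_measurable_mdist:
  assumes X: "second_countable (mtopology_of X)"
    and m: "\<xi> \<in> measurable \<mu> (borel_of (mtopology_of X))" "\<eta> \<in> measurable \<mu> (borel_of (mtopology_of X))"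
  shows "(\<lambda>\<omega>. mdist X (\<xi> \<omega>) (\<eta> \<omega>)) \<in> borel_measurable \<mu>"
proof -
  obtain D where D: "countable D" "D \<subseteq> mspace X" "mtopology_of X closure_of D = mspace X"
    using second_countable_imp_separable_space[OF X] by (auto simp: separable_space_def)
  have pt: "(\<lambda>\<omega>. mdist X p (\<zeta> \<omega>)) \<in> borel_measurable \<mu>"
    if "p \<in> D" "\<zeta> \<in> measurable \<mu> (borel_of (mtopology_of X))" for p \<zeta>
    using measurable_compose[OF that(2) borel_measurable_continuous_map[OF continuous_on_mdist]]
      that D(2) by blast
  have in_X: "\<xi> \<omega> \<in> mspace X" "\<eta> \<omega> \<in> mspace X" if "\<omega> \<in> space \<mu>" for \<omega>
    using that measurable_space[OF m(1)] measurable_space[OF m(2)] by auto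
  show ?thesis
    unfolding borel_measurable_iff_less
  proof
    fix c
    have "{\<omega> \<in> space \<mu>. mdist X (\<xi> \<omega>) (\<eta> \<omega>) < c}
      = (\<Union>p\<in>D. {\<omega> \<in> space \<mu>. mdist X p (\<xi> \<omega>) + mdist X p (\<eta> \<omega>) < c})" (is "?L = ?R")
    proof
      show "?R \<subseteq> ?L"
        using mdist_triangle[OF in_X(1) _ in_X(2)] D(2) by (fastforce simp: mdist_commute)
      show "?L \<subseteq> ?R"
      proof
        fix \<omega> assume \<omega>: "\<omega> \<in> ?L"
        \<comment> \<open>Half of the slack: a detour through a centre within \<open>e\<close> of
          \<open>\<xi> \<omega>\<close> lengthens the path by less than
          \<open>2 * e\<close>.\<close>
        define e where "e = (c - mdist X (\<xi> \<omega>) (\<eta> \<omega>)) / 2"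
        have "0 < e" using \<omega> by (simp add: e_def)
        then obtain p where p: "p \<in> D" "mdist X (\<xi> \<omega>) p < e"
          using in_X(1)[of \<omega>] \<omega> in_closure_of_mtopology_of[OF D(2)] unfolding D(3) by blast
        have "mdist X p (\<eta> \<omega>) \<le> mdist X p (\<xi> \<omega>) + mdist X (\<xi> \<omega>) (\<eta> \<omega>)"
          using in_X \<omega> p(1) D(2) by (intro mdist_triangle) auto
        then have "mdist X p (\<xi> \<omega>) + mdist X p (\<eta> \<omega>) < 2 * e + mdist X (\<xi> \<omega>) (\<eta> \<omega>)"
          using p(2) by (simp add: mdist_commute)
        also have "\<dots> = c" by (simp add: e_def field_simps)
        finally show "\<omega> \<in> ?R" using p(1) \<omega> by auto
      qed
    qed
    also have "\<dots> \<in> sets \<mu>"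
    proof (intro sets.countable_UN'[OF D(1)] ballI image_subsetI)
      fix p assume "p \<in> D"
      then have "(\<lambda>\<omega>. mdist X p (\<xi> \<omega>) + mdist X p (\<eta> \<omega>)) \<in> borel_measurable \<mu>"
        using pt m by (intro borel_measurable_add) blast+
      then show "{\<omega> \<in> space \<mu>. mdist X p (\<xi> \<omega>) + mdist X p (\<eta> \<omega>) < c} \<in> sets \<mu>"
        unfolding borel_measurable_iff_less by blast
    qed
    finally show "?L \<in> sets \<mu>" .
  qed
qed

locale L2_setting =
  fixes \<mu> :: "'w measure" and X :: "'a metric"
  assumes finite: "finite_measure \<mu>"
    and second_countable: "second_countable (mtopology_of X)"
begin

abbreviation "L2_dist \<xi> \<eta> \<equiv> sqrt (\<integral>\<omega>. (mdist X (\<xi> \<omega>) (\<eta> \<omega>))\<^sup>2 \<partial>\<mu>)"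

lemma L2_in_mspace: "\<lbrakk>\<xi> \<in> L2_functions \<mu> X; \<omega> \<in> space \<mu>\<rbrakk> \<Longrightarrow> \<xi> \<omega> \<in> mspace X"
  using measurable_space[of \<xi> \<mu> "borel_of (mtopology_of X)" \<omega>] by (simp add: L2_functions_def)

lemma L2_measurable: "\<xi> \<in> L2_functions \<mu> X \<Longrightarrow> \<xi> \<in> measurable \<mu> (borel_of (mtopology_of X))"
  by (simp add: L2_functions_def)

lemma measurable_const_mspace:
  "x \<in> mspace X \<Longrightarrow> (\<lambda>_. x) \<in> measurable \<mu> (borel_of (mtopology_of X))"
  by simp

lemma integrable_dist2_triangle:
  assumes m: "\<xi> \<in> measurable \<mu> (borel_of (mtopology_of X))"
      "\<eta> \<in> measurable \<mu> (borel_of (mtopology_of X))"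
      "\<zeta> \<in> measurable \<mu> (borel_of (mtopology_of X))"
    and i: "integrable \<mu> (\<lambda>\<omega>. (mdist X (\<xi> \<omega>) (\<eta> \<omega>))\<^sup>2)" "integrable \<mu> (\<lambda>\<omega>. (mdist X (\<eta> \<omega>) (\<zeta> \<omega>))\<^sup>2)"
  shows "integrable \<mu> (\<lambda>\<omega>. (mdist X (\<xi> \<omega>) (\<zeta> \<omega>))\<^sup>2)"
proof (rule Bochner_Integration.integrable_bound)
  show "integrable \<mu> (\<lambda>\<omega>. 2 * (mdist X (\<xi> \<omega>) (\<eta> \<omega>))\<^sup>2 + 2 * (mdist X (\<eta> \<omega>) (\<zeta> \<omega>))\<^sup>2)"
    using i by simp
  show "(\<lambda>\<omega>. (mdist X (\<xi> \<omega>) (\<zeta> \<omega>))\<^sup>2) \<in> borel_measurable \<mu>"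
    using borel_measurable_mdist[OF second_countable m(1,3)] by simp
  show "AE \<omega> in \<mu>. norm ((mdist X (\<xi> \<omega>) (\<zeta> \<omega>))\<^sup>2)
      \<le> norm (2 * (mdist X (\<xi> \<omega>) (\<eta> \<omega>))\<^sup>2 + 2 * (mdist X (\<eta> \<omega>) (\<zeta> \<omega>))\<^sup>2)"
  proof (rule AE_I2)
    fix \<omega> assume "\<omega> \<in> space \<mu>"
    then have "\<xi> \<omega> \<in> mspace X" "\<eta> \<omega> \<in> mspace X" "\<zeta> \<omega> \<in> mspace X"
      using measurable_space[OF m(1)] measurable_space[OF m(2)] measurable_space[OF m(3)] by auto
    then have "(mdist X (\<xi> \<omega>) (\<zeta> \<omega>))\<^sup>2 \<le> (mdist X (\<xi> \<omega>) (\<eta> \<omega>) + mdist X (\<eta> \<omega>) (\<zeta> \<omega>))\<^sup>2"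
      by (intro power_mono mdist_triangle) auto
    also have "\<dots> \<le> 2 * (mdist X (\<xi> \<omega>) (\<eta> \<omega>))\<^sup>2 + 2 * (mdist X (\<eta> \<omega>) (\<zeta> \<omega>))\<^sup>2"
      using zero_le_power2[of "mdist X (\<xi> \<omega>) (\<eta> \<omega>) - mdist X (\<eta> \<omega>) (\<zeta> \<omega>)"]
      unfolding power2_sum power2_diff by linarith
    finally show "norm ((mdist X (\<xi> \<omega>) (\<zeta> \<omega>))\<^sup>2)
      \<le> norm (2 * (mdist X (\<xi> \<omega>) (\<eta> \<omega>))\<^sup>2 + 2 * (mdist X (\<eta> \<omega>) (\<zeta> \<omega>))\<^sup>2)" by simp
  qed
qed

text \<open>The two functions may come with different base points. The measure is finite, so the
  constant squared distance of the base points is integrable and \<open>\<xi>\<close> can be moved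
  to the base point of \<open>\<eta>\<close>.\<close>

lemma L2_integrable:
  assumes "\<xi> \<in> L2_functions \<mu> X" "\<eta> \<in> L2_functions \<mu> X"
  shows "integrable \<mu> (\<lambda>\<omega>. (mdist X (\<xi> \<omega>) (\<eta> \<omega>))\<^sup>2)"
proof -
  obtain x y where x: "x \<in> mspace X" "integrable \<mu> (\<lambda>\<omega>. (mdist X (\<xi> \<omega>) x)\<^sup>2)"
    and y: "y \<in> mspace X" "integrable \<mu> (\<lambda>\<omega>. (mdist X (\<eta> \<omega>) y)\<^sup>2)"
    using assms by (auto simp: L2_functions_def)
  have c: "integrable \<mu> (\<lambda>\<omega>. (mdist X x y)\<^sup>2)"
    using finite_measure.integrable_const[OF finite] .
  have "integrable \<mu> (\<lambda>\<omega>. (mdist X (\<xi> \<omega>) y)\<^sup>2)"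
    using integrable_dist2_triangle[OF _ _ _ x(2) c] L2_measurable assms x y
      measurable_const_mspace by blast
  then show ?thesis
    using integrable_dist2_triangle[of \<xi> "\<lambda>_. y" \<eta>] L2_measurable assms y
      measurable_const_mspace by (simp add: mdist_commute)
qed

lemma L2_functionsI:
  assumes "\<xi> \<in> measurable \<mu> (borel_of (mtopology_of X))" "\<eta> \<in> L2_functions \<mu> X"
    and "integrable \<mu> (\<lambda>\<omega>. (mdist X (\<xi> \<omega>) (\<eta> \<omega>))\<^sup>2)"
  shows "\<xi> \<in> L2_functions \<mu> X"
proof -
  obtain y where y: "y \<in> mspace X" "integrable \<mu> (\<lambda>\<omega>. (mdist X (\<eta> \<omega>) y)\<^sup>2)"
    using assms by (auto simp: L2_functions_def)
  then show ?thesis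
    using integrable_dist2_triangle[OF assms(1) L2_measurable measurable_const_mspace assms(3) y(2)] assms
    by (auto simp: L2_functions_def)
qed

lemma L2_triangle:
  assumes "\<xi> \<in> L2_functions \<mu> X" "\<eta> \<in> L2_functions \<mu> X" "\<zeta> \<in> L2_functions \<mu> X"
  shows "L2_dist \<xi> \<zeta> \<le> L2_dist \<xi> \<eta> + L2_dist \<eta> \<zeta>"
proof (rule L2_minkowski)
  show "0 \<le> mdist X (\<xi> \<omega>) (\<zeta> \<omega>) \<and> mdist X (\<xi> \<omega>) (\<zeta> \<omega>) \<le> mdist X (\<xi> \<omega>) (\<eta> \<omega>) + mdist X (\<eta> \<omega>) (\<zeta> \<omega>)"
    if "\<omega> \<in> space \<mu>" for \<omega>
    using mdist_triangle[OF assms[THEN L2_in_mspace, OF that]] by simp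
qed (use assms L2_integrable in auto)

lemma L2_dist_zero:
  assumes "\<xi> \<in> L2_functions \<mu> X" "\<eta> \<in> L2_functions \<mu> X"
  shows "L2_dist \<xi> \<eta> = 0 \<longleftrightarrow> (\<xi>, \<eta>) \<in> L2_rel \<mu> X"
proof -
  have "L2_dist \<xi> \<eta> = 0 \<longleftrightarrow> (AE \<omega> in \<mu>. (mdist X (\<xi> \<omega>) (\<eta> \<omega>))\<^sup>2 = 0)"
    using integral_nonneg_eq_0_iff_AE[OF L2_integrable[OF assms]] by simp
  also have "\<dots> \<longleftrightarrow> (AE \<omega> in \<mu>. \<xi> \<omega> = \<eta> \<omega>)"
    using assms by (intro AE_cong) (simp add: L2_in_mspace)
  finally show ?thesis using assms by (simp add: L2_rel_def)
qed

lemma equiv_L2_rel: "equiv (L2_functions \<mu> X) (L2_rel \<mu> X)"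
proof (rule equivI)
  show "L2_rel \<mu> X \<subseteq> L2_functions \<mu> X \<times> L2_functions \<mu> X"
    "refl_on (L2_functions \<mu> X) (L2_rel \<mu> X)" "sym (L2_rel \<mu> X)"
    by (auto simp: L2_rel_def refl_on_def sym_def eq_commute)
  show "trans (L2_rel \<mu> X)"
    by (auto simp: L2_rel_def trans_def elim: eventually_elim2)
qed

lemma mspace_L2_space: "mspace (L2_space \<mu> X) = L2_functions \<mu> X // L2_rel \<mu> X"
  unfolding L2_space_def
  by (rule mspace_quotient_metric[OF equiv_L2_rel])
     (auto simp: mdist_commute L2_triangle L2_dist_zero simp del: real_sqrt_eq_zero_cancel_iff)

lemma mdist_L2_space:
  assumes "\<xi> \<in> L2_functions \<mu> X" "\<eta> \<in> L2_functions \<mu> X"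
  shows "mdist (L2_space \<mu> X) (L2_class \<mu> X \<xi>) (L2_class \<mu> X \<eta>) = L2_dist \<xi> \<eta>"
  unfolding L2_space_def L2_class_def
  by (rule mdist_quotient_metric[OF equiv_L2_rel])
     (use assms in \<open>auto simp: mdist_commute L2_triangle L2_dist_zero simp del: real_sqrt_eq_zero_cancel_iff\<close>)

lemma L2_class_in_mspace: "\<xi> \<in> L2_functions \<mu> X \<Longrightarrow> L2_class \<mu> X \<xi> \<in> mspace (L2_space \<mu> X)"
  by (simp add: mspace_L2_space L2_class_def quotientI)

lemma L2_class_eq_iff:
  "\<lbrakk>\<xi> \<in> L2_functions \<mu> X; \<eta> \<in> L2_functions \<mu> X\<rbrakk>
    \<Longrightarrow> L2_class \<mu> X \<xi> = L2_class \<mu> X \<eta> \<longleftrightarrow> (AE \<omega> in \<mu>. \<xi> \<omega> = \<eta> \<omega>)"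
  unfolding L2_class_def using eq_equiv_class_iff[OF equiv_L2_rel, of \<xi> \<eta>] by (simp add: L2_rel_def)

lemma L2_class_some:
  assumes "c \<in> mspace (L2_space \<mu> X)"
  shows "(SOME \<xi>. \<xi> \<in> c) \<in> L2_functions \<mu> X" "L2_class \<mu> X (SOME \<xi>. \<xi> \<in> c) = c"
proof -
  obtain \<eta> where \<eta>: "\<eta> \<in> L2_functions \<mu> X" "c = L2_rel \<mu> X `` {\<eta>}"
    using assms by (auto simp: mspace_L2_space quotient_def)
  then have "\<eta> \<in> c" by (auto simp: L2_rel_def)
  then have *: "(SOME \<xi>. \<xi> \<in> c) \<in> c" by (metis someI)
  then show "(SOME \<xi>. \<xi> \<in> c) \<in> L2_functions \<mu> X" using \<eta> by (auto simp: L2_rel_def)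
  have "(\<eta>, SOME \<xi>. \<xi> \<in> c) \<in> L2_rel \<mu> X" using * \<eta> by blast
  then show "L2_class \<mu> X (SOME \<xi>. \<xi> \<in> c) = c"
    unfolding L2_class_def \<eta>(2) using equiv_class_eq[OF equiv_L2_rel] by metis
qed

end

text \<open>No integrability is assumed: if one function is not square integrable then neither is
  the other, and both classes are empty. Representatives can thus be rewritten freely inside a
  class.\<close>

lemma L2_class_cong:
  assumes "\<And>\<omega>. \<omega> \<in> space \<mu> \<Longrightarrow> \<xi> \<omega> = \<eta> \<omega>"
  shows "L2_class \<mu> X \<xi> = L2_class \<mu> X \<eta>"
proof -
  have "\<xi> \<in> measurable \<mu> N \<longleftrightarrow> \<eta> \<in> measurable \<mu> N" for N :: "'b measure"
    using assms by (intro measurable_cong) auto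
  moreover have "integrable \<mu> (\<lambda>\<omega>. (mdist X (\<xi> \<omega>) x)\<^sup>2) \<longleftrightarrow> integrable \<mu> (\<lambda>\<omega>. (mdist X (\<eta> \<omega>) x)\<^sup>2)" for x
    using assms by (intro Bochner_Integration.integrable_cong) auto
  moreover have "(AE \<omega> in \<mu>. \<xi> \<omega> = \<zeta> \<omega>) \<longleftrightarrow> (AE \<omega> in \<mu>. \<eta> \<omega> = \<zeta> \<omega>)" for \<zeta>
    using assms by (intro AE_cong) auto
  ultimately show ?thesis
    by (auto simp: L2_class_def L2_rel_def L2_functions_def)
qed

lemma openin_continuous_map_less:
  fixes f :: "'a \<Rightarrow> real"
  assumes "continuous_map Z euclideanreal f"
  shows "openin Z {z \<in> topspace Z. f z < c}"
  using openin_continuous_map_preimage[OF assms, of "{..<c}"] by simp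

text \<open>The glued function is pointwise no farther from \<open>\<eta>\<close> than
  \<open>\<xi>\<close> is.\<close>

lemma (in L2_setting) L2_mix:
  assumes A: "A \<in> sets \<mu>" and \<xi>: "\<xi> \<in> L2_functions \<mu> X" and \<eta>: "\<eta> \<in> L2_functions \<mu> X"
  shows "(\<lambda>\<omega>. if \<omega> \<in> A then \<xi> \<omega> else \<eta> \<omega>) \<in> L2_functions \<mu> X" (is "?\<zeta> \<in> _")
proof (rule L2_functionsI)
  show m: "?\<zeta> \<in> measurable \<mu> (borel_of (mtopology_of X))"
    using A \<xi> \<eta> by (intro measurable_If_set L2_measurable) auto
  show "integrable \<mu> (\<lambda>\<omega>. (mdist X (?\<zeta> \<omega>) (\<eta> \<omega>))\<^sup>2)"
  proof (rule Bochner_Integration.integrable_bound[OF L2_integrable[OF \<xi> \<eta>]])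
    show "(\<lambda>\<omega>. (mdist X (?\<zeta> \<omega>) (\<eta> \<omega>))\<^sup>2) \<in> borel_measurable \<mu>"
      using borel_measurable_mdist[OF second_countable m L2_measurable[OF \<eta>]] by simp
    show "AE \<omega> in \<mu>. norm ((mdist X (?\<zeta> \<omega>) (\<eta> \<omega>))\<^sup>2) \<le> norm ((mdist X (\<xi> \<omega>) (\<eta> \<omega>))\<^sup>2)"
    proof (rule AE_I2)
      fix \<omega> assume "\<omega> \<in> space \<mu>"
      then have "mdist X (\<eta> \<omega>) (\<eta> \<omega>) = 0" using L2_in_mspace[OF \<eta>] by simp
      then show "norm ((mdist X (?\<zeta> \<omega>) (\<eta> \<omega>))\<^sup>2) \<le> norm ((mdist X (\<xi> \<omega>) (\<eta> \<omega>))\<^sup>2)" by simp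
    qed
  qed
qed fact

section \<open>Sections over the product with the probability space\<close>

locale field_setting =
  fixes C :: "('z, 'a) metric_field" and \<Omega> :: "'w topology" and \<mu> :: "'w measure"
  assumes CAT0_fiber: "z \<in> topspace (base C) \<Longrightarrow> CAT0 (fiber C z)"
    and second_countable_fiber: "z \<in> topspace (base C) \<Longrightarrow> second_countable (mtopology_of (fiber C z))"
    and sections_subset: "sections C \<subseteq> all_sections (base C) (fiber C)"
    and midpoint_closed: "midpoint_closed (base C) (fiber C) (sections C)"
    and dense: "z \<in> topspace (base C) \<Longrightarrow>
        mtopology_of (fiber C z) closure_of {s z | s. s \<in> sections C} = mspace (fiber C z)"
    and cocont: "\<lbrakk>s \<in> sections C; s' \<in> sections C\<rbrakk> \<Longrightarrow> cocontinuous (base C) (fiber C) s s'"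
    and closed: "\<lbrakk>s \<in> all_sections (base C) (fiber C);
        \<And>s'. s' \<in> sections C \<Longrightarrow> cocontinuous (base C) (fiber C) s s'\<rbrakk> \<Longrightarrow> s \<in> sections C"
    and compact: "compact_space \<Omega>" and Hausdorff: "Hausdorff_space \<Omega>"
    and regular: "regular_borel_probability \<Omega> \<mu>"
begin

lemma section_in: "\<lbrakk>s \<in> sections C; z \<in> topspace (base C)\<rbrakk> \<Longrightarrow> s z \<in> mspace (fiber C z)"
  using sections_subset by (auto simp: all_sections_def)

lemma section_approx:
  assumes "z \<in> topspace (base C)" "x \<in> mspace (fiber C z)" "0 < \<epsilon>"
  obtains s where "s \<in> sections C" "mdist (fiber C z) x (s z) < \<epsilon>"
proof -
  have "{s z | s. s \<in> sections C} \<subseteq> mspace (fiber C z)" using assms section_in by auto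
  from in_closure_of_mtopology_of[OF this, of x] show ?thesis
    using that assms unfolding dense[OF assms(1)] by blast
qed

text \<open>The ratios that work for all pairs of sections form a set \<open>D\<close> containing 0
  and 1. It is stable under midpoints by axiom (i), and closed because axiom (iv) admits local
  uniform limits.\<close>

lemma section_geodesic_point:
  assumes t: "t \<in> {0..1}" and ab: "a \<in> sections C" "b \<in> sections C"
  shows "(\<lambda>z\<in>topspace (base C). geodesic_point (fiber C z) (a z) (b z) t) \<in> sections C"
proof -
  let ?Z = "base C" and ?X = "fiber C"
  let ?g = "\<lambda>a b t. \<lambda>z\<in>topspace ?Z. geodesic_point (?X z) (a z) (b z) t"
  define D where "D = {t\<in>{0..1}. \<forall>a\<in>sections C. \<forall>b\<in>sections C. ?g a b t \<in> sections C}"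
  have D01: "D \<subseteq> {0..1}" by (auto simp: D_def)
  have g_all: "?g a b t \<in> all_sections ?Z ?X"
    if "a \<in> sections C" "b \<in> sections C" "t \<in> {0..1}" for a b t
    using that geodesic_point_in[OF CAT0_fiber] section_in by (auto simp: all_sections_def)
  have ext: "s \<in> extensional (topspace ?Z)" if "s \<in> sections C" for s
    using that sections_subset by (auto simp: all_sections_def PiE_def)
  have "0 \<in> D" "1 \<in> D"
  proof -
    have "?g a b 0 = a" "?g a b 1 = b" if "a \<in> sections C" "b \<in> sections C" for a b
      using geodesic_geodesic_point[OF CAT0_fiber section_in section_in] that ext[OF that(1)] ext[OF that(2)]
      by (auto simp: geodesic_def fun_eq_iff extensional_def)
    then show "0 \<in> D" "1 \<in> D" by (auto simp: D_def)
  qed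
  moreover have "(s + t) / 2 \<in> D" if st: "s \<in> D" "t \<in> D" for s t
  proof -
    have st01: "s \<in> {0..1}" "t \<in> {0..1}" "(s + t) / 2 \<in> {0..1}"
      using subsetD[OF D01 st(1)] subsetD[OF D01 st(2)] by auto
    have "?g a b ((s + t) / 2) \<in> sections C" if ab: "a \<in> sections C" "b \<in> sections C" for a b
    proof -
      have "\<forall>z\<in>topspace ?Z. is_midpoint (?X z) (?g a b s z) (?g a b t z) (?g a b ((s + t) / 2) z)"
      proof
        fix z assume z: "z \<in> topspace ?Z"
        note m = mdist_geodesic_point_same[OF CAT0_fiber[OF z] section_in[OF ab(1) z] section_in[OF ab(2) z]]
        \<comment> \<open>On a geodesic, distance is proportional to the difference of ratios, so
          the point at the mean ratio is a midpoint of the points at \<open>s\<close> and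
          \<open>t\<close>.\<close>
        have "s - (s + t) / 2 = (s - t) / 2" "t - (s + t) / 2 = - ((s - t) / 2)" by (simp_all add: field_simps)
        then have "\<bar>s - (s + t) / 2\<bar> = \<bar>s - t\<bar> / 2" "\<bar>t - (s + t) / 2\<bar> = \<bar>s - t\<bar> / 2"
          by (simp_all only: abs_minus_cancel abs_divide)
        then show "is_midpoint (?X z) (?g a b s z) (?g a b t z) (?g a b ((s + t) / 2) z)"
          using z geodesic_point_in[OF CAT0_fiber[OF z] section_in[OF ab(1) z] section_in[OF ab(2) z] st01(3)]
            m[OF st01(1,3)] m[OF st01(2,3)] m[OF st01(1,2)]
          by (simp add: is_midpoint_def)
      qed
      moreover have "?g a b s \<in> sections C" "?g a b t \<in> sections C" using st ab by (auto simp: D_def)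
      ultimately show ?thesis
        using midpoint_closed g_all[OF ab st01(3)] unfolding midpoint_closed_def by blast
    qed
    then show ?thesis using st01 by (simp add: D_def)
  qed
  moreover have "closed D"
    unfolding closure_subset_eq[symmetric]
  proof
    fix t assume t: "t \<in> closure D"
    have t01: "t \<in> {0..1}"
      using t closure_minimal[OF D01] by auto
    have "?g a b t \<in> sections C" if ab: "a \<in> sections C" "b \<in> sections C" for a b
    proof (rule closed[OF g_all[OF ab t01]])
      fix s' assume s': "s' \<in> sections C"
      have "cocontinuous ?Z ?X s' (?g a b t)"
      proof (rule cocontinuous_approx)
        fix z0 and \<epsilon> :: real assume z0: "z0 \<in> topspace ?Z" and \<epsilon>: "0 < \<epsilon>"
        \<comment> \<open>A bound for the length of the geodesics near \<open>z0\<close>; a change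
          of ratio below \<open>\<epsilon> / M\<close> then moves the point by less than
          \<open>\<epsilon>\<close>, uniformly on \<open>U\<close>.\<close>
        define M where "M = mdist (?X z0) (a z0) (b z0) + 1"
        have M: "0 < M" by (simp add: M_def add_nonneg_pos)
        define U where "U = {z \<in> topspace ?Z. mdist (?X z) (a z) (b z) < M}"
        have U: "openin ?Z U" "z0 \<in> U"
          unfolding U_def using cocont[OF ab] z0
          by (auto simp: cocontinuous_def M_def intro!: openin_continuous_map_less)
        have "0 < \<epsilon> / M" using \<epsilon> M by simp
        then obtain t' where t': "t' \<in> D" "\<bar>t - t'\<bar> < \<epsilon> / M"
          using t unfolding closure_approachable by (metis dist_real_def dist_commute)
        have "?g a b t' z \<in> mspace (?X z) \<and> mdist (?X z) (?g a b t z) (?g a b t' z) < \<epsilon>"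
          if "z \<in> U" for z
        proof -
          have z: "z \<in> topspace ?Z" and "mdist (?X z) (a z) (b z) \<le> M" using that by (auto simp: U_def)
          then have "\<bar>t - t'\<bar> * mdist (?X z) (a z) (b z) \<le> \<bar>t - t'\<bar> * M"
            by (intro mult_left_mono) auto
          also have "\<dots> < \<epsilon>" using t'(2) M by (simp add: field_simps)
          finally show ?thesis
            using z t'(1) D01 t01 mdist_geodesic_point_same[OF CAT0_fiber section_in section_in, of z a b t t']
              geodesic_point_in[OF CAT0_fiber section_in section_in, of z a b t'] ab by auto
        qed
        moreover have "cocontinuous ?Z ?X s' (?g a b t')"
          using cocont[OF s'] t' ab by (auto simp: D_def)
        ultimately show "\<exists>\<tau>' U. openin ?Z U \<and> z0 \<in> U \<and> cocontinuous ?Z ?X s' \<tau>' \<and>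
            (\<forall>z\<in>U. \<tau>' z \<in> mspace (?X z) \<and> mdist (?X z) (?g a b t z) (\<tau>' z) < \<epsilon>)"
          using U by blast
      qed (use section_in[OF s'] g_all[OF ab t01] in \<open>auto simp: all_sections_def\<close>)
      then show "cocontinuous ?Z ?X (?g a b t) s'" by (simp add: cocontinuous_commute)
    qed
    then show "t \<in> D" using t01 by (simp add: D_def)
  qed
  ultimately have "D = {0..1}"
    using closed_midpoint_convex_unit_interval D01 by blast
  then have "t \<in> D" using t by simp
  then show ?thesis using ab by (simp add: D_def)
qed

section \<open>Continuous sections over the product of the base with \<open>\<Omega>\<close>\<close>

abbreviation prod_base :: "('z \<times> 'w) topology" where
  "prod_base \<equiv> prod_topology (base C) \<Omega>"

abbreviation prod_fiber :: "'z \<times> 'w \<Rightarrow> 'a metric" where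
  "prod_fiber \<equiv> \<lambda>(z, \<omega>). fiber C z"

abbreviation lift :: "('z \<Rightarrow> 'a) \<Rightarrow> 'z \<times> 'w \<Rightarrow> 'a" where
  "lift s \<equiv> restrict (\<lambda>(z, \<omega>). s z) (topspace prod_base)"

abbreviation prod_sections :: "('z \<times> 'w \<Rightarrow> 'a) set" where
  "prod_sections \<equiv> sections (product_field \<Omega> C)"

text \<open>A generated field has as fibers the closures of the values of its generators. The lifts
  already take a dense set of values in each fiber of \<open>C\<close>, so nothing is lost.\<close>

lemma prod_sections_iff:
  "s \<in> prod_sections \<longleftrightarrow> s \<in> all_sections prod_base prod_fiber \<and>
    (\<forall>s0\<in>sections C. cocontinuous prod_base prod_fiber s (lift s0))"
proof -
  let ?\<Sigma> = "{lift s | s. s \<in> sections C}"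
  have "mspace (submetric (prod_fiber p) (mtopology_of (prod_fiber p) closure_of {s p | s. s \<in> ?\<Sigma>}))
      = mspace (prod_fiber p)" if p: "p \<in> topspace prod_base" for p
  proof -
    obtain z \<omega> where p': "p = (z, \<omega>)" and z: "z \<in> topspace (base C)" using p by auto
    have "{s p | s. s \<in> ?\<Sigma>} = {s z | s. s \<in> sections C}"
    proof -
      have "lift s p = s z" for s using p by (simp add: p')
      moreover have "{s p | s. s \<in> ?\<Sigma>} = {lift s p | s. s \<in> sections C}" by blast
      ultimately show ?thesis by (simp only:)
    qed
    then show ?thesis using dense[OF z] by (simp add: p')
  qed
  then have "all_sections prod_base (\<lambda>p. submetric (prod_fiber p)
      (mtopology_of (prod_fiber p) closure_of {s p | s. s \<in> ?\<Sigma>})) = all_sections prod_base prod_fiber"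
    unfolding all_sections_def by (intro PiE_cong)
  then show ?thesis
    unfolding product_field_def generated_field_def Let_def by auto
qed

lemma prod_section_in:
  "\<lbrakk>s \<in> prod_sections; z \<in> topspace (base C); \<omega> \<in> topspace \<Omega>\<rbrakk> \<Longrightarrow> s (z, \<omega>) \<in> mspace (fiber C z)"
  by (force simp: prod_sections_iff all_sections_def)

lemma prod_sectionsI:
  assumes "\<And>z \<omega>. \<lbrakk>z \<in> topspace (base C); \<omega> \<in> topspace \<Omega>\<rbrakk> \<Longrightarrow> s (z, \<omega>) \<in> mspace (fiber C z)"
    and "s \<in> extensional (topspace prod_base)"
    and "\<And>s0. s0 \<in> sections C \<Longrightarrow> cocontinuous prod_base prod_fiber (lift s0) s"
  shows "s \<in> prod_sections"
  using assms by (auto simp: prod_sections_iff all_sections_def PiE_def cocontinuous_commute)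

lemma cocontinuous_lift:
  assumes "s \<in> sections C" "s' \<in> sections C"
  shows "cocontinuous prod_base prod_fiber (lift s) (lift s')"
proof -
  have "continuous_map prod_base euclideanreal ((\<lambda>z. mdist (fiber C z) (s z) (s' z)) \<circ> fst)"
    using cocont[OF assms] unfolding cocontinuous_def
    by (rule continuous_map_compose[OF continuous_map_fst])
  then show ?thesis
    unfolding cocontinuous_def by (rule continuous_map_eq) auto
qed

text \<open>Membership is tested only against lifts, but near any point \<open>s'\<close> is close
  to a lift, so two product sections can also be tested against each other.\<close>

lemma prod_sections_cocont:
  assumes s: "s \<in> prod_sections" and s': "s' \<in> prod_sections"
  shows "cocontinuous prod_base prod_fiber s s'"
proof (rule cocontinuous_approx)
  fix p0 and \<epsilon> :: real assume p0: "p0 \<in> topspace prod_base" and \<epsilon>: "0 < \<epsilon>"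
  obtain z0 \<omega>0 where p: "p0 = (z0, \<omega>0)" "z0 \<in> topspace (base C)" "\<omega>0 \<in> topspace \<Omega>" using p0 by auto
  obtain s0 where s0: "s0 \<in> sections C" "mdist (fiber C z0) (s' p0) (s0 z0) < \<epsilon>"
    using section_approx[OF p(2) _ \<epsilon>] prod_section_in[OF s'] p by metis
  define U where "U = {p \<in> topspace prod_base. mdist (prod_fiber p) (s' p) (lift s0 p) < \<epsilon>}"
  have "openin prod_base U"
    unfolding U_def using s' s0(1)
    by (intro openin_continuous_map_less) (simp only: prod_sections_iff cocontinuous_def)
  moreover have "p0 \<in> U" using s0 p by (simp add: U_def)
  moreover have "cocontinuous prod_base prod_fiber s (lift s0)"
    using s s0 by (simp add: prod_sections_iff)
  ultimately show "\<exists>\<tau>' U. openin prod_base U \<and> p0 \<in> U \<and> cocontinuous prod_base prod_fiber s \<tau>' \<and>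
      (\<forall>p\<in>U. \<tau>' p \<in> mspace (prod_fiber p) \<and> mdist (prod_fiber p) (s' p) (\<tau>' p) < \<epsilon>)"
    using section_in[OF s0(1)] by (intro exI[of _ "lift s0"] exI[of _ U]) (auto simp: U_def)
qed (use prod_section_in[OF s] prod_section_in[OF s'] in auto)

text \<open>The ratio varies with \<open>\<omega>\<close>, whereas
  \<open>section_geodesic_point\<close> handles fixed ratios. Near \<open>(z0, \<omega>0)\<close>
  the ratio is therefore frozen at its value there, and \<open>s\<close>, \<open>s'\<close> are
  replaced by lifts of sections of \<open>C\<close>.\<close>

lemma prod_section_geodesic_point:
  assumes s: "s \<in> prod_sections" and s': "s' \<in> prod_sections"
    and f: "continuous_map \<Omega> euclideanreal f" and f01: "\<And>\<omega>. \<omega> \<in> topspace \<Omega> \<Longrightarrow> f \<omega> \<in> {0..1}"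
  shows "(\<lambda>p\<in>topspace prod_base. geodesic_point (prod_fiber p) (s p) (s' p) (f (snd p))) \<in> prod_sections"
    (is "?g \<in> _")
proof (rule prod_sectionsI)
  show g_in: "?g (z, \<omega>) \<in> mspace (fiber C z)" if "z \<in> topspace (base C)" "\<omega> \<in> topspace \<Omega>" for z \<omega>
    using that geodesic_point_in[OF CAT0_fiber prod_section_in[OF s] prod_section_in[OF s'] f01] by simp
  fix s0 assume s0: "s0 \<in> sections C"
  show "cocontinuous prod_base prod_fiber (lift s0) ?g"
  proof (rule cocontinuous_approx)
    fix p0 and \<epsilon> :: real assume p0: "p0 \<in> topspace prod_base" and \<epsilon>: "0 < \<epsilon>"
    obtain z0 \<omega>0 where p: "p0 = (z0, \<omega>0)" "z0 \<in> topspace (base C)" "\<omega>0 \<in> topspace \<Omega>" using p0 by auto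
    have \<epsilon>2: "0 < \<epsilon> / 2" using \<epsilon> by simp
    obtain a where a: "a \<in> sections C" "mdist (fiber C z0) (s p0) (a z0) < \<epsilon> / 2"
      using section_approx[OF p(2) _ \<epsilon>2] prod_section_in[OF s] p by metis
    obtain b where b: "b \<in> sections C" "mdist (fiber C z0) (s' p0) (b z0) < \<epsilon> / 2"
      using section_approx[OF p(2) _ \<epsilon>2] prod_section_in[OF s'] p by metis
    define t where "t = f \<omega>0"
    have t: "t \<in> {0..1}" using f01 p by (simp add: t_def)
    let ?c = "\<lambda>z\<in>topspace (base C). geodesic_point (fiber C z) (a z) (b z) t"
    have c: "?c \<in> sections C" by (rule section_geodesic_point[OF t a(1) b(1)])
    \<comment> \<open>A continuous upper bound for the error, one summand per replacement. At
      \<open>p0\<close> the first summand vanishes and the other two are below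
      \<open>\<epsilon> / 2\<close>, so the error stays below \<open>\<epsilon>\<close>
      nearby.\<close>
    define h where "h = (\<lambda>p. \<bar>f (snd p) - t\<bar> * mdist (prod_fiber p) (s p) (s' p)
        + mdist (prod_fiber p) (s p) (lift a p) + mdist (prod_fiber p) (s' p) (lift b p))"
    have fs: "continuous_map prod_base euclideanreal (\<lambda>p. f (snd p))"
      using continuous_map_compose[OF continuous_map_snd f] by (simp add: comp_def)
    have "continuous_map prod_base euclideanreal h"
      unfolding h_def using fs prod_sections_cocont[OF s s'] s s' a(1) b(1)
      by (intro continuous_map_add continuous_map_real_mult continuous_map_real_abs continuous_map_diff)
         (auto simp: prod_sections_iff cocontinuous_def)
    then have U: "openin prod_base {p \<in> topspace prod_base. h p < \<epsilon>}" (is "openin _ ?U")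
      by (rule openin_continuous_map_less)
    have "h p0 < \<epsilon>" using a(2) b(2) p by (simp add: h_def t_def)
    moreover have "lift ?c p \<in> mspace (prod_fiber p) \<and> mdist (prod_fiber p) (?g p) (lift ?c p) < \<epsilon>"
      if p_in: "p \<in> ?U" for p
    proof -
      obtain z \<omega> where q: "p = (z, \<omega>)" "z \<in> topspace (base C)" "\<omega> \<in> topspace \<Omega>"
        using p_in by (cases p) auto
      let ?X = "fiber C z"
      note X = CAT0_fiber[OF q(2)]
      note m = prod_section_in[OF s q(2,3)] prod_section_in[OF s' q(2,3)]
        section_in[OF a(1) q(2)] section_in[OF b(1) q(2)]
      have "mdist ?X (geodesic_point ?X (s p) (s' p) (f \<omega>)) (geodesic_point ?X (a z) (b z) t)
        \<le> mdist ?X (geodesic_point ?X (s p) (s' p) (f \<omega>)) (geodesic_point ?X (s p) (s' p) t)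
         + mdist ?X (geodesic_point ?X (s p) (s' p) t) (geodesic_point ?X (a z) (b z) t)"
        using m q(1) f01[OF q(3)] t by (intro mdist_triangle geodesic_point_in X) auto
      also have "\<dots> \<le> \<bar>f \<omega> - t\<bar> * mdist ?X (s p) (s' p) + (mdist ?X (s p) (a z) + mdist ?X (s' p) (b z))"
        using m q(1) f01[OF q(3)] t mdist_geodesic_point_same[OF X m(1,2) f01[OF q(3)] t]
        by (intro add_mono mdist_geodesic_point_le X) auto
      also have "\<dots> = h p" using q by (simp add: h_def)
      also have "\<dots> < \<epsilon>" using p_in by simp
      finally show ?thesis
        using q m geodesic_point_in[OF X m(3,4) t] by simp
    qed
    ultimately show "\<exists>\<tau>' U. openin prod_base U \<and> p0 \<in> U \<and> cocontinuous prod_base prod_fiber (lift s0) \<tau>' \<and>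
      (\<forall>p\<in>U. \<tau>' p \<in> mspace (prod_fiber p) \<and> mdist (prod_fiber p) (?g p) (\<tau>' p) < \<epsilon>)"
      using U p0 cocontinuous_lift[OF s0 c] by (intro exI[of _ "lift ?c"] exI[of _ ?U]) auto
  qed (use section_in[OF s0] g_in in auto)
qed simp

text \<open>Co-continuity only controls distances to sections. A section of \<open>C\<close> passing
  close to \<open>s (z, \<omega>0)\<close> serves as a fixed point in the fiber, and the triangle
  inequality gives continuity at \<open>\<omega>0\<close>.\<close>

lemma prod_section_slice:
  assumes s: "s \<in> prod_sections" and z: "z \<in> topspace (base C)"
  shows "continuous_map \<Omega> (mtopology_of (fiber C z)) (\<lambda>\<omega>. s (z, \<omega>))"
  unfolding mtopology_of_def Metric_space.continuous_map_to_metric[OF Metric_space_mspace_mdist]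
    Metric_space.in_mball[OF Metric_space_mspace_mdist]
proof (intro ballI allI impI)
  fix \<omega>0 and \<epsilon> :: real assume \<omega>0: "\<omega>0 \<in> topspace \<Omega>" and \<epsilon>: "0 < \<epsilon>"
  have "0 < \<epsilon> / 2" using \<epsilon> by simp
  then obtain s0 where s0: "s0 \<in> sections C" "mdist (fiber C z) (s (z, \<omega>0)) (s0 z) < \<epsilon> / 2"
    using section_approx[OF z prod_section_in[OF s z \<omega>0]] by blast
  have "continuous_map prod_base euclideanreal (\<lambda>p. mdist (prod_fiber p) (s p) (lift s0 p))"
    using s s0(1) by (simp add: prod_sections_iff cocontinuous_def)
  moreover have "continuous_map \<Omega> prod_base (\<lambda>\<omega>. (z, \<omega>))"
    using z by (simp add: continuous_map_pairedI)
  ultimately have "continuous_map \<Omega> euclideanreal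
      ((\<lambda>p. mdist (prod_fiber p) (s p) (lift s0 p)) \<circ> (\<lambda>\<omega>. (z, \<omega>)))"
    by (rule continuous_map_compose[rotated])
  then have "continuous_map \<Omega> euclideanreal (\<lambda>\<omega>. mdist (fiber C z) (s (z, \<omega>)) (s0 z))"
    by (rule continuous_map_eq) (use z in auto)
  then have "openin \<Omega> {\<omega> \<in> topspace \<Omega>. mdist (fiber C z) (s (z, \<omega>)) (s0 z) < \<epsilon> / 2}" (is "openin _ ?U")
    by (rule openin_continuous_map_less)
  moreover have "mdist (fiber C z) (s (z, \<omega>0)) (s (z, \<omega>)) < \<epsilon>" if "\<omega> \<in> ?U" for \<omega>
    using mdist_triangle[of "s (z, \<omega>0)" "fiber C z" "s0 z" "s (z, \<omega>)"] that s0
      prod_section_in[OF s z] section_in[OF _ z] \<omega>0 by (auto simp: mdist_commute)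
  ultimately show "\<exists>U. openin \<Omega> U \<and> \<omega>0 \<in> U \<and> (\<forall>\<omega>\<in>U. s (z, \<omega>0) \<in> mspace (fiber C z) \<and>
      s (z, \<omega>) \<in> mspace (fiber C z) \<and> mdist (fiber C z) (s (z, \<omega>0)) (s (z, \<omega>)) < \<epsilon>)"
    using s0(2) \<omega>0 prod_section_in[OF s z] by (intro exI[of _ ?U]) auto
qed

lemma compact_real_bounded:
  assumes "continuous_map \<Omega> euclideanreal f"
  obtains M where "0 < M" "\<And>\<omega>. \<omega> \<in> topspace \<Omega> \<Longrightarrow> f \<omega> < M"
proof -
  have "compact (f ` topspace \<Omega>)"
    using image_compactin[OF _ assms] compact by (simp add: compact_space_def)
  then have "bounded (f ` topspace \<Omega>)" by (rule compact_imp_bounded)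
  then obtain B where "\<And>\<omega>. \<omega> \<in> topspace \<Omega> \<Longrightarrow> \<bar>f \<omega>\<bar> \<le> B"
    unfolding bounded_iff by auto
  then have "\<And>\<omega>. \<omega> \<in> topspace \<Omega> \<Longrightarrow> f \<omega> < \<bar>B\<bar> + 1" by (smt (verit))
  then show ?thesis using that[of "\<bar>B\<bar> + 1"] by auto
qed

text \<open>Compactness of \<open>\<Omega>\<close> is used twice: to bound the distance on the slice
  over \<open>z0\<close>, and in the tube lemma, which spreads the bound to all of
  \<open>U \<times> \<Omega>\<close>.\<close>

lemma prod_sections_bounded:
  assumes s: "s \<in> prod_sections" and s': "s' \<in> prod_sections" and z0: "z0 \<in> topspace (base C)"
  obtains U M where "openin (base C) U" "z0 \<in> U" "0 < M"
    "\<And>z \<omega>. \<lbrakk>z \<in> U; \<omega> \<in> topspace \<Omega>\<rbrakk> \<Longrightarrow> mdist (fiber C z) (s (z, \<omega>)) (s' (z, \<omega>)) \<le> M"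
proof -
  have "continuous_map \<Omega> euclideanreal (\<lambda>\<omega>. mdist (fiber C z0) (s (z0, \<omega>)) (s' (z0, \<omega>)))"
    using continuous_map_mdist[OF prod_section_slice[OF s z0] prod_section_slice[OF s' z0]] by simp
  then obtain M where M: "0 < M" "\<And>\<omega>. \<omega> \<in> topspace \<Omega> \<Longrightarrow> mdist (fiber C z0) (s (z0, \<omega>)) (s' (z0, \<omega>)) < M"
    using compact_real_bounded by blast
  have "openin prod_base {p \<in> topspace prod_base. mdist (prod_fiber p) (s p) (s' p) < M}" (is "openin _ ?W")
    using prod_sections_cocont[OF s s'] unfolding cocontinuous_def by (rule openin_continuous_map_less)
  moreover have "compactin \<Omega> (topspace \<Omega>)" using compact by (simp add: compact_space_def)
  moreover have "{z0} \<times> topspace \<Omega> \<subseteq> ?W" using M z0 by auto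
  ultimately obtain U V where UV: "openin (base C) U" "z0 \<in> U" "topspace \<Omega> \<subseteq> V" "U \<times> V \<subseteq> ?W"
    using tube_lemma_right[of "base C" \<Omega> ?W "topspace \<Omega>" z0] z0 by blast
  have "mdist (fiber C z) (s (z, \<omega>)) (s' (z, \<omega>)) \<le> M" if "z \<in> U" "\<omega> \<in> topspace \<Omega>" for z \<omega>
  proof -
    have "(z, \<omega>) \<in> ?W" using UV that by blast
    then show ?thesis by simp
  qed
  then show ?thesis using that UV M by blast
qed

section \<open>Square integrable slices and gluing along measurable sets\<close>

lemma prob_space_\<mu>: "prob_space \<mu>" and space_\<mu> [simp]: "space \<mu> = topspace \<Omega>"
  and sets_\<mu>: "sets \<mu> = sets (borel_of \<Omega>)"
  using regular by (auto simp: regular_borel_probability_def)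

lemma L2_setting_fiber: "z \<in> topspace (base C) \<Longrightarrow> L2_setting \<mu> (fiber C z)"
  using prob_space.finite_measure[OF prob_space_\<mu>] second_countable_fiber by (simp add: L2_setting_def)

lemma prod_section_L2:
  assumes s: "s \<in> prod_sections" and z: "z \<in> topspace (base C)"
  shows "(\<lambda>\<omega>. s (z, \<omega>)) \<in> L2_functions \<mu> (fiber C z)"
proof -
  interpret \<mu>: prob_space \<mu> by (rule prob_space_\<mu>)
  obtain \<omega>0 where \<omega>0: "\<omega>0 \<in> topspace \<Omega>" using \<mu>.not_empty unfolding space_\<mu> by blast
  let ?x = "s (z, \<omega>0)"
  have x: "?x \<in> mspace (fiber C z)" using prod_section_in[OF s z \<omega>0] .
  note c = prod_section_slice[OF s z]
  have m: "(\<lambda>\<omega>. s (z, \<omega>)) \<in> measurable \<mu> (borel_of (mtopology_of (fiber C z)))"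
    using measurable_borel_of_continuous_map[OF c] measurable_cong_sets[OF sets_\<mu> refl] by blast
  have cm: "continuous_map \<Omega> euclideanreal (\<lambda>\<omega>. mdist (fiber C z) (s (z, \<omega>)) ?x)"
    using c x by (intro continuous_map_mdist) auto
  then obtain M where M: "0 < M" "\<And>\<omega>. \<omega> \<in> topspace \<Omega> \<Longrightarrow> mdist (fiber C z) (s (z, \<omega>)) ?x < M"
    using compact_real_bounded by blast
  have "(\<lambda>\<omega>. mdist (fiber C z) (s (z, \<omega>)) ?x) \<in> borel_measurable \<mu>"
    using borel_measurable_continuous_map[OF cm] measurable_cong_sets[OF sets_\<mu> refl] by blast
  moreover have "(mdist (fiber C z) (s (z, \<omega>)) ?x)\<^sup>2 \<le> M\<^sup>2" if "\<omega> \<in> topspace \<Omega>" for \<omega>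
    using M(2)[OF that] by (intro power_mono) auto
  ultimately have "integrable \<mu> (\<lambda>\<omega>. (mdist (fiber C z) (s (z, \<omega>)) ?x)\<^sup>2)"
    by (intro \<mu>.integrable_const_bound[of _ "M\<^sup>2"]) auto
  then show ?thesis using m x by (auto simp: L2_functions_def)
qed

lemma inner_regular:
  assumes A: "A \<in> sets \<mu>" and \<delta>: "0 < \<delta>"
  obtains K where "compactin \<Omega> K" "K \<subseteq> A" "measure \<mu> A - measure \<mu> K < \<delta>"
proof -
  interpret \<mu>: prob_space \<mu> by (rule prob_space_\<mu>)
  show ?thesis
  proof (cases "measure \<mu> A = 0")
    \<comment> \<open>Treated apart because \<open>ennreal\<close> truncates negative numbers to 0,
      so lowering the measure of a null set gives nothing strictly smaller.\<close>
    case True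
    then show ?thesis using that[of "{}"] \<delta> by simp
  next
    case False
    then have pos: "0 < measure \<mu> A" by (simp add: zero_less_measure_iff)
    have "ennreal (measure \<mu> A - \<delta>) < ennreal (measure \<mu> A)"
      using pos \<delta> by (intro ennreal_lessI) auto
    also have "\<dots> = (SUP K\<in>{K. compactin \<Omega> K \<and> K \<subseteq> A}. emeasure \<mu> K)"
      using regular A by (simp add: regular_borel_probability_def \<mu>.emeasure_eq_measure[symmetric])
    finally obtain K where K: "compactin \<Omega> K" "K \<subseteq> A" "ennreal (measure \<mu> A - \<delta>) < emeasure \<mu> K"
      unfolding less_SUP_iff by blast
    have "measure \<mu> A - \<delta> < measure \<mu> K"
      using K(3) unfolding \<mu>.emeasure_eq_measure
      by (smt (verit) ennreal_le_iff2 measure_nonneg not_le)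
    then show ?thesis using that K by force
  qed
qed

text \<open>By regularity and Urysohn's lemma the indicator function of \<open>A\<close> agrees with a continuous
  function \<open>f\<close> outside a set of small measure; the point at ratio \<open>f \<omega>\<close> on the geodesic from
  \<open>s0 (z, \<omega>)\<close> to \<open>s1 (z, \<omega>)\<close> then yields a continuous section.\<close>

lemma mix_approx:
  assumes s0: "s0 \<in> prod_sections" and s1: "s1 \<in> prod_sections" and A: "A \<in> sets \<mu>"
    and z0: "z0 \<in> topspace (base C)" and \<epsilon>: "0 < \<epsilon>"
  obtains s U where "s \<in> prod_sections" "openin (base C) U" "z0 \<in> U"
    "\<And>z. z \<in> U \<Longrightarrow> mdist (L2_space \<mu> (fiber C z))
        (L2_class \<mu> (fiber C z) (\<lambda>\<omega>. if \<omega> \<in> A then s1 (z, \<omega>) else s0 (z, \<omega>)))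
        (L2_class \<mu> (fiber C z) (\<lambda>\<omega>. s (z, \<omega>))) < \<epsilon>"
proof -
  interpret \<mu>: prob_space \<mu> by (rule prob_space_\<mu>)
  obtain U M where U: "openin (base C) U" "z0 \<in> U" and M: "0 < M"
    and bound: "\<And>z \<omega>. \<lbrakk>z \<in> U; \<omega> \<in> topspace \<Omega>\<rbrakk> \<Longrightarrow> mdist (fiber C z) (s0 (z, \<omega>)) (s1 (z, \<omega>)) \<le> M"
    using prod_sections_bounded[OF s0 s1 z0] by blast
  \<comment> \<open>Chosen so that an error of at most \<open>M\<close> on a set of measure below
    \<open>\<delta>\<close> has L2 norm below \<open>\<epsilon>\<close>. Each of \<open>A\<close>
    and its complement may lose half of it.\<close>
  define \<delta> where "\<delta> = (\<epsilon> / M)\<^sup>2"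
  have \<delta>: "0 < \<delta> / 2" using \<epsilon> M by (simp add: \<delta>_def)
  have A': "topspace \<Omega> - A \<in> sets \<mu>" using A sets.compl_sets[of A \<mu>] by simp
  obtain K1 where K1: "compactin \<Omega> K1" "K1 \<subseteq> A" "measure \<mu> A - measure \<mu> K1 < \<delta> / 2"
    using inner_regular[OF A \<delta>] .
  obtain K0 where K0: "compactin \<Omega> K0" "K0 \<subseteq> topspace \<Omega> - A"
    "measure \<mu> (topspace \<Omega> - A) - measure \<mu> K0 < \<delta> / 2"
    using inner_regular[OF A' \<delta>] .
  have cl: "closedin \<Omega> K0" "closedin \<Omega> K1"
    using K0 K1 Hausdorff by (auto intro: compactin_imp_closedin)
  have disj: "disjnt K0 K1" using K0 K1 by (auto simp: disjnt_def)
  have "normal_space \<Omega>"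
    using compact_Hausdorff_or_regular_imp_normal_space compact Hausdorff by blast
  then obtain f where f: "continuous_map \<Omega> (top_of_set {0..1}) f" "f ` K0 \<subseteq> {0}" "f ` K1 \<subseteq> {1::real}"
    using Urysohn_lemma[OF _ cl disj, of 0 1] by auto
  have fc: "continuous_map \<Omega> euclideanreal f" and f01: "\<And>\<omega>. \<omega> \<in> topspace \<Omega> \<Longrightarrow> f \<omega> \<in> {0..1}"
    using f(1) by (auto simp: continuous_map_in_subtopology)
  define s where "s = (\<lambda>p\<in>topspace prod_base. geodesic_point (prod_fiber p) (s0 p) (s1 p) (f (snd p)))"
  have s: "s \<in> prod_sections"
    unfolding s_def by (rule prod_section_geodesic_point[OF s0 s1 fc f01])
  have Ks: "K0 \<in> sets \<mu>" "K1 \<in> sets \<mu>"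
  proof -
    have "K \<in> sets \<mu>" if "closedin \<Omega> K" for K
    proof -
      have "topspace \<Omega> - K \<in> sets \<mu>" using that by (simp add: sets_\<mu> openin_sets_borel_of closedin_def)
      then have "space \<mu> - (topspace \<Omega> - K) \<in> sets \<mu>" by (rule sets.compl_sets)
      then show ?thesis using closedin_subset[OF that] by (simp add: double_diff)
    qed
    then show "K0 \<in> sets \<mu>" "K1 \<in> sets \<mu>" using cl by auto
  qed
  define B where "B = topspace \<Omega> - (K0 \<union> K1)"
  have B: "B \<in> sets \<mu>" using Ks sets.compl_sets[of "K0 \<union> K1" \<mu>] by (simp add: B_def)
  have "measure \<mu> B = 1 - (measure \<mu> K0 + measure \<mu> K1)"
    using \<mu>.prob_compl[of "K0 \<union> K1"] \<mu>.finite_measure_Union[of K0 K1] Ks disj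
    by (simp add: B_def disjnt_def)
  then have mB: "measure \<mu> B < \<delta>"
    using K0(3) K1(3) \<mu>.prob_compl[OF A] by simp
  have "mdist (L2_space \<mu> (fiber C z))
        (L2_class \<mu> (fiber C z) (\<lambda>\<omega>. if \<omega> \<in> A then s1 (z, \<omega>) else s0 (z, \<omega>)))
        (L2_class \<mu> (fiber C z) (\<lambda>\<omega>. s (z, \<omega>))) < \<epsilon>" if z: "z \<in> U" for z
  proof -
    have zZ: "z \<in> topspace (base C)" using U(1) z openin_subset by blast
    interpret L2_setting \<mu> "fiber C z" by (rule L2_setting_fiber[OF zZ])
    let ?X = "fiber C z"
    let ?m = "\<lambda>\<omega>. if \<omega> \<in> A then s1 (z, \<omega>) else s0 (z, \<omega>)"
    have L: "?m \<in> L2_functions \<mu> ?X" "(\<lambda>\<omega>. s (z, \<omega>)) \<in> L2_functions \<mu> ?X"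
      using L2_mix[OF A prod_section_L2[OF s1 zZ] prod_section_L2[OF s0 zZ]] prod_section_L2[OF s zZ] by auto
    \<comment> \<open>On \<open>K0\<close> and \<open>K1\<close> the ratio is 0 and 1, so
      \<open>s\<close> hits exactly the endpoint selected by \<open>A\<close>. On the rest,
      \<open>B\<close>, both points lie on a geodesic of length at most \<open>M\<close>.\<close>
    have pt: "(mdist ?X (?m \<omega>) (s (z, \<omega>)))\<^sup>2 \<le> M\<^sup>2 * indicator B \<omega>" if \<omega>: "\<omega> \<in> space \<mu>" for \<omega>
    proof -
      have \<omega>: "\<omega> \<in> topspace \<Omega>" using that by simp
      note X = CAT0_fiber[OF zZ]
      note p0 = prod_section_in[OF s0 zZ \<omega>] and p1 = prod_section_in[OF s1 zZ \<omega>]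
      let ?d = "mdist ?X (s0 (z, \<omega>)) (s1 (z, \<omega>))"
      have sz: "s (z, \<omega>) = geodesic_point ?X (s0 (z, \<omega>)) (s1 (z, \<omega>)) (f \<omega>)"
        using zZ \<omega> by (simp add: s_def)
      have ends: "geodesic_point ?X (s0 (z, \<omega>)) (s1 (z, \<omega>)) 0 = s0 (z, \<omega>)"
        "geodesic_point ?X (s0 (z, \<omega>)) (s1 (z, \<omega>)) 1 = s1 (z, \<omega>)"
        using geodesic_geodesic_point[OF X p0 p1] by (auto simp: geodesic_def)
      have e0: "mdist ?X (s0 (z, \<omega>)) (s (z, \<omega>)) = f \<omega> * ?d"
        using mdist_geodesic_point_same[OF X p0 p1 _ f01[OF \<omega>], of 0] f01[OF \<omega>] by (simp add: sz ends)
      have e1: "mdist ?X (s1 (z, \<omega>)) (s (z, \<omega>)) = (1 - f \<omega>) * ?d"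
        using mdist_geodesic_point_same[OF X p0 p1 _ f01[OF \<omega>], of 1] f01[OF \<omega>] by (simp add: sz ends)
      have "f \<omega> * ?d \<le> 1 * M" "(1 - f \<omega>) * ?d \<le> 1 * M"
        using bound[OF z \<omega>] f01[OF \<omega>] by (intro mult_mono; simp)+
      then have "mdist ?X (?m \<omega>) (s (z, \<omega>)) \<le> M" using e0 e1 by auto
      moreover have "mdist ?X (?m \<omega>) (s (z, \<omega>)) = 0" if not_B: "\<omega> \<notin> B"
      proof -
        consider "\<omega> \<in> K0" | "\<omega> \<in> K1" using not_B \<omega> by (auto simp: B_def)
        then show ?thesis
        proof cases
          case 1
          then have "f \<omega> = 0" "\<omega> \<notin> A" using f(2) K0(2) by auto
          then show ?thesis using e0 by simp
        next
          case 2
          then have "f \<omega> = 1" "\<omega> \<in> A" using f(3) K1(2) by auto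
          then show ?thesis using e1 by simp
        qed
      qed
      ultimately show ?thesis
        using power_mono[of "mdist ?X (?m \<omega>) (s (z, \<omega>))" M 2] by (cases "\<omega> \<in> B") auto
    qed
    have "(\<integral>\<omega>. (mdist ?X (?m \<omega>) (s (z, \<omega>)))\<^sup>2 \<partial>\<mu>) \<le> (\<integral>\<omega>. M\<^sup>2 * indicator B \<omega> \<partial>\<mu>)"
      using L2_integrable[OF L] B pt by (intro integral_mono) (auto simp: \<mu>.emeasure_eq_measure)
    also have "\<dots> = M\<^sup>2 * measure \<mu> B" using B by (simp add: B_def Int_absorb2)
    also have "\<dots> < M\<^sup>2 * \<delta>" using mB M by simp
    also have "\<dots> = \<epsilon>\<^sup>2" using M by (simp add: \<delta>_def power_divide)
    finally have "L2_dist ?m (\<lambda>\<omega>. s (z, \<omega>)) < sqrt (\<epsilon>\<^sup>2)" by (rule real_sqrt_less_mono)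
    then show ?thesis unfolding mdist_L2_space[OF L] using \<epsilon> by simp
  qed
  then show ?thesis using that s U by blast
qed

end

lemma isometry_continuous_map:
  assumes "f \<in> mspace X \<rightarrow> mspace Y"
    and "\<And>x y. \<lbrakk>x \<in> mspace X; y \<in> mspace X\<rbrakk> \<Longrightarrow> mdist Y (f x) (f y) = mdist X x y"
  shows "continuous_map (mtopology_of X) (mtopology_of Y) f"
proof -
  have "Lipschitz_continuous_map X Y f"
    unfolding Lipschitz_continuous_map_def using assms by (auto intro!: exI[of _ 1])
  then show ?thesis by (rule Lipschitz_continuous_imp_continuous_map)
qed

lemma L2_functions_isometry:
  assumes f: "f \<in> mspace X \<rightarrow> mspace Y"
    and d: "\<And>x y. \<lbrakk>x \<in> mspace X; y \<in> mspace X\<rbrakk> \<Longrightarrow> mdist Y (f x) (f y) = mdist X x y"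
    and \<xi>: "\<xi> \<in> L2_functions \<mu> X"
  shows "(\<lambda>\<omega>. f (\<xi> \<omega>)) \<in> L2_functions \<mu> Y"
proof -
  obtain x where x: "x \<in> mspace X" "integrable \<mu> (\<lambda>\<omega>. (mdist X (\<xi> \<omega>) x)\<^sup>2)"
    and m: "\<xi> \<in> measurable \<mu> (borel_of (mtopology_of X))"
    using \<xi> by (auto simp: L2_functions_def)
  have "(\<lambda>\<omega>. f (\<xi> \<omega>)) \<in> measurable \<mu> (borel_of (mtopology_of Y))"
    using measurable_compose[OF m measurable_borel_of_continuous_map[OF isometry_continuous_map[OF f d]]] .
  moreover have "integrable \<mu> (\<lambda>\<omega>. (mdist Y (f (\<xi> \<omega>)) (f x))\<^sup>2)"
    using x(2) by (rule Bochner_Integration.integrable_cong[OF refl, THEN iffD1, rotated])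
      (use measurable_space[OF m] x(1) d in auto)
  ultimately show ?thesis using f x(1) by (auto simp: L2_functions_def)
qed

section \<open>Automorphisms acting piecewise on the randomization\<close>

text \<open>The inverse is kept explicit because sections and classes are transported back along it;
  for an action it will be the value at the inverse group element.\<close>

definition inverse_pair :: "('z, 'a) metric_field \<Rightarrow> ('z, 'a) field_map \<Rightarrow> ('z, 'a) field_map \<Rightarrow> bool" where
  "inverse_pair C \<phi> \<psi> \<longleftrightarrow> \<phi> \<in> Isom C \<and> \<psi> \<in> Isom C \<and>
     compose_maps C \<phi> \<psi> = one (Isom_group C) \<and> compose_maps C \<psi> \<phi> = one (Isom_group C)"

lemma inverse_pair_commute: "inverse_pair C \<phi> \<psi> \<longleftrightarrow> inverse_pair C \<psi> \<phi>"
  by (auto simp: inverse_pair_def)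

lemma Isom_base_continuous: "\<phi> \<in> Isom C \<Longrightarrow> continuous_map (base C) (base C) (base_map \<phi>)"
  by (simp add: Isom_def homeomorphic_imp_continuous_map)

lemma Isom_base_in: "\<lbrakk>\<phi> \<in> Isom C; z \<in> topspace (base C)\<rbrakk> \<Longrightarrow> base_map \<phi> z \<in> topspace (base C)"
  using Isom_base_continuous by (fastforce simp: continuous_map_def)

lemma Isom_fiber:
  assumes "\<phi> \<in> Isom C" "z \<in> topspace (base C)"
  shows "bij_betw (fiber_map \<phi> z) (mspace (fiber C (base_map \<phi> z))) (mspace (fiber C z))"
    and "fiber_map \<phi> z \<in> mspace (fiber C (base_map \<phi> z)) \<rightarrow> mspace (fiber C z)"
    and "\<And>x y. \<lbrakk>x \<in> mspace (fiber C (base_map \<phi> z)); y \<in> mspace (fiber C (base_map \<phi> z))\<rbrakk>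
      \<Longrightarrow> mdist (fiber C z) (fiber_map \<phi> z x) (fiber_map \<phi> z y) = mdist (fiber C (base_map \<phi> z)) x y"
proof -
  note * = assms(1)[unfolded Isom_def Let_def mem_Collect_eq, THEN conjunct2, THEN conjunct2,
      THEN conjunct2, THEN conjunct1, rule_format, OF assms(2)]
  show bij: "bij_betw (fiber_map \<phi> z) (mspace (fiber C (base_map \<phi> z))) (mspace (fiber C z))"
    using * by blast
  then show "fiber_map \<phi> z \<in> mspace (fiber C (base_map \<phi> z)) \<rightarrow> mspace (fiber C z)"
    by (rule bij_betw_imp_funcset)
  show "mdist (fiber C z) (fiber_map \<phi> z x) (fiber_map \<phi> z y) = mdist (fiber C (base_map \<phi> z)) x y"
    if "x \<in> mspace (fiber C (base_map \<phi> z))" "y \<in> mspace (fiber C (base_map \<phi> z))" for x y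
    using * that by blast
qed

lemma Isom_sections: "\<lbrakk>\<phi> \<in> Isom C; s \<in> sections C\<rbrakk> \<Longrightarrow> apply_section C \<phi> s \<in> sections C"
  by (simp add: Isom_def)

lemma inverse_pair_Isom: "inverse_pair C \<phi> \<psi> \<Longrightarrow> \<phi> \<in> Isom C" "inverse_pair C \<phi> \<psi> \<Longrightarrow> \<psi> \<in> Isom C"
  by (auto simp: inverse_pair_def)

lemma inverse_pair_base:
  assumes "inverse_pair C \<phi> \<psi>" "z \<in> topspace (base C)"
  shows "base_map \<psi> (base_map \<phi> z) = z"
proof -
  have "fst (compose_maps C \<phi> \<psi>) z = fst (one (Isom_group C)) z" using assms by (simp add: inverse_pair_def)
  then show ?thesis using assms(2) by (simp add: compose_maps_def Isom_group_def)
qed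

lemma inverse_pair_fiber:
  assumes "inverse_pair C \<phi> \<psi>" "z \<in> topspace (base C)" "x \<in> mspace (fiber C z)"
  shows "fiber_map \<phi> z (fiber_map \<psi> (base_map \<phi> z) x) = x"
proof -
  have "snd (compose_maps C \<phi> \<psi>) z x = snd (one (Isom_group C)) z x" using assms by (simp add: inverse_pair_def)
  then show ?thesis
    using assms inverse_pair_base[OF assms(1,2)] by (simp add: compose_maps_def Isom_group_def)
qed

context field_setting
begin

section \<open>Transport of product sections along automorphisms\<close>

abbreviation pull :: "('z, 'a) field_map \<Rightarrow> ('z \<times> 'w \<Rightarrow> 'a) \<Rightarrow> 'z \<times> 'w \<Rightarrow> 'a" where
  "pull \<phi> s \<equiv> \<lambda>p\<in>topspace prod_base. fiber_map \<phi> (fst p) (s (base_map \<phi> (fst p), snd p))"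

text \<open>Since \<open>\<phi>\<close> is isometric on fibers, the distance of the image to
  \<open>s0\<close> at \<open>z\<close> equals the distance of \<open>s\<close> to the
  \<open>\<psi>\<close>-image of \<open>s0\<close> at \<open>base_map \<phi> z\<close>. The latter
  is a continuous function precomposed with a continuous map.\<close>

lemma prod_section_pull:
  assumes p: "inverse_pair C \<phi> \<psi>" and s: "s \<in> prod_sections"
  shows "pull \<phi> s \<in> prod_sections" (is "?t \<in> _")
proof (rule prod_sectionsI)
  note I = inverse_pair_Isom[OF p]
  have s_in: "s (base_map \<phi> z, \<omega>) \<in> mspace (fiber C (base_map \<phi> z))"
    if "z \<in> topspace (base C)" "\<omega> \<in> topspace \<Omega>" for z \<omega>
    using that by (intro prod_section_in[OF s] Isom_base_in[OF I(1)])
  show "?t (z, \<omega>) \<in> mspace (fiber C z)" if "z \<in> topspace (base C)" "\<omega> \<in> topspace \<Omega>" for z \<omega>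
    using that s_in[OF that] Isom_fiber(2)[OF I(1) that(1)] by auto
  fix s0 assume s0: "s0 \<in> sections C"
  define s0' where "s0' = apply_section C \<psi> s0"
  have s0': "s0' \<in> sections C" unfolding s0'_def by (rule Isom_sections[OF I(2) s0])
  have cs: "continuous_map prod_base euclideanreal (\<lambda>p. mdist (prod_fiber p) (s p) (lift s0' p))"
    using s s0' by (simp only: prod_sections_iff cocontinuous_def)
  have cb: "continuous_map prod_base prod_base (\<lambda>p. (base_map \<phi> (fst p), snd p))"
    using continuous_map_compose[OF continuous_map_fst Isom_base_continuous[OF I(1)]]
    by (intro continuous_map_pairedI continuous_map_snd) (simp add: comp_def)
  have "cocontinuous prod_base prod_fiber ?t (lift s0)"
    unfolding cocontinuous_def
  proof (rule continuous_map_eq[OF continuous_map_compose[OF cb cs]])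
    fix p assume "p \<in> topspace prod_base"
    then obtain z \<omega> where q: "p = (z, \<omega>)" "z \<in> topspace (base C)" "\<omega> \<in> topspace \<Omega>" by (cases p) auto
    note bz = Isom_base_in[OF I(1) q(2)]
    have "s0' (base_map \<phi> z) = fiber_map \<psi> (base_map \<phi> z) (s0 z)"
      using bz inverse_pair_base[OF p q(2)] by (simp add: s0'_def apply_section_def)
    then have "fiber_map \<phi> z (s0' (base_map \<phi> z)) = s0 z"
      using inverse_pair_fiber[OF p q(2) section_in[OF s0 q(2)]] by simp
    then have "mdist (fiber C z) (fiber_map \<phi> z (s (base_map \<phi> z, \<omega>))) (s0 z)
      = mdist (fiber C (base_map \<phi> z)) (s (base_map \<phi> z, \<omega>)) (s0' (base_map \<phi> z))"
      using Isom_fiber(3)[OF I(1) q(2) s_in[OF q(2,3)] section_in[OF s0' bz]] by simp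
    then show "((\<lambda>p. mdist (prod_fiber p) (s p) (lift s0' p)) \<circ> (\<lambda>p. (base_map \<phi> (fst p), snd p))) p
      = mdist (prod_fiber p) (?t p) (lift s0 p)"
      using q bz by simp
  qed
  then show "cocontinuous prod_base prod_fiber (lift s0) ?t" by (simp add: cocontinuous_commute)
qed simp

section \<open>Fibers and continuous sections of the randomization\<close>

abbreviation R :: "('z, ('w \<Rightarrow> 'a) set) metric_field" where
  "R \<equiv> randomization \<Omega> \<mu> C"

abbreviation L2_fiber :: "'z \<Rightarrow> ('w \<Rightarrow> 'a) set metric" where
  "L2_fiber z \<equiv> L2_space \<mu> (fiber C z)"

abbreviation slice_class :: "('z \<times> 'w \<Rightarrow> 'a) \<Rightarrow> 'z \<Rightarrow> ('w \<Rightarrow> 'a) set" where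
  "slice_class s \<equiv> \<lambda>z\<in>topspace (base C). L2_class \<mu> (fiber C z) (\<lambda>\<omega>. s (z, \<omega>))"

lemma base_R [simp]: "base R = base C"
  by (simp add: randomization_def generated_field_def Let_def)

lemma mdist_R [simp]: "mdist (fiber R z) = mdist (L2_fiber z)"
  by (simp add: randomization_def generated_field_def Let_def)

lemma slice_class_in_L2:
  "\<lbrakk>s \<in> prod_sections; z \<in> topspace (base C)\<rbrakk> \<Longrightarrow> slice_class s z \<in> mspace (L2_fiber z)"
  by (simp add: L2_setting.L2_class_in_mspace[OF L2_setting_fiber] prod_section_L2)

text \<open>Closure in the L2 space in terms of distances; this is the form in which images under
  glued maps are shown to lie in the fiber again.\<close>

lemma fiber_R_iff:
  assumes z: "z \<in> topspace (base C)"
  shows "c \<in> mspace (fiber R z) \<longleftrightarrow> c \<in> mspace (L2_fiber z) \<and>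
    (\<forall>\<epsilon>>0. \<exists>s\<in>prod_sections. mdist (L2_fiber z) c (slice_class s z) < \<epsilon>)"
proof -
  let ?S = "{\<sigma> z | \<sigma>. \<sigma> \<in> {slice_class s | s. s \<in> prod_sections}}"
  have S: "?S \<subseteq> mspace (L2_fiber z)" using slice_class_in_L2[OF _ z] by blast
  have "mspace (fiber R z) = mtopology_of (L2_fiber z) closure_of ?S \<inter> mspace (L2_fiber z)"
    by (simp only: randomization_def generated_field_def Let_def metric_field.simps mspace_submetric)
  also have "\<dots> = mtopology_of (L2_fiber z) closure_of ?S"
    using closure_of_subset_topspace[of "mtopology_of (L2_fiber z)" ?S] by (simp only: topspace_mtopology_of Int_absorb2)
  finally have R: "mspace (fiber R z) = mtopology_of (L2_fiber z) closure_of ?S" .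
  have E: "(\<exists>y\<in>?S. P y) \<longleftrightarrow> (\<exists>s\<in>prod_sections. P (slice_class s z))" for P
    by blast
  show ?thesis
    unfolding R in_closure_of_mtopology_of[OF S] E ..
qed

lemma fiber_R_subset: "z \<in> topspace (base C) \<Longrightarrow> c \<in> mspace (fiber R z) \<Longrightarrow> c \<in> mspace (L2_fiber z)"
  by (simp add: fiber_R_iff)

lemma slice_class_in_R:
  assumes "s \<in> prod_sections" "z \<in> topspace (base C)"
  shows "slice_class s z \<in> mspace (fiber R z)"
proof -
  note L = slice_class_in_L2[OF assms]
  have "mdist (L2_fiber z) (slice_class s z) (slice_class s z) = 0"
    unfolding mdist_zero[OF L L] ..
  then show ?thesis
    unfolding fiber_R_iff[OF assms(2)] using L assms(1) by (intro conjI allI impI bexI[of _ s]) (simp_all only:)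
qed

lemma sections_R_iff:
  "\<sigma> \<in> sections R \<longleftrightarrow> \<sigma> \<in> all_sections (base C) (fiber R) \<and>
    (\<forall>s\<in>prod_sections. cocontinuous (base C) L2_fiber \<sigma> (slice_class s))"
proof -
  have "fiber R = (\<lambda>z. submetric (L2_fiber z) (mtopology_of (L2_fiber z) closure_of
      {s z | s. s \<in> {slice_class s | s. s \<in> prod_sections}}))"
    by (simp only: randomization_def generated_field_def Let_def metric_field.simps)
  then show ?thesis
    unfolding randomization_def generated_field_def Let_def by auto
qed

section \<open>Gluing two automorphisms over the same base map\<close>

definition piece ::
    "'w set \<Rightarrow> ('z, 'a) field_map \<Rightarrow> ('z, 'a) field_map \<Rightarrow> 'z \<Rightarrow> ('w \<Rightarrow> 'a) \<Rightarrow> 'w \<Rightarrow> 'a" where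
  "piece A \<phi>0 \<phi>1 z \<xi> = (\<lambda>\<omega>. if \<omega> \<in> A then fiber_map \<phi>1 z (\<xi> \<omega>) else fiber_map \<phi>0 z (\<xi> \<omega>))"

text \<open>The base map is read off \<open>\<phi>0\<close>; it is applied to pairs with equal base
  maps. Domains and choice of representative copy \<open>randomized_map\<close>, so that the extreme
  sets give equalities of functions and not merely of their effects.\<close>

definition mixed_map ::
    "'w set \<Rightarrow> ('z, 'a) field_map \<Rightarrow> ('z, 'a) field_map \<Rightarrow> ('z, ('w \<Rightarrow> 'a) set) field_map" where
  "mixed_map A \<phi>0 \<phi>1 =
     (base_map \<phi>0,
      \<lambda>z\<in>topspace (base C). \<lambda>c\<in>mspace (fiber R (base_map \<phi>0 z)).
        L2_class \<mu> (fiber C z) (piece A \<phi>0 \<phi>1 z (SOME \<xi>. \<xi> \<in> c)))"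

lemma base_mixed_map [simp]: "base_map (mixed_map A \<phi>0 \<phi>1) = base_map \<phi>0"
  by (simp add: mixed_map_def)

lemma mixed_map_empty: "mixed_map {} \<phi>0 \<phi>1 = randomized_map \<Omega> \<mu> C \<phi>0"
  by (simp add: mixed_map_def randomized_map_def piece_def comp_def)

lemma mixed_map_space:
  assumes "base_map \<phi>0 = base_map \<phi>1"
  shows "mixed_map (space \<mu>) \<phi>0 \<phi>1 = randomized_map \<Omega> \<mu> C \<phi>1"
proof -
  have "L2_class \<mu> (fiber C z) (piece (space \<mu>) \<phi>0 \<phi>1 z \<xi>) = L2_class \<mu> (fiber C z) (fiber_map \<phi>1 z \<circ> \<xi>)" for z \<xi>
    by (rule L2_class_cong) (simp add: piece_def)
  then show ?thesis using assms by (simp add: mixed_map_def randomized_map_def)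
qed

lemma piece_L2:
  assumes A: "A \<in> sets \<mu>" and I: "\<phi>0 \<in> Isom C" "\<phi>1 \<in> Isom C" "base_map \<phi>0 = base_map \<phi>1"
    and z: "z \<in> topspace (base C)" and \<xi>: "\<xi> \<in> L2_functions \<mu> (fiber C (base_map \<phi>0 z))"
  shows "piece A \<phi>0 \<phi>1 z \<xi> \<in> L2_functions \<mu> (fiber C z)"
  unfolding piece_def
  using L2_functions_isometry[OF Isom_fiber(2,3)[OF I(1) z] \<xi>]
    L2_functions_isometry[OF Isom_fiber(2,3)[OF I(2) z] \<xi>[unfolded I(3)]]
  by (rule L2_setting.L2_mix[OF L2_setting_fiber[OF z] A, rotated])

text \<open>The fiber maps act on values pointwise, so representatives that agree almost everywhere
  have images that do; the chosen representative can be exchanged for any other.\<close>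

lemma mixed_map_class:
  assumes A: "A \<in> sets \<mu>" and I: "\<phi>0 \<in> Isom C" "\<phi>1 \<in> Isom C" "base_map \<phi>0 = base_map \<phi>1"
    and z: "z \<in> topspace (base C)" and \<xi>: "\<xi> \<in> L2_functions \<mu> (fiber C (base_map \<phi>0 z))"
    and c: "L2_class \<mu> (fiber C (base_map \<phi>0 z)) \<xi> \<in> mspace (fiber R (base_map \<phi>0 z))" (is "?c \<in> _")
  shows "fiber_map (mixed_map A \<phi>0 \<phi>1) z ?c = L2_class \<mu> (fiber C z) (piece A \<phi>0 \<phi>1 z \<xi>)"
proof -
  note bz = Isom_base_in[OF I(1) z]
  interpret b: L2_setting \<mu> "fiber C (base_map \<phi>0 z)" by (rule L2_setting_fiber[OF bz])
  interpret f: L2_setting \<mu> "fiber C z" by (rule L2_setting_fiber[OF z])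
  let ?\<eta> = "SOME \<xi>. \<xi> \<in> ?c"
  note \<eta> = b.L2_class_some[OF fiber_R_subset[OF bz c]]
  have "AE \<omega> in \<mu>. ?\<eta> \<omega> = \<xi> \<omega>" using \<eta>(2) b.L2_class_eq_iff[OF \<eta>(1) \<xi>] by simp
  then have "AE \<omega> in \<mu>. piece A \<phi>0 \<phi>1 z ?\<eta> \<omega> = piece A \<phi>0 \<phi>1 z \<xi> \<omega>"
    by (rule AE_mp) (auto simp: piece_def)
  then show ?thesis
    using f.L2_class_eq_iff[OF piece_L2[OF A I z \<eta>(1)] piece_L2[OF A I z \<xi>]] z c
    by (simp add: mixed_map_def)
qed

lemma fiber_R_class:
  assumes z: "z \<in> topspace (base C)" and c: "c \<in> mspace (fiber R z)"
  obtains \<xi> where "\<xi> \<in> L2_functions \<mu> (fiber C z)" "c = L2_class \<mu> (fiber C z) \<xi>"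
  using that[OF L2_setting.L2_class_some(1)[OF L2_setting_fiber[OF z] fiber_R_subset[OF z c]]]
    L2_setting.L2_class_some(2)[OF L2_setting_fiber[OF z] fiber_R_subset[OF z c]] by simp

text \<open>Equal base maps give both fiber maps the same source and target, so distances of values
  are kept on \<open>A\<close> and off \<open>A\<close>, hence under the integral.\<close>

lemma mixed_map_dist:
  assumes A: "A \<in> sets \<mu>" and I: "\<phi>0 \<in> Isom C" "\<phi>1 \<in> Isom C" "base_map \<phi>0 = base_map \<phi>1"
    and z: "z \<in> topspace (base C)"
    and c: "c \<in> mspace (fiber R (base_map \<phi>0 z))" and d: "d \<in> mspace (fiber R (base_map \<phi>0 z))"
  shows "mdist (L2_fiber z) (fiber_map (mixed_map A \<phi>0 \<phi>1) z c) (fiber_map (mixed_map A \<phi>0 \<phi>1) z d)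
    = mdist (L2_fiber (base_map \<phi>0 z)) c d"
proof -
  note bz = Isom_base_in[OF I(1) z]
  interpret b: L2_setting \<mu> "fiber C (base_map \<phi>0 z)" by (rule L2_setting_fiber[OF bz])
  interpret f: L2_setting \<mu> "fiber C z" by (rule L2_setting_fiber[OF z])
  obtain \<xi> where \<xi>: "\<xi> \<in> L2_functions \<mu> (fiber C (base_map \<phi>0 z))" "c = L2_class \<mu> (fiber C (base_map \<phi>0 z)) \<xi>"
    using fiber_R_class[OF bz c] .
  obtain \<eta> where \<eta>: "\<eta> \<in> L2_functions \<mu> (fiber C (base_map \<phi>0 z))" "d = L2_class \<mu> (fiber C (base_map \<phi>0 z)) \<eta>"
    using fiber_R_class[OF bz d] .
  have "mdist (fiber C z) (piece A \<phi>0 \<phi>1 z \<xi> \<omega>) (piece A \<phi>0 \<phi>1 z \<eta> \<omega>)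
      = mdist (fiber C (base_map \<phi>0 z)) (\<xi> \<omega>) (\<eta> \<omega>)" if "\<omega> \<in> space \<mu>" for \<omega>
    using Isom_fiber(3)[OF I(1) z b.L2_in_mspace[OF \<xi>(1) that] b.L2_in_mspace[OF \<eta>(1) that]]
      Isom_fiber(3)[OF I(2) z, folded I(3), OF b.L2_in_mspace[OF \<xi>(1) that] b.L2_in_mspace[OF \<eta>(1) that]]
    by (simp add: piece_def)
  then have "f.L2_dist (piece A \<phi>0 \<phi>1 z \<xi>) (piece A \<phi>0 \<phi>1 z \<eta>) = b.L2_dist \<xi> \<eta>"
    by (intro arg_cong[where f = sqrt] Bochner_Integration.integral_cong) auto
  then show ?thesis
    using c d unfolding \<xi>(2) \<eta>(2)
    by (simp add: mixed_map_class[OF A I z] \<xi>(1) \<eta>(1) b.mdist_L2_space f.mdist_L2_space piece_L2[OF A I z])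
qed

lemma mixed_map_slice_class:
  assumes A: "A \<in> sets \<mu>" and I: "\<phi>0 \<in> Isom C" "\<phi>1 \<in> Isom C" "base_map \<phi>0 = base_map \<phi>1"
    and z: "z \<in> topspace (base C)" and s: "s \<in> prod_sections"
  shows "fiber_map (mixed_map A \<phi>0 \<phi>1) z (slice_class s (base_map \<phi>0 z)) =
    L2_class \<mu> (fiber C z) (piece A \<phi>0 \<phi>1 z (\<lambda>\<omega>. s (base_map \<phi>0 z, \<omega>)))"
  using mixed_map_class[OF A I z prod_section_L2[OF s Isom_base_in[OF I(1) z]]]
    slice_class_in_R[OF s Isom_base_in[OF I(1) z]] Isom_base_in[OF I(1) z] by simp

text \<open>Exhibits the image as two continuous product sections glued along \<open>A\<close>, the
  situation of \<open>mix_approx\<close>.\<close>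

lemma mixed_map_slice_class_pull:
  assumes A: "A \<in> sets \<mu>" and I: "\<phi>0 \<in> Isom C" "\<phi>1 \<in> Isom C" "base_map \<phi>0 = base_map \<phi>1"
    and z: "z \<in> topspace (base C)" and s: "s \<in> prod_sections"
  shows "fiber_map (mixed_map A \<phi>0 \<phi>1) z (slice_class s (base_map \<phi>0 z)) =
    L2_class \<mu> (fiber C z) (\<lambda>\<omega>. if \<omega> \<in> A then pull \<phi>1 s (z, \<omega>) else pull \<phi>0 s (z, \<omega>))"
  unfolding mixed_map_slice_class[OF assms]
  by (rule L2_class_cong) (use z I(3) in \<open>simp add: piece_def\<close>)

text \<open>The substitute for the statement that images of slice classes are slice classes, which
  gluing along a merely measurable set destroys.\<close>

lemma mixed_map_slice_class_approx:
  assumes A: "A \<in> sets \<mu>" and p: "inverse_pair C \<phi>0 \<psi>0" "inverse_pair C \<phi>1 \<psi>1"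
    and b: "base_map \<phi>0 = base_map \<phi>1"
    and z0: "z0 \<in> topspace (base C)" and s: "s \<in> prod_sections" and \<epsilon>: "0 < \<epsilon>"
  obtains s' U where "s' \<in> prod_sections" "openin (base C) U" "z0 \<in> U"
    "\<And>z. z \<in> U \<Longrightarrow> mdist (L2_fiber z) (fiber_map (mixed_map A \<phi>0 \<phi>1) z (slice_class s (base_map \<phi>0 z)))
      (slice_class s' z) < \<epsilon>"
proof -
  note I = inverse_pair_Isom(1)[OF p(1)] inverse_pair_Isom(1)[OF p(2)] b
  obtain s' U where s': "s' \<in> prod_sections" "openin (base C) U" "z0 \<in> U"
    and d: "\<And>z. z \<in> U \<Longrightarrow> mdist (L2_fiber z)
        (L2_class \<mu> (fiber C z) (\<lambda>\<omega>. if \<omega> \<in> A then pull \<phi>1 s (z, \<omega>) else pull \<phi>0 s (z, \<omega>)))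
        (L2_class \<mu> (fiber C z) (\<lambda>\<omega>. s' (z, \<omega>))) < \<epsilon>"
    using mix_approx[OF prod_section_pull[OF p(1) s] prod_section_pull[OF p(2) s] A z0 \<epsilon>] by blast
  have "mdist (L2_fiber z) (fiber_map (mixed_map A \<phi>0 \<phi>1) z (slice_class s (base_map \<phi>0 z)))
      (slice_class s' z) < \<epsilon>" if "z \<in> U" for z
  proof -
    have z: "z \<in> topspace (base C)" using that s'(2) openin_subset by blast
    then show ?thesis using d[OF that] unfolding mixed_map_slice_class_pull[OF A I z s] by simp
  qed
  then show ?thesis using that s' by blast
qed

lemma mixed_map_in_L2:
  assumes A: "A \<in> sets \<mu>" and I: "\<phi>0 \<in> Isom C" "\<phi>1 \<in> Isom C" "base_map \<phi>0 = base_map \<phi>1"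
    and z: "z \<in> topspace (base C)" and c: "c \<in> mspace (fiber R (base_map \<phi>0 z))"
  shows "fiber_map (mixed_map A \<phi>0 \<phi>1) z c \<in> mspace (L2_fiber z)"
proof -
  obtain \<xi> where \<xi>: "\<xi> \<in> L2_functions \<mu> (fiber C (base_map \<phi>0 z))" "c = L2_class \<mu> (fiber C (base_map \<phi>0 z)) \<xi>"
    using fiber_R_class[OF Isom_base_in[OF I(1) z] c] .
  then show ?thesis
    using mixed_map_class[OF A I z \<xi>(1)] c L2_setting.L2_class_in_mspace[OF L2_setting_fiber[OF z] piece_L2[OF A I z \<xi>(1)]]
    by simp
qed

text \<open>A class near \<open>c\<close> stays equally near after the isometry, and its image is
  near another slice class by \<open>mixed_map_slice_class_approx\<close>; each step takes half of
  \<open>\<epsilon>\<close>.\<close>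

lemma mixed_map_in:
  assumes A: "A \<in> sets \<mu>" and p: "inverse_pair C \<phi>0 \<psi>0" "inverse_pair C \<phi>1 \<psi>1"
    and b: "base_map \<phi>0 = base_map \<phi>1"
    and z: "z \<in> topspace (base C)" and c: "c \<in> mspace (fiber R (base_map \<phi>0 z))"
  shows "fiber_map (mixed_map A \<phi>0 \<phi>1) z c \<in> mspace (fiber R z)"
  unfolding fiber_R_iff[OF z]
proof (intro conjI allI impI)
  note I = inverse_pair_Isom(1)[OF p(1)] inverse_pair_Isom(1)[OF p(2)] b
  let ?m = "fiber_map (mixed_map A \<phi>0 \<phi>1) z"
  note bz = Isom_base_in[OF I(1) z]
  show m: "?m c \<in> mspace (L2_fiber z)" by (rule mixed_map_in_L2[OF A I z c])
  fix \<epsilon> :: real assume "0 < \<epsilon>"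
  then have \<epsilon>: "0 < \<epsilon> / 2" by simp
  obtain s where s: "s \<in> prod_sections" "mdist (L2_fiber (base_map \<phi>0 z)) c (slice_class s (base_map \<phi>0 z)) < \<epsilon> / 2"
    using c \<epsilon> unfolding fiber_R_iff[OF bz] by blast
  obtain s' U where s': "s' \<in> prod_sections" "z \<in> U"
    and d: "\<And>z. z \<in> U \<Longrightarrow> mdist (L2_fiber z) (fiber_map (mixed_map A \<phi>0 \<phi>1) z (slice_class s (base_map \<phi>0 z)))
      (slice_class s' z) < \<epsilon> / 2"
    using mixed_map_slice_class_approx[OF A p b z s(1) \<epsilon>] by blast
  note sR = slice_class_in_R[OF s(1) bz]
  have "mdist (L2_fiber z) (?m c) (slice_class s' z) \<le>
      mdist (L2_fiber z) (?m c) (?m (slice_class s (base_map \<phi>0 z)))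
      + mdist (L2_fiber z) (?m (slice_class s (base_map \<phi>0 z))) (slice_class s' z)"
    using m mixed_map_in_L2[OF A I z sR] slice_class_in_L2[OF s'(1) z] by (rule mdist_triangle)
  also have "\<dots> < \<epsilon> / 2 + \<epsilon> / 2"
    using s(2) d[OF s'(2)] unfolding mixed_map_dist[OF A I z c sR] by (rule add_strict_mono)
  finally show "\<exists>s\<in>prod_sections. mdist (L2_fiber z) (?m c) (slice_class s z) < \<epsilon>"
    using s'(1) by auto
qed

text \<open>Both maps are glued along the same \<open>A\<close>, so at each \<open>\<omega>\<close>
  only \<open>\<phi>1\<close> meets \<open>\<psi>1\<close> or only \<open>\<phi>0\<close> meets
  \<open>\<psi>0\<close>.\<close>

lemma mixed_map_compose_apply:
  assumes A: "A \<in> sets \<mu>"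
    and I: "\<phi>0 \<in> Isom C" "\<phi>1 \<in> Isom C" and b: "base_map \<phi>0 = base_map \<phi>1"
    and p: "inverse_pair C \<psi>0 \<psi>0'" "inverse_pair C \<psi>1 \<psi>1'" and b': "base_map \<psi>0 = base_map \<psi>1"
    and z: "z \<in> topspace (base C)"
    and \<xi>: "\<xi> \<in> L2_functions \<mu> (fiber C (base_map \<psi>0 (base_map \<phi>0 z)))"
    and c: "L2_class \<mu> (fiber C (base_map \<psi>0 (base_map \<phi>0 z))) \<xi> \<in> mspace (fiber R (base_map \<psi>0 (base_map \<phi>0 z)))"
      (is "?c \<in> _")
  shows "fiber_map (mixed_map A \<phi>0 \<phi>1) z (fiber_map (mixed_map A \<psi>0 \<psi>1) (base_map \<phi>0 z) ?c)
    = L2_class \<mu> (fiber C z) (\<lambda>\<omega>. if \<omega> \<in> A then fiber_map \<phi>1 z (fiber_map \<psi>1 (base_map \<phi>0 z) (\<xi> \<omega>))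
        else fiber_map \<phi>0 z (fiber_map \<psi>0 (base_map \<phi>0 z) (\<xi> \<omega>)))"
proof -
  note bz = Isom_base_in[OF I(1) z]
  note I' = inverse_pair_Isom(1)[OF p(1)] inverse_pair_Isom(1)[OF p(2)] b'
  have e: "fiber_map (mixed_map A \<psi>0 \<psi>1) (base_map \<phi>0 z) ?c
    = L2_class \<mu> (fiber C (base_map \<phi>0 z)) (piece A \<psi>0 \<psi>1 (base_map \<phi>0 z) \<xi>)"
    by (rule mixed_map_class[OF A I' bz \<xi> c])
  \<comment> \<open>The outer map is extensional on the fiber of the randomization, so the
    intermediate class must lie there and not just in the L2 space. This is where the inverses of
    \<open>\<psi>0\<close> and \<open>\<psi>1\<close> are used.\<close>
  have "fiber_map (mixed_map A \<psi>0 \<psi>1) (base_map \<phi>0 z) ?c \<in> mspace (fiber R (base_map \<phi>0 z))"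
    by (rule mixed_map_in[OF A p b' bz c])
  then show ?thesis
    unfolding e using mixed_map_class[OF A I b z piece_L2[OF A I' bz \<xi>]]
    by (simp add: piece_def if_distrib cong: if_cong)
qed

lemma mixed_map_inverse:
  assumes A: "A \<in> sets \<mu>" and p: "inverse_pair C \<phi>0 \<psi>0" "inverse_pair C \<phi>1 \<psi>1"
    and b: "base_map \<phi>0 = base_map \<phi>1" "base_map \<psi>0 = base_map \<psi>1"
    and z: "z \<in> topspace (base C)" and c: "c \<in> mspace (fiber R z)"
  shows "fiber_map (mixed_map A \<phi>0 \<phi>1) z (fiber_map (mixed_map A \<psi>0 \<psi>1) (base_map \<phi>0 z) c) = c"
proof -
  note I = inverse_pair_Isom(1)[OF p(1)] inverse_pair_Isom(1)[OF p(2)] b(1)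
  note p' = p[THEN iffD1[OF inverse_pair_commute]]
  note zz = inverse_pair_base[OF p(1) z]
  obtain \<xi> where \<xi>: "\<xi> \<in> L2_functions \<mu> (fiber C z)" "c = L2_class \<mu> (fiber C z) \<xi>"
    using fiber_R_class[OF z c] .
  have "fiber_map (mixed_map A \<phi>0 \<phi>1) z (fiber_map (mixed_map A \<psi>0 \<psi>1) (base_map \<phi>0 z) c)
    = L2_class \<mu> (fiber C z) (\<lambda>\<omega>. if \<omega> \<in> A then fiber_map \<phi>1 z (fiber_map \<psi>1 (base_map \<phi>0 z) (\<xi> \<omega>))
        else fiber_map \<phi>0 z (fiber_map \<psi>0 (base_map \<phi>0 z) (\<xi> \<omega>)))"
    using mixed_map_compose_apply[OF A I p' b(2) z, unfolded zz, OF \<xi>(1)] c unfolding \<xi>(2) by blast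
  also have "\<dots> = c"
    unfolding \<xi>(2)
  proof (rule L2_class_cong)
    fix \<omega> assume "\<omega> \<in> space \<mu>"
    then have "\<xi> \<omega> \<in> mspace (fiber C z)" by (rule L2_setting.L2_in_mspace[OF L2_setting_fiber[OF z] \<xi>(1)])
    then show "(if \<omega> \<in> A then fiber_map \<phi>1 z (fiber_map \<psi>1 (base_map \<phi>0 z) (\<xi> \<omega>))
        else fiber_map \<phi>0 z (fiber_map \<psi>0 (base_map \<phi>0 z) (\<xi> \<omega>))) = \<xi> \<omega>"
      using inverse_pair_fiber[OF p(1) z] inverse_pair_fiber[OF p(2) z, folded b(1)] by simp
  qed
  finally show ?thesis .
qed

text \<open>The image of \<open>\<sigma>\<close> has to be co-continuous with every slice class. By
  isometry this amounts to co-continuity of \<open>\<sigma>\<close> with the slice class carried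
  back by the inverse glued map, composed with the base map.\<close>

lemma mixed_map_section:
  assumes A: "A \<in> sets \<mu>" and p: "inverse_pair C \<phi>0 \<psi>0" "inverse_pair C \<phi>1 \<psi>1"
    and b: "base_map \<phi>0 = base_map \<phi>1" "base_map \<psi>0 = base_map \<psi>1"
    and \<sigma>: "\<sigma> \<in> sections R"
  shows "apply_section R (mixed_map A \<phi>0 \<phi>1) \<sigma> \<in> sections R"
  unfolding sections_R_iff
proof (intro conjI ballI)
  note I = inverse_pair_Isom(1)[OF p(1)] inverse_pair_Isom(1)[OF p(2)] b(1)
  note p' = p[THEN iffD1[OF inverse_pair_commute]]
  note I' = inverse_pair_Isom(1)[OF p'(1)] inverse_pair_Isom(1)[OF p'(2)] b(2)
  have \<sigma>_in: "\<sigma> z \<in> mspace (fiber R z)" if "z \<in> topspace (base C)" for z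
    using \<sigma> that by (auto simp: sections_R_iff all_sections_def)
  show "apply_section R (mixed_map A \<phi>0 \<phi>1) \<sigma> \<in> all_sections (base C) (fiber R)"
    using mixed_map_in[OF A p b(1)] \<sigma>_in Isom_base_in[OF I(1)]
    by (auto simp: apply_section_def all_sections_def)
  fix s assume s: "s \<in> prod_sections"
  \<comment> \<open>The slice class carried back. It need not be a slice class, but near every point
    it is uniformly close to one, and with those \<open>\<sigma>\<close> is co-continuous by
    definition.\<close>
  define \<tau> where "\<tau> = apply_section R (mixed_map A \<psi>0 \<psi>1) (slice_class s)"
  have \<tau>: "\<tau> z = fiber_map (mixed_map A \<psi>0 \<psi>1) z (slice_class s (base_map \<psi>0 z))"
    if "z \<in> topspace (base C)" for z
    using that by (simp add: \<tau>_def apply_section_def)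
  have \<tau>_in: "\<tau> z \<in> mspace (fiber R z)" if "z \<in> topspace (base C)" for z
    using mixed_map_in[OF A p' b(2) that slice_class_in_R[OF s Isom_base_in[OF I'(1) that]]] \<tau>[OF that] by simp
  have c\<tau>: "cocontinuous (base C) L2_fiber \<sigma> \<tau>"
  proof (rule cocontinuous_approx)
    fix z0 and \<epsilon> :: real assume z0: "z0 \<in> topspace (base C)" and \<epsilon>: "0 < \<epsilon>"
    obtain s' U where s': "s' \<in> prod_sections" "openin (base C) U" "z0 \<in> U"
      and d: "\<And>z. z \<in> U \<Longrightarrow> mdist (L2_fiber z) (fiber_map (mixed_map A \<psi>0 \<psi>1) z (slice_class s (base_map \<psi>0 z)))
        (slice_class s' z) < \<epsilon>"
      using mixed_map_slice_class_approx[OF A p' b(2) z0 s \<epsilon>] by blast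
    have "slice_class s' z \<in> mspace (L2_fiber z) \<and> mdist (L2_fiber z) (\<tau> z) (slice_class s' z) < \<epsilon>"
      if "z \<in> U" for z
    proof -
      have z: "z \<in> topspace (base C)" using that s'(2) openin_subset by blast
      show ?thesis using slice_class_in_L2[OF s'(1) z] d[OF that] unfolding \<tau>[OF z] by blast
    qed
    moreover have "cocontinuous (base C) L2_fiber \<sigma> (slice_class s')"
      using \<sigma> s'(1) by (simp only: sections_R_iff)
    ultimately show "\<exists>\<tau>' U. openin (base C) U \<and> z0 \<in> U \<and> cocontinuous (base C) L2_fiber \<sigma> \<tau>' \<and>
        (\<forall>z\<in>U. \<tau>' z \<in> mspace (L2_fiber z) \<and> mdist (L2_fiber z) (\<tau> z) (\<tau>' z) < \<epsilon>)"
      using s' by blast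
  qed (use \<sigma>_in \<tau>_in fiber_R_subset in blast)+
  show "cocontinuous (base C) L2_fiber (apply_section R (mixed_map A \<phi>0 \<phi>1) \<sigma>) (slice_class s)"
    unfolding cocontinuous_def
  proof (rule continuous_map_eq[OF continuous_map_compose[OF Isom_base_continuous[OF I(1)] c\<tau>[unfolded cocontinuous_def]]])
    fix z assume z: "z \<in> topspace (base C)"
    note bz = Isom_base_in[OF I(1) z] and sR = slice_class_in_R[OF s z]
    have "\<tau> (base_map \<phi>0 z) = fiber_map (mixed_map A \<psi>0 \<psi>1) (base_map \<phi>0 z) (slice_class s z)"
      unfolding \<tau>[OF bz] inverse_pair_base[OF p(1) z] ..
    then have e: "fiber_map (mixed_map A \<phi>0 \<phi>1) z (\<tau> (base_map \<phi>0 z)) = slice_class s z"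
      using mixed_map_inverse[OF A p b z sR] by simp
    have "mdist (L2_fiber (base_map \<phi>0 z)) (\<sigma> (base_map \<phi>0 z)) (\<tau> (base_map \<phi>0 z))
      = mdist (L2_fiber z) (fiber_map (mixed_map A \<phi>0 \<phi>1) z (\<sigma> (base_map \<phi>0 z))) (slice_class s z)"
      using mixed_map_dist[OF A I z \<sigma>_in[OF bz] \<tau>_in[OF bz]] unfolding e by simp
    then show "((\<lambda>z. mdist (L2_fiber z) (\<sigma> z) (\<tau> z)) \<circ> base_map \<phi>0) z =
      mdist (L2_fiber z) (apply_section R (mixed_map A \<phi>0 \<phi>1) \<sigma> z) (slice_class s z)"
      using z by (simp add: apply_section_def)
  qed
qed

text \<open>Bijectivity between fibers of the randomization is witnessed by gluing the inverses
  along the same set \<open>A\<close>.\<close>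

lemma mixed_map_Isom:
  assumes A: "A \<in> sets \<mu>" and p: "inverse_pair C \<phi>0 \<psi>0" "inverse_pair C \<phi>1 \<psi>1"
    and b: "base_map \<phi>0 = base_map \<phi>1" "base_map \<psi>0 = base_map \<psi>1"
  shows "mixed_map A \<phi>0 \<phi>1 \<in> Isom R"
proof -
  note I = inverse_pair_Isom(1)[OF p(1)] inverse_pair_Isom(1)[OF p(2)] b(1)
  note p' = p[THEN iffD1[OF inverse_pair_commute]]
  let ?m = "fiber_map (mixed_map A \<phi>0 \<phi>1)" and ?n = "fiber_map (mixed_map A \<psi>0 \<psi>1)"
  have "bij_betw (?m z) (mspace (fiber R (base_map \<phi>0 z))) (mspace (fiber R z))"
    if z: "z \<in> topspace (base C)" for z
  proof (rule bij_betw_byWitness[where f' = "?n (base_map \<phi>0 z)"])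
    note bz = Isom_base_in[OF I(1) z]
    have zz: "base_map \<psi>0 (base_map \<phi>0 z) = z" by (rule inverse_pair_base[OF p(1) z])
    show "\<forall>c\<in>mspace (fiber R (base_map \<phi>0 z)). ?n (base_map \<phi>0 z) (?m z c) = c"
      using mixed_map_inverse[OF A p' b(2,1) bz] unfolding zz by blast
    show "\<forall>c\<in>mspace (fiber R z). ?m z (?n (base_map \<phi>0 z) c) = c"
      using mixed_map_inverse[OF A p b z] by blast
    show "?m z ` mspace (fiber R (base_map \<phi>0 z)) \<subseteq> mspace (fiber R z)"
      using mixed_map_in[OF A p b(1) z] by blast
    show "?n (base_map \<phi>0 z) ` mspace (fiber R z) \<subseteq> mspace (fiber R (base_map \<phi>0 z))"
      using mixed_map_in[OF A p' b(2) bz] unfolding zz by blast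
  qed
  moreover have "?m \<in> extensional (topspace (base C))"
    "\<And>z. z \<in> topspace (base C) \<Longrightarrow> ?m z \<in> extensional (mspace (fiber R (base_map \<phi>0 z)))"
    by (auto simp: mixed_map_def)
  moreover have "homeomorphic_map (base C) (base C) (base_map \<phi>0)"
    "base_map \<phi>0 \<in> extensional (topspace (base C))"
    using I(1) by (auto simp: Isom_def)
  ultimately show ?thesis
    using mixed_map_dist[OF A I] mixed_map_section[OF A p b]
    unfolding Isom_def Let_def by simp
qed

text \<open>The source of multiplicativity of each \<open>\<beta> t\<close>: composition and gluing
  along one fixed set commute, by the contravariant rule for fiber maps.\<close>

lemma mixed_map_compose:
  assumes A: "A \<in> sets \<mu>"
    and I: "\<phi>0 \<in> Isom C" "\<phi>1 \<in> Isom C" and b: "base_map \<phi>0 = base_map \<phi>1"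
    and p: "inverse_pair C \<psi>0 \<psi>0'" "inverse_pair C \<psi>1 \<psi>1'" and b': "base_map \<psi>0 = base_map \<psi>1"
    and IC: "compose_maps C \<phi>0 \<psi>0 \<in> Isom C" "compose_maps C \<phi>1 \<psi>1 \<in> Isom C"
  shows "compose_maps R (mixed_map A \<phi>0 \<phi>1) (mixed_map A \<psi>0 \<psi>1)
    = mixed_map A (compose_maps C \<phi>0 \<psi>0) (compose_maps C \<phi>1 \<psi>1)"
proof -
  let ?c0 = "compose_maps C \<phi>0 \<psi>0" and ?c1 = "compose_maps C \<phi>1 \<psi>1"
  have bc: "base_map ?c0 = (\<lambda>z\<in>topspace (base C). base_map \<psi>0 (base_map \<phi>0 z))"
    "base_map ?c1 = (\<lambda>z\<in>topspace (base C). base_map \<psi>0 (base_map \<phi>0 z))"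
    by (auto simp: compose_maps_def b b')
  have "fiber_map (mixed_map A \<phi>0 \<phi>1) z (fiber_map (mixed_map A \<psi>0 \<psi>1) (base_map \<phi>0 z) c)
      = fiber_map (mixed_map A ?c0 ?c1) z c"
    if z: "z \<in> topspace (base C)" and c: "c \<in> mspace (fiber R (base_map \<psi>0 (base_map \<phi>0 z)))" for z c
  proof -
    have bb: "base_map \<psi>0 (base_map \<phi>0 z) \<in> topspace (base C)"
      using Isom_base_in[OF inverse_pair_Isom(1)[OF p(1)] Isom_base_in[OF I(1) z]] .
    have e: "base_map ?c0 z = base_map \<psi>0 (base_map \<phi>0 z)" using z bc by simp
    obtain \<xi> where \<xi>: "\<xi> \<in> L2_functions \<mu> (fiber C (base_map ?c0 z))" "c = L2_class \<mu> (fiber C (base_map ?c0 z)) \<xi>"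
      using fiber_R_class[OF bb c] unfolding e .
    have cR: "L2_class \<mu> (fiber C (base_map ?c0 z)) \<xi> \<in> mspace (fiber R (base_map ?c0 z))"
      using c unfolding \<xi>(2) e .
    have "fiber_map (mixed_map A ?c0 ?c1) z c = L2_class \<mu> (fiber C z) (piece A ?c0 ?c1 z \<xi>)"
      unfolding \<xi>(2) using mixed_map_class[OF A IC _ z \<xi>(1) cR] bc by simp
    also have "\<dots> = L2_class \<mu> (fiber C z) (\<lambda>\<omega>. if \<omega> \<in> A then fiber_map \<phi>1 z (fiber_map \<psi>1 (base_map \<phi>0 z) (\<xi> \<omega>))
        else fiber_map \<phi>0 z (fiber_map \<psi>0 (base_map \<phi>0 z) (\<xi> \<omega>)))"
    proof (rule L2_class_cong)
      fix \<omega> assume "\<omega> \<in> space \<mu>"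
      then have "\<xi> \<omega> \<in> mspace (fiber C (base_map ?c0 z))"
        using L2_setting.L2_in_mspace[OF L2_setting_fiber \<xi>(1)] bb e by simp
      then show "piece A ?c0 ?c1 z \<xi> \<omega> = (if \<omega> \<in> A then fiber_map \<phi>1 z (fiber_map \<psi>1 (base_map \<phi>0 z) (\<xi> \<omega>))
        else fiber_map \<phi>0 z (fiber_map \<psi>0 (base_map \<phi>0 z) (\<xi> \<omega>)))"
        using z unfolding e by (simp add: piece_def compose_maps_def b b')
    qed
    also have "\<dots> = fiber_map (mixed_map A \<phi>0 \<phi>1) z (fiber_map (mixed_map A \<psi>0 \<psi>1) (base_map \<phi>0 z) c)"
      unfolding \<xi>(2) e
      by (rule mixed_map_compose_apply[OF A I b p b' z \<xi>(1)[unfolded e] cR[unfolded e], symmetric])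
    finally show ?thesis by simp
  qed
  then have "snd (compose_maps R (mixed_map A \<phi>0 \<phi>1) (mixed_map A \<psi>0 \<psi>1))
    = (\<lambda>z\<in>topspace (base C). \<lambda>c\<in>mspace (fiber R (base_map ?c0 z)). fiber_map (mixed_map A ?c0 ?c1) z c)"
    by (auto simp: compose_maps_def bc intro!: restrict_ext)
  also have "\<dots> = snd (mixed_map A ?c0 ?c1)"
    by (auto simp: mixed_map_def intro!: restrict_ext)
  finally show ?thesis
    by (intro prod_eqI) (auto simp: bc, simp add: compose_maps_def)
qed

end

section \<open>The homotopy\<close>

text \<open>In essence \<open>A t\<close> is the preimage of \<open>[0, t)\<close> under an
  isomorphism with the unit interval, so that differences are preimages of intervals. The
  isomorphism relates completions off null sets, hence preimages are measurable only for the
  completion and must be corrected to members of \<open>sets \<mu>\<close>.\<close>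

lemma standard_probability_space_path_of_sets:
  assumes "standard_probability_space \<Omega> \<mu>"
  obtains A :: "real \<Rightarrow> 'w set" where "\<And>t. t \<in> {0..1} \<Longrightarrow> A t \<in> sets \<mu>" "A 0 = {}" "A 1 = space \<mu>"
    "\<And>s t. \<lbrakk>s \<in> {0..1}; t \<in> {0..1}\<rbrakk> \<Longrightarrow> measure \<mu> ((A s - A t) \<union> (A t - A s)) = \<bar>s - t\<bar>"
proof -
  interpret \<mu>: prob_space \<mu>
    using assms by (auto simp: standard_probability_space_def regular_borel_probability_def)
  let ?M = "completion \<mu>" and ?N = "lebesgue_on {0..1::real}"
  interpret M: prob_space ?M by (rule \<mu>.prob_space_completion)
  obtain P Q f where P: "P \<in> null_sets ?M" and Q: "Q \<in> null_sets ?N"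
    and f: "f \<in> measurable (restrict_space ?M (space ?M - P)) (restrict_space ?N (space ?N - Q))"
    and f_meas: "\<And>E. E \<in> sets (restrict_space ?N (space ?N - Q)) \<Longrightarrow>
      emeasure (restrict_space ?M (space ?M - P)) (f -` E \<inter> space (restrict_space ?M (space ?M - P)))
        = emeasure (restrict_space ?N (space ?N - Q)) E"
    using assms by (auto simp: standard_probability_space_def measure_isomorphic_def Let_def)
  define M' where "M' = restrict_space ?M (space ?M - P)"
  define N' where "N' = restrict_space ?N (space ?N - Q)"
  note f = f[folded M'_def N'_def] and f_meas = f_meas[folded M'_def N'_def]
  have P': "(space ?M - P) \<inter> space ?M \<in> sets ?M" using P by auto
  have Q': "(space ?N - Q) \<inter> space ?N \<in> sets ?N" using Q by auto
  have spN: "space N' = {0..1} - Q" by (auto simp: N'_def space_restrict_space)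
  have spM: "space M' = space ?M - P" by (auto simp: M'_def space_restrict_space)
  have f01: "f \<omega> \<in> {0..1} - Q" if "\<omega> \<in> space M'" for \<omega>
    using measurable_space[OF f that] spN by simp
  \<comment> \<open>Half-open intervals make \<open>F 0\<close> exactly empty and turn
    \<open>F t - F s\<close> into the preimage of \<open>[s, t)\<close> for
    \<open>s \<le> t\<close>. The points with value 1 are missing from \<open>F 1\<close>, but they
    form a null set.\<close>
  define F where "F = (\<lambda>t. f -` {..<t} \<inter> space M')"
  have setsM': "S \<in> sets ?M" if "S \<in> sets M'" for S
    using that sets_restrict_space_iff[OF P'] by (simp add: M'_def)
  have interval: "{s..<t} - Q \<in> sets N'" "emeasure N' ({s..<t} - Q) = ennreal (t - s)"
    if st: "s \<in> {0..1}" "t \<in> {0..1}" "s \<le> t" for s t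
  proof -
    have I: "{s..<t} \<in> sets ?N" using st by (auto simp: sets_restrict_space_iff)
    then have "{s..<t} - Q \<in> sets ?N" using Q by auto
    then show "{s..<t} - Q \<in> sets N'"
      using st unfolding N'_def sets_restrict_space_iff[OF Q'] by auto
    have "emeasure N' ({s..<t} - Q) = emeasure ?N ({s..<t} - Q)"
      unfolding N'_def using st by (intro emeasure_restrict_space Q') auto
    also have "\<dots> = emeasure ?N {s..<t}" by (rule emeasure_Diff_null_set[OF Q I])
    also have "\<dots> = emeasure lebesgue {s..<t}" using st by (intro emeasure_restrict_space) auto
    also have "\<dots> = ennreal (t - s)" using st by simp
    finally show "emeasure N' ({s..<t} - Q) = ennreal (t - s)" .
  qed
  have F_sets: "F t \<in> sets ?M" if t: "t \<in> {0..1}" for t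
  proof -
    have "F t = f -` ({0..<t} - Q) \<inter> space M'" using f01 by (auto simp: F_def)
    also have "\<dots> \<in> sets M'" using measurable_sets[OF f interval(1)[of 0 t]] t by simp
    finally show ?thesis by (rule setsM')
  qed
  have F_diff: "measure ?M (F t - F s) = t - s" if st: "s \<in> {0..1}" "t \<in> {0..1}" "s \<le> t" for s t
  proof -
    have e: "F t - F s = f -` ({s..<t} - Q) \<inter> space M'" using f01 by (auto simp: F_def)
    have "emeasure ?M (F t - F s) = emeasure M' (F t - F s)"
      unfolding M'_def by (rule emeasure_restrict_space[OF P', symmetric]) (auto simp: F_def spM)
    also have "\<dots> = ennreal (t - s)" unfolding e using f_meas interval[OF st] by simp
    finally show ?thesis using st(3) by (simp add: measure_def)
  qed
  have F_sub: "F s \<subseteq> F t" if "s \<le> t" for s t using that by (auto simp: F_def)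
  have F_sym: "measure ?M ((F s - F t) \<union> (F t - F s)) = \<bar>s - t\<bar>" if st: "s \<in> {0..1}" "t \<in> {0..1}" for s t
  proof (cases "s \<le> t")
    case True
    then have "(F s - F t) \<union> (F t - F s) = F t - F s" using F_sub by blast
    then show ?thesis using F_diff[OF st True] True by simp
  next
    case False
    then have "(F s - F t) \<union> (F t - F s) = F s - F t" using F_sub[of t s] by auto
    then show ?thesis using F_diff[OF st(2,1)] False by simp
  qed
  have F0: "F 0 = {}" using f01 by (fastforce simp: F_def)
  have F1: "AE \<omega> in ?M. \<omega> \<in> F 1"
    using F_diff[of 0 1] F0 by (intro M.AE_prob_1) simp
  \<comment> \<open>\<open>main_part\<close> trades a set of the completion for one in
    \<open>sets \<mu>\<close> up to a null set. The ends are prescribed so that the glued maps there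
    are literally the given randomized maps.\<close>
  define A where "A = (\<lambda>t. if t = 0 then {} else if t = 1 then space \<mu> else main_part \<mu> (F t))"
  have A_sets: "A t \<in> sets \<mu>" if "t \<in> {0..1}" for t
    using F_sets[OF that] by (auto simp: A_def)
  have A_F: "AE \<omega> in ?M. \<omega> \<in> A t \<longleftrightarrow> \<omega> \<in> F t" if t: "t \<in> {0..1}" for t
  proof -
    consider "t = 0" | "t = 1" | "A t = main_part \<mu> (F t)" unfolding A_def by argo
    then show ?thesis
    proof cases
      case 1 then show ?thesis by (simp add: A_def F0)
    next
      case 2 then show ?thesis using F1 AE_space[of ?M] by (auto simp: A_def elim: eventually_elim2)
    next
      case 3
      have "AE \<omega> in ?M. \<omega> \<notin> null_part \<mu> (F t)"
        using null_part_null_sets[OF F_sets[OF t]] by (rule AE_not_in)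
      then show ?thesis
        by (rule AE_mp) (use main_part_null_part_Un[OF F_sets[OF t]] 3 in auto)
    qed
  qed
  have "measure \<mu> ((A s - A t) \<union> (A t - A s)) = \<bar>s - t\<bar>" if st: "s \<in> {0..1}" "t \<in> {0..1}" for s t
  proof -
    have S: "(A s - A t) \<union> (A t - A s) \<in> sets \<mu>" using A_sets st by auto
    then have "measure \<mu> ((A s - A t) \<union> (A t - A s)) = measure ?M ((A s - A t) \<union> (A t - A s))" by simp
    also have "\<dots> = measure ?M ((F s - F t) \<union> (F t - F s))"
    proof (rule measure_eq_AE)
      show "AE \<omega> in ?M. \<omega> \<in> (A s - A t) \<union> (A t - A s) \<longleftrightarrow> \<omega> \<in> (F s - F t) \<union> (F t - F s)"
        using A_F[OF st(1)] A_F[OF st(2)] by eventually_elim auto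
    qed (use S F_sets st in auto)
    finally show ?thesis using F_sym[OF st] by simp
  qed
  then show ?thesis using that[of A] A_sets by (auto simp: A_def)
qed

section \<open>Inverses of the automorphisms in an action\<close>

lemma isometric_action_Isom: "\<lbrakk>isometric_action G C \<alpha>; g \<in> carrier G\<rbrakk> \<Longrightarrow> \<alpha> g \<in> Isom C"
  by (auto simp: isometric_action_def hom_def Isom_group_def)

lemma isometric_action_mult:
  "\<lbrakk>isometric_action G C \<alpha>; g \<in> carrier G; h \<in> carrier G\<rbrakk> \<Longrightarrow> \<alpha> (g \<otimes>\<^bsub>G\<^esub> h) = compose_maps C (\<alpha> g) (\<alpha> h)"
  by (auto simp: isometric_action_def hom_def Isom_group_def)

text \<open>\<open>hom\<close> demands only multiplicativity, so the image of the unit is at first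
  just idempotent. An injective idempotent map is the identity; this is applied on the base and then
  in every fiber.\<close>

lemma Isom_idempotent:
  assumes e: "e \<in> Isom C" and ee: "compose_maps C e e = e"
  shows "e = one (Isom_group C)"
proof -
  let ?Z = "topspace (base C)"
  have bb: "base_map e (base_map e z) = base_map e z" if "z \<in> ?Z" for z
  proof -
    have "base_map (compose_maps C e e) z = base_map e z" by (simp add: ee)
    then show ?thesis using that by (simp add: compose_maps_def)
  qed
  have "inj_on (base_map e) ?Z" using e by (auto simp: Isom_def intro: homeomorphic_imp_injective_map)
  then have b: "base_map e z = z" if "z \<in> ?Z" for z
    using bb[OF that] Isom_base_in[OF e that] that by (auto dest: inj_onD)
  have f: "fiber_map e z x = x" if z: "z \<in> ?Z" and x: "x \<in> mspace (fiber C z)" for z x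
  proof -
    have "fiber_map (compose_maps C e e) z x = fiber_map e z x" by (simp add: ee)
    then have "fiber_map e z (fiber_map e z x) = fiber_map e z x"
      using z x by (simp add: compose_maps_def b)
    moreover have "inj_on (fiber_map e z) (mspace (fiber C z))" "fiber_map e z x \<in> mspace (fiber C z)"
      using Isom_fiber(1,2)[OF e z] x by (auto simp: b[OF z] bij_betw_def)
    ultimately show ?thesis using x by (auto dest: inj_onD)
  qed
  have ext: "base_map e \<in> extensional ?Z" "fiber_map e \<in> extensional ?Z"
    "\<And>z. z \<in> ?Z \<Longrightarrow> fiber_map e z \<in> extensional (mspace (fiber C z))"
    using e b by (auto simp: Isom_def Let_def)
  have "base_map e = (\<lambda>z\<in>?Z. z)"
    using ext(1) b by (intro extensionalityI[of _ ?Z]) auto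
  moreover have "fiber_map e = (\<lambda>z\<in>?Z. \<lambda>x\<in>mspace (fiber C z). x)"
    using ext(2)
  proof (rule extensionalityI)
    fix z assume z: "z \<in> ?Z"
    show "fiber_map e z = (\<lambda>z\<in>?Z. \<lambda>x\<in>mspace (fiber C z). x) z"
      using ext(3)[OF z] f[OF z] z by (intro extensionalityI[of _ "mspace (fiber C z)"]) auto
  qed simp
  ultimately show ?thesis by (simp add: Isom_group_def prod_eq_iff)
qed

lemma isometric_action_inverse_pair:
  assumes "group G" and \<alpha>: "isometric_action G C \<alpha>" and g: "g \<in> carrier G"
  shows "inverse_pair C (\<alpha> g) (\<alpha> (inv\<^bsub>G\<^esub> g))"
proof -
  interpret group G by fact
  have "\<alpha> \<one>\<^bsub>G\<^esub> = one (Isom_group C)"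
    using isometric_action_mult[OF \<alpha> one_closed one_closed]
    by (intro Isom_idempotent isometric_action_Isom[OF \<alpha>]) auto
  then show ?thesis
    using isometric_action_mult[OF \<alpha> g inv_closed[OF g]] isometric_action_mult[OF \<alpha> inv_closed[OF g] g]
      isometric_action_Isom[OF \<alpha>] g by (simp add: inverse_pair_def)
qed

section \<open>Continuity in the gluing set and in time\<close>

context field_setting
begin

text \<open>Two gluings of the same pair of functions agree off the symmetric difference of the
  sets, and on it they are at most \<open>M\<close> apart.\<close>

lemma mixed_map_slice_class_dist:
  assumes A: "A \<in> sets \<mu>" "B \<in> sets \<mu>" and p: "inverse_pair C \<phi>0 \<psi>0" "inverse_pair C \<phi>1 \<psi>1"
    and b: "base_map \<phi>0 = base_map \<phi>1" and s: "s \<in> prod_sections"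
    and z: "z \<in> topspace (base C)"
    and bound: "\<And>\<omega>. \<omega> \<in> topspace \<Omega> \<Longrightarrow> mdist (fiber C z) (pull \<phi>0 s (z, \<omega>)) (pull \<phi>1 s (z, \<omega>)) \<le> M"
  shows "mdist (L2_fiber z) (fiber_map (mixed_map A \<phi>0 \<phi>1) z (slice_class s (base_map \<phi>0 z)))
      (fiber_map (mixed_map B \<phi>0 \<phi>1) z (slice_class s (base_map \<phi>0 z)))
    \<le> sqrt (M\<^sup>2 * measure \<mu> ((A - B) \<union> (B - A)))"
proof -
  interpret \<mu>: prob_space \<mu> by (rule prob_space_\<mu>)
  interpret L2_setting \<mu> "fiber C z" by (rule L2_setting_fiber[OF z])
  note I = inverse_pair_Isom(1)[OF p(1)] inverse_pair_Isom(1)[OF p(2)] b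
  let ?D = "(A - B) \<union> (B - A)" and ?X = "fiber C z"
  let ?m = "\<lambda>A \<omega>. if \<omega> \<in> A then pull \<phi>1 s (z, \<omega>) else pull \<phi>0 s (z, \<omega>)"
  have D: "?D \<in> sets \<mu>" using A by auto
  have t: "pull \<phi>0 s \<in> prod_sections" "pull \<phi>1 s \<in> prod_sections"
    using prod_section_pull[OF p(1) s] prod_section_pull[OF p(2) s] .
  have L: "?m A \<in> L2_functions \<mu> ?X" "?m B \<in> L2_functions \<mu> ?X"
    using L2_mix[OF A(1) prod_section_L2[OF t(2) z] prod_section_L2[OF t(1) z]]
      L2_mix[OF A(2) prod_section_L2[OF t(2) z] prod_section_L2[OF t(1) z]] .
  have pt: "(mdist ?X (?m A \<omega>) (?m B \<omega>))\<^sup>2 \<le> M\<^sup>2 * indicator ?D \<omega>" if "\<omega> \<in> space \<mu>" for \<omega>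
  proof -
    have \<omega>: "\<omega> \<in> topspace \<Omega>" using that by simp
    define x y where "x = pull \<phi>0 s (z, \<omega>)" and "y = pull \<phi>1 s (z, \<omega>)"
    have "x \<in> mspace ?X" "y \<in> mspace ?X"
      using prod_section_in[OF t(1) z \<omega>] prod_section_in[OF t(2) z \<omega>] unfolding x_def y_def .
    moreover have "(mdist ?X x y)\<^sup>2 \<le> M\<^sup>2" "(mdist ?X y x)\<^sup>2 \<le> M\<^sup>2"
      using bound[OF \<omega>] by (auto intro!: power_mono simp: x_def y_def mdist_commute simp del: restrict_apply)
    ultimately have "(mdist ?X (if \<omega> \<in> A then y else x) (if \<omega> \<in> B then y else x))\<^sup>2 \<le> M\<^sup>2 * indicator ?D \<omega>"
      by (auto simp: indicator_def)
    then show ?thesis unfolding x_def y_def .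
  qed
  have "(\<integral>\<omega>. (mdist ?X (?m A \<omega>) (?m B \<omega>))\<^sup>2 \<partial>\<mu>) \<le> (\<integral>\<omega>. M\<^sup>2 * indicator ?D \<omega> \<partial>\<mu>)"
  proof (rule integral_mono[OF L2_integrable[OF L] _ pt])
    show "integrable \<mu> (\<lambda>\<omega>. M\<^sup>2 * indicator ?D \<omega>)"
      using D by (intro integrable_mult_right) (simp add: \<mu>.emeasure_eq_measure)
  qed
  also have "\<dots> = M\<^sup>2 * measure \<mu> ?D" using D sets.sets_into_space[OF D] by (simp add: Int_absorb2)
  finally have "L2_dist (?m A) (?m B) \<le> sqrt (M\<^sup>2 * measure \<mu> ?D)" by (rule real_sqrt_le_mono)
  then show ?thesis
    unfolding mixed_map_slice_class_pull[OF A(1) I z s] mixed_map_slice_class_pull[OF A(2) I z s]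
      mdist_L2_space[OF L] .
qed

text \<open>Uniformity on \<open>K\<close> holds because a section of the randomization is locally close to the class of
  a continuous section over the product, and such sections are bounded by compactness of \<open>\<Omega>\<close>.\<close>

lemma mixed_map_continuous:
  assumes p: "inverse_pair C \<phi>0 \<psi>0" "inverse_pair C \<phi>1 \<psi>1" and b: "base_map \<phi>0 = base_map \<phi>1"
    and \<sigma>: "\<sigma> \<in> sections R" and K: "compactin (base C) K" and \<epsilon>: "0 < \<epsilon>"
  obtains \<delta> where "0 < \<delta>"
    "\<And>A B z. \<lbrakk>A \<in> sets \<mu>; B \<in> sets \<mu>; measure \<mu> ((A - B) \<union> (B - A)) < \<delta>; z \<in> K\<rbrakk> \<Longrightarrow>
      mdist (L2_fiber z) (apply_section R (mixed_map A \<phi>0 \<phi>1) \<sigma> z)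
        (apply_section R (mixed_map B \<phi>0 \<phi>1) \<sigma> z) < \<epsilon>"
proof -
  note I = inverse_pair_Isom(1)[OF p(1)] inverse_pair_Isom(1)[OF p(2)] b
  have \<sigma>_in: "\<sigma> z \<in> mspace (fiber R z)" if "z \<in> topspace (base C)" for z
    using \<sigma> that by (auto simp: sections_R_iff all_sections_def)
  let ?d = "\<lambda>A B z. mdist (L2_fiber z) (apply_section R (mixed_map A \<phi>0 \<phi>1) \<sigma> z)
        (apply_section R (mixed_map B \<phi>0 \<phi>1) \<sigma> z)"
  have "\<exists>U \<delta>. openin (base C) U \<and> z0 \<in> U \<and> 0 < \<delta> \<and> (\<forall>A\<in>sets \<mu>. \<forall>B\<in>sets \<mu>. \<forall>z\<in>U.
      measure \<mu> ((A - B) \<union> (B - A)) < \<delta> \<longrightarrow> ?d A B z < \<epsilon>)" if "z0 \<in> K" for z0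
  proof -
    have z0: "z0 \<in> topspace (base C)" using K \<open>z0 \<in> K\<close> compactin_subset_topspace by blast
    note bz0 = Isom_base_in[OF I(1) z0]
    have "0 < \<epsilon> / 3" using \<epsilon> by simp
    then obtain s where s: "s \<in> prod_sections"
      "mdist (L2_fiber (base_map \<phi>0 z0)) (\<sigma> (base_map \<phi>0 z0)) (slice_class s (base_map \<phi>0 z0)) < \<epsilon> / 3"
      using \<sigma>_in[OF bz0] unfolding fiber_R_iff[OF bz0] by blast
    \<comment> \<open>Precomposed with the base map because an automorphism evaluates a section at
      \<open>base_map \<phi>0 z\<close>. As glued maps are isometric, \<open>?h\<close> measures the
      approximation error after applying them, whatever the gluing set.\<close>
    let ?h = "(\<lambda>z. mdist (L2_fiber z) (\<sigma> z) (slice_class s z)) \<circ> base_map \<phi>0"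
    have "cocontinuous (base C) L2_fiber \<sigma> (slice_class s)"
      using \<sigma> s(1) by (simp only: sections_R_iff)
    then have "continuous_map (base C) euclideanreal ?h"
      unfolding cocontinuous_def by (rule continuous_map_compose[OF Isom_base_continuous[OF I(1)]])
    then have U1: "openin (base C) {z \<in> topspace (base C). ?h z < \<epsilon> / 3}" (is "openin _ ?U1")
      by (rule openin_continuous_map_less)
    have "z0 \<in> ?U1" using s(2) z0 by (simp only: mem_Collect_eq comp_apply simp_thms)
    obtain U2 M where U2: "openin (base C) U2" "z0 \<in> U2" and M: "0 < M"
      and bound: "\<And>z \<omega>. \<lbrakk>z \<in> U2; \<omega> \<in> topspace \<Omega>\<rbrakk> \<Longrightarrow>
        mdist (fiber C z) (pull \<phi>0 s (z, \<omega>)) (pull \<phi>1 s (z, \<omega>)) \<le> M"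
      using prod_sections_bounded[OF prod_section_pull[OF p(1) s(1)] prod_section_pull[OF p(2) s(1)] z0] by blast
    \<comment> \<open>Makes \<open>sqrt (M\<^sup>2 * \<delta>)\<close> equal to
      \<open>\<epsilon> / 3\<close>. The other two thirds pay for replacing \<open>\<sigma>\<close>
      by the slice class under either gluing.\<close>
    define \<delta> where "\<delta> = (\<epsilon> / (3 * M))\<^sup>2"
    have "0 < \<delta>" using \<epsilon> M by (simp add: \<delta>_def)
    moreover have "?d A B z < \<epsilon>" if A: "A \<in> sets \<mu>" "B \<in> sets \<mu>"
      and z: "z \<in> ?U1 \<inter> U2" and m: "measure \<mu> ((A - B) \<union> (B - A)) < \<delta>" for A B z
    proof -
      have zZ: "z \<in> topspace (base C)" and h: "?h z < \<epsilon> / 3" and zU2: "z \<in> U2" using z by auto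
      note bz = Isom_base_in[OF I(1) zZ]
      note c = \<sigma>_in[OF bz] and c' = slice_class_in_R[OF s(1) bz]
      let ?a = "\<lambda>A. fiber_map (mixed_map A \<phi>0 \<phi>1) z (\<sigma> (base_map \<phi>0 z))"
      let ?b = "\<lambda>A. fiber_map (mixed_map A \<phi>0 \<phi>1) z (slice_class s (base_map \<phi>0 z))"
      have in_L2: "?a A \<in> mspace (L2_fiber z)" "?b A \<in> mspace (L2_fiber z)"
        "?a B \<in> mspace (L2_fiber z)" "?b B \<in> mspace (L2_fiber z)"
        using mixed_map_in_L2[OF A(1) I zZ c] mixed_map_in_L2[OF A(1) I zZ c']
          mixed_map_in_L2[OF A(2) I zZ c] mixed_map_in_L2[OF A(2) I zZ c'] .
      have ab: "mdist (L2_fiber z) (?a A) (?b A) < \<epsilon> / 3" "mdist (L2_fiber z) (?a B) (?b B) < \<epsilon> / 3"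
        using h mixed_map_dist[OF A(1) I zZ c c'] mixed_map_dist[OF A(2) I zZ c c'] by (simp_all only: comp_apply)
      have "mdist (L2_fiber z) (?b A) (?b B) \<le> sqrt (M\<^sup>2 * measure \<mu> ((A - B) \<union> (B - A)))"
        by (rule mixed_map_slice_class_dist[OF A p b s(1) zZ bound[OF zU2]])
      also have "\<dots> < sqrt (M\<^sup>2 * \<delta>)" using m M by (intro real_sqrt_less_mono mult_strict_left_mono) auto
      also have "M\<^sup>2 * \<delta> = (\<epsilon> / 3)\<^sup>2" using M by (simp add: \<delta>_def power_divide power_mult_distrib)
      also have "sqrt \<dots> = \<epsilon> / 3" using \<epsilon> by simp
      finally have bb: "mdist (L2_fiber z) (?b A) (?b B) < \<epsilon> / 3" .
      have "mdist (L2_fiber z) (?a A) (?a B) < \<epsilon>"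
        using mdist_triangle[OF in_L2(1,2,3)] mdist_triangle[OF in_L2(2,4,3)] ab bb
          mdist_commute[of "L2_fiber z" "?a B" "?b B"] by linarith
      then show ?thesis using zZ by (simp add: apply_section_def)
    qed
    ultimately show ?thesis
      using U1 \<open>z0 \<in> ?U1\<close> U2 by (intro exI[of _ "?U1 \<inter> U2"] exI[of _ \<delta>]) (blast intro: openin_Int)
  qed
  then obtain U \<delta> where U: "\<And>z. z \<in> K \<Longrightarrow> openin (base C) (U z)" "\<And>z. z \<in> K \<Longrightarrow> z \<in> U z"
    and \<delta>: "\<And>z. z \<in> K \<Longrightarrow> 0 < (\<delta> z :: real)"
    and d: "\<And>z0 A B z. \<lbrakk>z0 \<in> K; A \<in> sets \<mu>; B \<in> sets \<mu>; z \<in> U z0;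
      measure \<mu> ((A - B) \<union> (B - A)) < \<delta> z0\<rbrakk> \<Longrightarrow> ?d A B z < \<epsilon>"
    by metis
  obtain T where T: "finite T" "T \<subseteq> K" "K \<subseteq> \<Union> (U ` T)"
    using compactinD[OF K, of "U ` K"] U by (smt (verit) UN_I finite_subset_image imageE subsetI)
  \<comment> \<open>The inserted 1 keeps the minimum meaningful when the finite subcover is empty,
    that is for empty \<open>K\<close>.\<close>
  define \<delta>' where "\<delta>' = Min (insert 1 (\<delta> ` T))"
  have "0 < \<delta>'" using T \<delta> by (auto simp: \<delta>'_def)
  moreover have "?d A B z < \<epsilon>" if AB: "A \<in> sets \<mu>" "B \<in> sets \<mu>"
      "measure \<mu> ((A - B) \<union> (B - A)) < \<delta>'" "z \<in> K" for A B z
  proof -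
    obtain z0 where z0: "z0 \<in> T" "z \<in> U z0" using T(3) AB(4) by blast
    have "\<delta>' \<le> \<delta> z0" using T(1) z0(1) by (auto simp: \<delta>'_def)
    then show ?thesis using d[of z0 A B z] z0 T(2) AB by auto
  qed
  ultimately show ?thesis using that by blast
qed

text \<open>As \<open>G\<close> is discrete, a neighbourhood of \<open>(g, t)\<close> may fix
  \<open>g\<close>, and joint continuity becomes continuity in \<open>t\<close>. There the measure
  of the symmetric difference is exactly the elapsed time.\<close>

lemma mixed_map_homotopy:
  assumes G: "group G" and \<alpha>: "isometric_action G C \<alpha>0" "isometric_action G C \<alpha>1"
    and b: "\<And>g. g \<in> carrier G \<Longrightarrow> base_map (\<alpha>0 g) = base_map (\<alpha>1 g)"
    and A: "\<And>t. t \<in> {0..1} \<Longrightarrow> A t \<in> sets \<mu>"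
    and m: "\<And>s t. \<lbrakk>s \<in> {0..1}; t \<in> {0..1}\<rbrakk> \<Longrightarrow> measure \<mu> ((A s - A t) \<union> (A t - A s)) = \<bar>s - t\<bar>"
  shows "homotopy_of_actions (discrete_topology (carrier G)) G R (\<lambda>t g. mixed_map (A t) (\<alpha>0 g) (\<alpha>1 g))"
proof -
  interpret group G by fact
  let ?\<beta> = "\<lambda>t g. mixed_map (A t) (\<alpha>0 g) (\<alpha>1 g)"
  have p: "inverse_pair C (\<alpha>0 g) (\<alpha>0 (inv\<^bsub>G\<^esub> g))" "inverse_pair C (\<alpha>1 g) (\<alpha>1 (inv\<^bsub>G\<^esub> g))"
    if "g \<in> carrier G" for g
    using isometric_action_inverse_pair[OF G \<alpha>(1) that] isometric_action_inverse_pair[OF G \<alpha>(2) that] .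
  have \<beta>_Isom: "?\<beta> t g \<in> Isom R" if "t \<in> {0..1}" "g \<in> carrier G" for t g
    using mixed_map_Isom[OF A[OF that(1)] p[OF that(2)] b[OF that(2)] b[OF inv_closed[OF that(2)]]] .
  have "isometric_action G R (?\<beta> t)" if t: "t \<in> {0..1}" for t
    unfolding isometric_action_def
  proof (rule homI)
    show "?\<beta> t g \<in> carrier (Isom_group R)" if "g \<in> carrier G" for g
      using \<beta>_Isom[OF t that] by (simp add: Isom_group_def)
    show "?\<beta> t (g \<otimes>\<^bsub>G\<^esub> h) = ?\<beta> t g \<otimes>\<^bsub>Isom_group R\<^esub> ?\<beta> t h"
      if gh: "g \<in> carrier G" "h \<in> carrier G" for g h
    proof -
      note gh' = m_closed[OF gh]
      have "compose_maps R (?\<beta> t g) (?\<beta> t h)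
        = mixed_map (A t) (compose_maps C (\<alpha>0 g) (\<alpha>0 h)) (compose_maps C (\<alpha>1 g) (\<alpha>1 h))"
        using isometric_action_Isom[OF \<alpha>(1) gh'] isometric_action_Isom[OF \<alpha>(2) gh']
          isometric_action_Isom[OF \<alpha>(1) gh(1)] isometric_action_Isom[OF \<alpha>(2) gh(1)]
        unfolding isometric_action_mult[OF \<alpha>(1) gh] isometric_action_mult[OF \<alpha>(2) gh]
        by (intro mixed_map_compose[OF A[OF t] _ _ b[OF gh(1)] p[OF gh(2)] b[OF gh(2)]])
      then show ?thesis
        by (simp add: Isom_group_def isometric_action_mult[OF \<alpha>(1) gh] isometric_action_mult[OF \<alpha>(2) gh])
    qed
  qed
  moreover have "continuous_map (prod_topology (discrete_topology (carrier G)) (top_of_set {0..1}))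
      (Isom_topology R) (\<lambda>(g, t). ?\<beta> t g)"
    unfolding continuous_map_def
  proof (intro conjI allI impI)
    have "openin (Isom_topology R) (Isom R)"
      unfolding openin_Isom_topology by (intro conjI ballI exI[of _ "{}"]) auto
    then have "Isom R \<subseteq> topspace (Isom_topology R)" by (rule openin_subset)
    then show "(\<lambda>(g, t). ?\<beta> t g) \<in> topspace (prod_topology (discrete_topology (carrier G)) (top_of_set {0..1}))
        \<rightarrow> topspace (Isom_topology R)"
      using \<beta>_Isom by auto
    fix U assume U: "openin (Isom_topology R) U"
    let ?S = "{x \<in> topspace (prod_topology (discrete_topology (carrier G)) (top_of_set {0..1})).
      (case x of (g, t) \<Rightarrow> ?\<beta> t g) \<in> U}"
    show "openin (prod_topology (discrete_topology (carrier G)) (top_of_set {0..1})) ?S"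
      unfolding openin_prod_topology_alt
    proof (intro allI impI)
      fix g t assume "(g, t) \<in> ?S"
      then have g: "g \<in> carrier G" and t: "t \<in> {0..1}" and "?\<beta> t g \<in> U" by auto
      then obtain \<F> where F: "finite \<F>" "\<F> \<subseteq> Isom_subbase R (?\<beta> t g)" "Isom R \<inter> \<Inter>\<F> \<subseteq> U"
        using U unfolding openin_Isom_topology by blast
      have "\<exists>\<delta>>0. \<forall>t'\<in>{0..1}. \<bar>t' - t\<bar> < \<delta> \<longrightarrow> ?\<beta> t' g \<in> W" if "W \<in> \<F>" for W
      proof -
        obtain L V K \<sigma> \<epsilon> where W: "W = {\<psi> \<in> Isom R. base_map \<psi> ` L \<subseteq> V \<and>
            (\<forall>z\<in>K. mdist (fiber R z) (apply_section R \<psi> \<sigma> z) (apply_section R (?\<beta> t g) \<sigma> z) < \<epsilon>)}"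
          and LV: "base_map (?\<beta> t g) ` L \<subseteq> V" and \<sigma>: "\<sigma> \<in> sections R"
          and K: "compactin (base R) K" and \<epsilon>: "0 < \<epsilon>"
        proof -
          have "W \<in> Isom_subbase R (?\<beta> t g)" using F(2) \<open>W \<in> \<F>\<close> by (rule subsetD)
          then show thesis
            unfolding Isom_subbase_def mem_Collect_eq by (elim exE conjE) (rule that)
        qed
        obtain \<delta> where \<delta>: "0 < \<delta>"
          "\<And>A B z. \<lbrakk>A \<in> sets \<mu>; B \<in> sets \<mu>; measure \<mu> ((A - B) \<union> (B - A)) < \<delta>; z \<in> K\<rbrakk> \<Longrightarrow>
            mdist (L2_fiber z) (apply_section R (mixed_map A (\<alpha>0 g) (\<alpha>1 g)) \<sigma> z)
              (apply_section R (mixed_map B (\<alpha>0 g) (\<alpha>1 g)) \<sigma> z) < \<epsilon>"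
          using mixed_map_continuous[OF p[OF g] b[OF g] \<sigma> K[unfolded base_R] \<epsilon>] by blast
        \<comment> \<open>The base map of \<open>?\<beta> t' g\<close> is that of
          \<open>\<alpha>0 g\<close> for every \<open>t'\<close>, so the condition on
          \<open>L\<close> and \<open>V\<close> is inherited; only the distance condition on
          \<open>K\<close> depends on time.\<close>
        have "?\<beta> t' g \<in> W" if "t' \<in> {0..1}" "\<bar>t' - t\<bar> < \<delta>" for t'
          unfolding W using \<beta>_Isom[OF that(1) g] LV \<delta>(2)[OF A[OF that(1)] A[OF t]] m[OF that(1) t] that(2)
          by simp
        then show ?thesis using \<delta>(1) by blast
      qed
      then obtain \<delta> where \<delta>: "\<And>W. W \<in> \<F> \<Longrightarrow> 0 < (\<delta> W :: real)"
        "\<And>W t'. \<lbrakk>W \<in> \<F>; t' \<in> {0..1}; \<bar>t' - t\<bar> < \<delta> W\<rbrakk> \<Longrightarrow> ?\<beta> t' g \<in> W"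
        by metis
      define e where "e = Min (insert 1 (\<delta> ` \<F>))"
      have e: "0 < e" "\<And>W. W \<in> \<F> \<Longrightarrow> e \<le> \<delta> W" using F(1) \<delta>(1) by (auto simp: e_def)
      have "openin (top_of_set {0..1}) ({0..1} \<inter> ball t e)"
        by (rule openin_open_Int) simp
      moreover have "{g} \<times> ({0..1} \<inter> ball t e) \<subseteq> ?S"
      proof clarsimp
        fix t' assume t': "0 \<le> t'" "t' \<le> 1" "dist t t' < e"
        then have "?\<beta> t' g \<in> W" if "W \<in> \<F>" for W
          using \<delta>(2)[OF that, of t'] e(2)[OF that] by (simp add: dist_real_def abs_minus_commute)
        then show "g \<in> carrier G \<and> ?\<beta> t' g \<in> U" using \<beta>_Isom[of t' g] t' g F(3) by auto
      qed
      ultimately show "\<exists>V W. openin (discrete_topology (carrier G)) V \<and> openin (top_of_set {0..1}) W \<and>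
          g \<in> V \<and> t \<in> W \<and> V \<times> W \<subseteq> ?S"
        using g t e(1) by (intro exI[of _ "{g}"] exI[of _ "{0..1} \<inter> ball t e"]) auto
    qed
  qed
  ultimately show ?thesis unfolding homotopy_of_actions_def by blast
qed

end

theorem lemma8p4:
  fixes C :: "('z, 'a) metric_field"
    and G :: "('g, 'm) monoid_scheme"
    and \<alpha>\<^sub>0 \<alpha>\<^sub>1 :: "'g \<Rightarrow> ('z, 'a) field_map"
    and \<Omega> :: "'w topology"
    and \<mu> :: "'w measure"
  assumes "continuous_field TYPE('h::{real_inner, complete_space}) C"
    and "second_countable_field C"
    and "group G"
    and "isometric_action G C \<alpha>\<^sub>0"
    and "isometric_action G C \<alpha>\<^sub>1"
    and "\<forall>g\<in>carrier G. base_map (\<alpha>\<^sub>0 g) = base_map (\<alpha>\<^sub>1 g)"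
    and "standard_probability_space \<Omega> \<mu>"
  shows "\<exists>\<beta> :: real \<Rightarrow> 'g \<Rightarrow> ('z, ('w \<Rightarrow> 'a) set) field_map.
           homotopy_of_actions (discrete_topology (carrier G)) G (randomization \<Omega> \<mu> C) \<beta> \<and>
           (\<forall>g\<in>carrier G. \<beta> 0 g = randomized_action \<Omega> \<mu> C \<alpha>\<^sub>0 g) \<and>
           (\<forall>g\<in>carrier G. \<beta> 1 g = randomized_action \<Omega> \<mu> C \<alpha>\<^sub>1 g) \<and>
           (\<forall>t\<in>{0..1}. \<forall>g\<in>carrier G. base_map (\<beta> 0 g) = base_map (\<beta> t g))"
proof -
  interpret field_setting C \<Omega> \<mu>
    using assms(1,2,7)
    by unfold_locales
      (auto simp: continuous_field_def second_countable_field_def Hilbert_Hadamard_def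
        standard_probability_space_def)
  obtain A :: "real \<Rightarrow> 'w set" where A: "\<And>t. t \<in> {0..1} \<Longrightarrow> A t \<in> sets \<mu>" "A 0 = {}" "A 1 = space \<mu>"
    "\<And>s t. \<lbrakk>s \<in> {0..1}; t \<in> {0..1}\<rbrakk> \<Longrightarrow> measure \<mu> ((A s - A t) \<union> (A t - A s)) = \<bar>s - t\<bar>"
    using standard_probability_space_path_of_sets[OF assms(7)] by blast
  show ?thesis
  proof (intro exI conjI ballI)
    show "homotopy_of_actions (discrete_topology (carrier G)) G R (\<lambda>t g. mixed_map (A t) (\<alpha>\<^sub>0 g) (\<alpha>\<^sub>1 g))"
      using assms(6) by (intro mixed_map_homotopy assms(3,4,5) A) auto
    fix g assume "g \<in> carrier G"
    \<comment> \<open>The rule \<open>space_\<mu>\<close> is withheld so that \<open>A 1\<close>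
      stays \<open>space \<mu>\<close>, the form in which \<open>mixed_map_space\<close>
      matches.\<close>
    then show "mixed_map (A 0) (\<alpha>\<^sub>0 g) (\<alpha>\<^sub>1 g) = randomized_action \<Omega> \<mu> C \<alpha>\<^sub>0 g"
      "mixed_map (A 1) (\<alpha>\<^sub>0 g) (\<alpha>\<^sub>1 g) = randomized_action \<Omega> \<mu> C \<alpha>\<^sub>1 g"
      using assms(6) by (simp_all add: randomized_action_def A(2,3) mixed_map_empty mixed_map_space del: space_\<mu>)
  qed simp
qed

end
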